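(* Let $d\ge1$ be an integer, $\varepsilon\in(0,1)$ and $1\le p<\infty$. There exists a constant $C>0$, depending only on $p$ and $d$ (and $\varepsilon$), such that for all $e\in\mathbb{S}^d$, $\alpha\in(0,\pi-\varepsilon]$, all positive integers $n$, every finite subset $\Lambda$ of $B(e,\alpha)$ and every $f\in\Pi_n^d$, $$\sum_{\omega\in\Lambda}|f(\omega)|^p\,\triangle_{1/n}(\omega)\le C\,\tau\int_{B(e,\alpha)}|f(x)|^p\,d\sigma(x),$$ where $$\tau=\max_{x\in B(e,\alpha)}\#\bigl(\Lambda\cap B_\rho(x,\tfrac1n)\bigr).$$
   Context: $\mathbb{S}^d$ is the unit sphere of $\mathbb{R}^{d+1}$ with the usual rotation invariant (Lebesgue surface) measure $d\sigma$. $d(x,y)=\arccos (x\cdot y)$ is the geodesic distance, and $B(e,\alpha)=\{x\in\mathbb{S}^d: d(x,e)\le\alpha\}$. $\Pi_n^d$ is the space of spherical polynomials of degree at most $n$, i.e. restrictions to $\mathbb{S}^d$ of polynomials in $d+1$ variables of total degree at most $n$. For $x,y\in B(e,\alpha)$ put $b_x=\alpha-d(x,e)$ and $$\rho(x,y)=\frac1\alpha\sqrt{(d(x,y))^2+\alpha\bigl(b_x^{1/2}-b_y^{1/2}\bigr)^2},$$ which is a metric on $B(e,\alpha)$; $B_\rho(x,r)=\{y\in B(e,\alpha):\rho(x,y)\le r\}$. For $r>0$, $x\in B(e,\alpha)$, $$\triangle_r(x)=\alpha^d\Bigl(r^{d+1}+r^d\sqrt{1-\tfrac{d(x,e)}{\alpha}}\Bigr).$$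 $\#E$ denotes the cardinality of $E$. *)

theory Defs
  imports "HOL-Analysis.Analysis"
begin

text \<open>The sphere \<open>\<S>\<^sup>d\<close> is \<open>sphere (0 :: real ^ 'n) 1\<close> with \<open>CARD('n) = d + 1\<close>.\<close>

text \<open>Surface measure, not normalised: a Borel set \<open>A\<close> of the sphere has measure \<open>d + 1\<close> times the
  Lebesgue measure of the cone \<open>{t x | x \<in> A, 0 < t \<le> 1}\<close>, as integration in polar coordinates
  requires.\<close>

definition sphere_measure :: "(real ^ 'n::finite) measure" where
  "sphere_measure =
     scale_measure (of_nat CARD('n))
       (distr (restrict_space lborel (cball 0 1 - {0})) (restrict_space borel (sphere 0 1))
         (\<lambda>x. x /\<^sub>R norm x))"

lemma space_sphere_measure [simp]: "space sphere_measure = sphere 0 1"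
  by (simp add: sphere_measure_def space_scale_measure space_restrict_space)

lemma sets_sphere_measure [simp]: "sets sphere_measure = sets (restrict_space borel (sphere 0 1))"
  by (simp add: sphere_measure_def)

lemma emeasure_sphere_measure:
  fixes A :: "(real ^ 'n::finite) set"
  assumes "A \<in> sets borel" "A \<subseteq> sphere 0 1"
  shows "emeasure sphere_measure A =
    of_nat CARD('n) * emeasure lborel {x \<in> cball 0 1 - {0}. x /\<^sub>R norm x \<in> A}"
proof -
  have m: "(\<lambda>x::real^'n. x /\<^sub>R norm x) \<in>
      restrict_space lborel (cball 0 1 - {0}) \<rightarrow>\<^sub>M restrict_space borel (sphere 0 1)"
    by (rule measurable_restrict_space2)
       (auto simp: space_restrict_space intro!: measurable_restrict_space1)
  have A: "A \<in> sets (restrict_space borel (sphere (0::real^'n) 1))"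
    using assms by (auto simp: sets_restrict_space_iff)
  have "(\<lambda>x::real^'n. x /\<^sub>R norm x) -` A \<inter> space (restrict_space lborel (cball 0 1 - {0}))
      = {x \<in> cball 0 1 - {0}. x /\<^sub>R norm x \<in> A}"
    by (auto simp: space_restrict_space)
  moreover have "emeasure (restrict_space lborel (cball 0 1 - {0})) {x \<in> cball 0 1 - {0}. x /\<^sub>R norm x \<in> A}
      = emeasure lborel {x \<in> cball (0::real^'n) 1 - {0}. x /\<^sub>R norm x \<in> A}"
    by (rule emeasure_restrict_space) auto
  ultimately show ?thesis
    unfolding sphere_measure_def
    by (simp only: emeasure_scale_measure emeasure_distr[OF m A])
qed

definition poly_fun_deg_le :: "nat \<Rightarrow> (real ^ 'n::finite \<Rightarrow> real) \<Rightarrow> bool" where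
  "poly_fun_deg_le n P \<longleftrightarrow>
     (\<exists>c :: ('n \<Rightarrow> nat) \<Rightarrow> real.
        \<forall>x. P x = (\<Sum>k | (\<Sum>i\<in>UNIV. k i) \<le> n. c k * (\<Prod>i\<in>UNIV. (x $ i) ^ k i)))"

lemma finite_multi_indices: "finite {k :: 'n::finite \<Rightarrow> nat. (\<Sum>i\<in>UNIV. k i) \<le> n}"
proof (rule finite_subset)
  show "{k :: 'n \<Rightarrow> nat. (\<Sum>i\<in>UNIV. k i) \<le> n} \<subseteq> PiE UNIV (\<lambda>_. {..n})"
  proof (clarsimp simp: PiE_def)
    fix k :: "'n \<Rightarrow> nat" and i assume "(\<Sum>i\<in>UNIV. k i) \<le> n"
    moreover have "k i \<le> (\<Sum>i\<in>UNIV. k i)" by (rule member_le_sum) auto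
    ultimately show "k i \<le> n" by linarith
  qed
qed (rule finite_PiE, auto)

text \<open>The space \<open>\<Pi>\<^sub>n\<^sup>d\<close>. Values off the sphere are unconstrained.\<close>

definition spherical_polynomials :: "nat \<Rightarrow> (real ^ 'n::finite \<Rightarrow> real) set" where
  "spherical_polynomials n = {f. \<exists>P. poly_fun_deg_le n P \<and> (\<forall>x\<in>sphere 0 1. f x = P x)}"

definition geo_dist :: "real ^ 'n::finite \<Rightarrow> real ^ 'n \<Rightarrow> real" where
  "geo_dist x y = arccos (x \<bullet> y)"

definition sph_cap :: "real ^ 'n::finite \<Rightarrow> real \<Rightarrow> (real ^ 'n) set" where
  "sph_cap e \<alpha> = {x \<in> sphere 0 1. geo_dist x e \<le> \<alpha>}"

definition cap_depth :: "real ^ 'n::finite \<Rightarrow> real \<Rightarrow> real ^ 'n \<Rightarrow> real" where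
  "cap_depth e \<alpha> x = \<alpha> - geo_dist x e"

definition cap_rho :: "real ^ 'n::finite \<Rightarrow> real \<Rightarrow> real ^ 'n \<Rightarrow> real ^ 'n \<Rightarrow> real" where
  "cap_rho e \<alpha> x y =
     1 / \<alpha> * sqrt ((geo_dist x y)\<^sup>2 + \<alpha> * (sqrt (cap_depth e \<alpha> x) - sqrt (cap_depth e \<alpha> y))\<^sup>2)"

definition cap_rho_ball :: "real ^ 'n::finite \<Rightarrow> real \<Rightarrow> real ^ 'n \<Rightarrow> real \<Rightarrow> (real ^ 'n) set" where
  "cap_rho_ball e \<alpha> x r = {y \<in> sph_cap e \<alpha>. cap_rho e \<alpha> x y \<le> r}"

text \<open>\<open>\<triangle>\<^sub>r(x)\<close>\<close>

definition cap_weight :: "nat \<Rightarrow> real ^ 'n::finite \<Rightarrow> real \<Rightarrow> real \<Rightarrow> real ^ 'n \<Rightarrow> real" where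
  "cap_weight d e \<alpha> r x = \<alpha> ^ d * (r ^ (d + 1) + r ^ d * sqrt (1 - geo_dist x e / \<alpha>))"

end

theory Submission
  imports Defs "HOL-Complex_Analysis.Conformal_Mappings"
begin

text \<open>Stereographic projection from \<open>-e\<close> maps the cap onto a ball of \<open>\<real>\<^sup>d\<close>, and after rescaling, vertical
  projection maps the upper hemisphere of \<open>\<S>\<^sup>d\<close> onto that ball. In the resulting chart of the cap by the
  hemisphere, \<open>\<rho>\<close> is dominated by the Euclidean distance, and \<open>\<triangle>\<^bsub>1/n\<^esub>(x)\<close> by the measure of the image
  of a hemispherical ball of radius comparable to \<open>1/n\<close>. A spherical polynomial pulled back to the
  hemisphere is a polynomial divided by the \<open>n\<close>-th power of a quadratic; multiplied by a suitable
  binomial tail, whose values lie in \<open>[1/2, 1]\<close>, it becomes a trigonometric polynomial \<open>G\<close> of degree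
  \<open>O(n)\<close> along every great circle.

  Given \<open>\<omega>\<close>, let \<open>\<xi>\<close> maximise \<open>|G(\<xi>)| (1 + n|\<xi> - \<omega>|)\<^bsup>-K\<^esup>\<close>. Then \<open>|G|\<close> grows at most like
  \<open>|G(\<xi>)| (1 + n|z - \<xi>|)\<^bsup>K\<^esup>\<close> around \<open>\<xi>\<close>, so Bernstein's inequality, applied after multiplication by a
  Fejer type kernel, gives \<open>|G| \<ge> |G(\<xi>)|/2\<close> on a ball of radius \<open>c/n\<close>. Hence
  \<open>|f(\<omega>)|\<^sup>p \<triangle>\<^bsub>1/n\<^esub>(\<omega>)\<close> is bounded by a rapidly decaying multiple of the integral of \<open>|f|\<^sup>p\<close> over that ball,
  and the overlaps of these balls are counted by cells of side comparable to \<open>1/n\<close>.\<close>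

section \<open>Polynomials on the unit circle\<close>

text \<open>The hemisphere resolves the boundary layer of the cap: the image of a point at height s
  above the equator has depth comparable to R s^2, where R = tan(\<alpha>/2). Square roots of depths
  thus become Lipschitz, and \<open>\<triangle>\<close> is bounded by a multiple of (R/n)^d (1/n +
  s). The powers of R cancel against the measure of the lifted balls, so the cap enters the
  constants only through a bound B for 1 + R^2, which is where \<epsilon> comes in. Bernstein's
  inequality lives on whole great circles, while the maximum is taken over half the sphere; the
  chart agrees at mirror points, so reflection in the equator extends the growth bound. A global
  Bernstein bound would only see the maximum of |G| over the sphere, possibly far from \<omega>; the
  weighted maximum localises it, at the price of moving from \<omega> to \<xi>. The exponent K =
  2(d+1) + 1 pays for the move: one power compares the weights at the two points, and two powers per
  ambient coordinate make the sum over cells converge.\<close>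

lemma poly_bound_unit_disc:
  fixes q :: "complex poly"
  assumes "\<And>w. norm w = 1 \<Longrightarrow> norm (poly q w) \<le> M" and "norm w \<le> 1"
  shows "norm (poly q w) \<le> M"
proof (cases "norm w = 1")
  case False
  then have "w \<in> ball 0 1" using assms(2) by auto
  moreover have "poly q holomorphic_on interior (ball 0 1)"
    by (intro holomorphic_intros)
  moreover have "continuous_on (closure (ball 0 1)) (poly q)"
    by (intro continuous_intros)
  moreover have "\<And>z. z \<in> frontier (ball 0 1) \<Longrightarrow> norm (poly q z) \<le> M"
    using assms(1) by (simp add: frontier_ball)
  ultimately show ?thesis
    using maximum_modulus_frontier[of "poly q" "ball 0 1" M w] by auto
qed (use assms in auto)

text \<open>The reversed polynomial exchanges the exterior and the interior of the disc and obeys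
  the same bound on the circle, so the maximum principle applies to it.\<close>

lemma poly_bound_outside_unit_disc:
  fixes q :: "complex poly"
  assumes "degree q \<le> D" "\<And>w. norm w = 1 \<Longrightarrow> norm (poly q w) \<le> M" and "1 \<le> norm w"
  shows "norm (poly q w) \<le> norm w ^ D * M"
proof -
  have M: "0 \<le> M" using order_trans[OF norm_ge_zero assms(2)[of 1]] by simp
  have w0: "w \<noteq> 0" using assms(3) by auto
  have refl: "poly (reflect_poly q) v = v ^ degree q * poly q (inverse v)" if "v \<noteq> 0" for v
    using that by (simp add: poly_reflect_poly_nz)
  have "norm (poly (reflect_poly q) (inverse w)) \<le> M"
  proof (rule poly_bound_unit_disc)
    fix v :: complex assume v: "norm v = 1"
    then have "v \<noteq> 0" by auto
    then show "norm (poly (reflect_poly q) v) \<le> M"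
      using assms(2)[of "inverse v"] v by (simp add: refl norm_mult norm_power norm_inverse)
  next
    show "norm (inverse w) \<le> 1" using assms(3) by (simp add: norm_inverse inverse_le_1_iff)
  qed
  then have "norm (poly q w) \<le> M * norm w ^ degree q"
    using w0 by (simp add: refl norm_mult norm_divide norm_power norm_inverse field_simps)
  also have "\<dots> \<le> M * norm w ^ D"
    using M assms by (intro mult_left_mono power_increasing) auto
  finally show ?thesis by (simp add: mult.commute)
qed

text \<open>Bernstein's inequality with a crude constant: Cauchy's estimate on circles of radius
  1/D, where leaving the disc costs at most (1 + 1/D)^D \<le> e \<le> 3. Convexity of the disc turns
  the derivative bound into a Lipschitz bound.\<close>

lemma poly_lipschitz_unit_disc:
  fixes q :: "complex poly"
  assumes "degree q \<le> D" "1 \<le> D" "\<And>w. norm w = 1 \<Longrightarrow> norm (poly q w) \<le> M"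
    and "norm v \<le> 1" "norm w \<le> 1"
  shows "norm (poly q v - poly q w) \<le> 3 * real D * M * norm (v - w)"
proof -
  have M: "0 \<le> M" using order_trans[OF norm_ge_zero assms(3)[of 1]] by simp
  have e3: "(1 + 1 / real D) ^ D \<le> 3"
  proof -
    have "(1 + 1 / real D) ^ D \<le> exp (1 / real D) ^ D"
      by (intro power_mono exp_ge_add_one_self) auto
    also have "\<dots> = exp (real D * (1 / real D))" by (rule exp_of_nat_mult[symmetric])
    also have "\<dots> = exp 1" using assms(2) by simp
    finally show ?thesis using exp_le by simp
  qed
  have big: "norm (poly q x) \<le> 3 * M" if "norm x \<le> 1 + 1 / real D" for x
  proof (cases "norm x \<le> 1")
    case True
    then show ?thesis using poly_bound_unit_disc[OF assms(3), of x] M by auto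
  next
    case False
    then have "norm (poly q x) \<le> norm x ^ D * M"
      using poly_bound_outside_unit_disc[OF assms(1,3)] by auto
    also have "\<dots> \<le> (1 + 1 / real D) ^ D * M" using that M
      by (intro mult_right_mono power_mono) auto
    also have "\<dots> \<le> 3 * M" using e3 M by (intro mult_right_mono) auto
    finally show ?thesis .
  qed
  have der: "norm (poly (pderiv q) x) \<le> 3 * real D * M" if "norm x \<le> 1" for x
  proof -
    have "norm ((deriv ^^ 1) (poly q) x) \<le> fact 1 * (3 * M) / (1 / real D) ^ 1"
    proof (rule Cauchy_inequality)
      fix y assume "norm (x - y) = 1 / real D"
      moreover have "norm y \<le> norm x + norm (x - y)"
        using norm_triangle_sub[of y x] by (simp add: norm_minus_commute)
      ultimately show "norm (poly q y) \<le> 3 * M" using that by (intro big) linarith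
    next
      show "poly q holomorphic_on ball x (1 / real D)" by (intro holomorphic_intros)
      show "continuous_on (cball x (1 / real D)) (poly q)" by (intro continuous_intros)
      show "0 < 1 / real D" using assms(2) by simp
    qed
    moreover have "deriv (poly q) x = poly (pderiv q) x"
      by (rule DERIV_imp_deriv) (rule poly_DERIV)
    ultimately show ?thesis by (simp add: field_simps)
  qed
  have "norm (poly q v - poly q w) \<le> (3 * real D * M) * norm (v - w)"
    by (rule field_differentiable_bound[of "cball 0 1" "poly q" "poly (pderiv q)"])
       (use assms der in \<open>auto intro: has_field_derivative_at_within poly_DERIV\<close>)
  then show ?thesis .
qed

text \<open>The mean of the first D powers serves as localising kernel: it equals 1 at w = 1, and
  telescoping after multiplication by w - 1 makes it decay like 2 / (D |w - 1|).\<close>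

lemma norm_geometric_mean_le:
  fixes w :: complex
  assumes "norm w = 1" "1 \<le> D"
  shows "norm ((\<Sum>k<D. w ^ k) / of_nat D) \<le> 1"
    and "norm ((\<Sum>k<D. w ^ k) / of_nat D) * (D * norm (w - 1)) \<le> 2"
proof -
  have "norm (\<Sum>k<D. w ^ k) \<le> (\<Sum>k<D. 1)"
    using assms by (intro sum_norm_le) (auto simp: norm_power)
  then show "norm ((\<Sum>k<D. w ^ k) / of_nat D) \<le> 1" using assms by (simp add: norm_divide)
  have "norm ((\<Sum>k<D. w ^ k) / of_nat D) * (D * norm (w - 1)) = norm ((w - 1) * (\<Sum>k<D. w ^ k))"
    using assms by (simp add: norm_divide norm_mult)
  also have "\<dots> = norm (w ^ D - 1)" by (simp add: power_diff_1_eq)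
  also have "\<dots> \<le> norm (w ^ D) + norm (1::complex)" by (rule norm_triangle_ineq4)
  finally show "norm ((\<Sum>k<D. w ^ k) / of_nat D) * (D * norm (w - 1)) \<le> 2" using assms by (simp add: norm_power)
qed

text \<open>The K-th power of the kernel absorbs the growth, so the product is bounded on the circle
  and the Lipschitz estimate applies in degree (K + 1) D. Since the kernel has modulus at most 1 and
  equals 1 at the base point, a lower bound for the product is one for \<open>q\<close>.\<close>

lemma poly_local_lower_bound:
  fixes q :: "complex poly"
  assumes deg: "degree q \<le> D" "1 \<le> D"
    and growth: "\<And>w. norm w = 1 \<Longrightarrow> norm (poly q w) \<le> M * (1 + D * norm (w - 1)) ^ K"
    and w: "norm w = 1"
  shows "norm (poly q w) \<ge> norm (poly q 1) - 3 ^ (K + 1) * real (K + 1) * real D * M * norm (w - 1)"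
proof -
  have M: "0 \<le> M" using order_trans[OF norm_ge_zero growth[of 1]] by simp
  define j where "j = smult (1 / of_nat D) (\<Sum>k<D. monom (1::complex) k)"
  have pj: "poly j v = (\<Sum>k<D. v ^ k) / of_nat D" for v
    by (simp add: j_def poly_sum poly_monom)
  have dj: "degree j \<le> D"
    unfolding j_def by (rule order.trans[OF degree_smult_le])
      (rule degree_sum_le, auto intro: order.trans[OF degree_monom_le])
  have j1: "poly j 1 = 1" using deg by (simp add: pj)
  have dg: "degree (q * j ^ K) \<le> (K + 1) * D"
  proof -
    have "degree (q * j ^ K) \<le> degree q + degree j * K"
      by (metis add_left_mono degree_mult_le degree_power_le order.trans)
    also have "\<dots> \<le> D + D * K" using deg dj by (intro add_mono mult_right_mono) auto
    finally show ?thesis by (simp add: algebra_simps)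
  qed
  have bd: "norm (poly (q * j ^ K) v) \<le> 3 ^ K * M" if v: "norm v = 1" for v
  proof -
    note g = norm_geometric_mean_le[OF v deg(2), folded pj]
    \<comment> \<open>The 3 adds the trivial bound 1 for the kernel and its decay bound 2.\<close>
    have "(1 + D * norm (v - 1)) * norm (poly j v) \<le> 3"
      using g by (simp add: algebra_simps)
    then have *: "((1 + D * norm (v - 1)) * norm (poly j v)) ^ K \<le> 3 ^ K"
      by (intro power_mono) auto
    have "norm (poly (q * j ^ K) v) = norm (poly q v) * norm (poly j v) ^ K"
      by (simp add: norm_mult norm_power poly_power)
    also have "\<dots> \<le> M * (1 + D * norm (v - 1)) ^ K * norm (poly j v) ^ K"
      using growth[OF v] by (intro mult_right_mono) auto
    also have "\<dots> = M * ((1 + D * norm (v - 1)) * norm (poly j v)) ^ K"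
      by (simp add: power_mult_distrib)
    also have "\<dots> \<le> M * 3 ^ K" using * M by (intro mult_left_mono)
    finally show ?thesis by (simp add: mult.commute)
  qed
  have "norm (poly (q * j ^ K) 1 - poly (q * j ^ K) w) \<le> 3 * real ((K + 1) * D) * (3 ^ K * M) * norm (1 - w)"
    by (rule poly_lipschitz_unit_disc[OF dg _ bd]) (use w deg in auto)
  then have "norm (poly q 1) - norm (poly (q * j ^ K) w) \<le> 3 * real ((K + 1) * D) * (3 ^ K * M) * norm (1 - w)"
    using norm_triangle_ineq2[of "poly (q * j ^ K) 1" "poly (q * j ^ K) w"] j1 by (simp add: poly_power)
  moreover have "norm (poly (q * j ^ K) w) \<le> norm (poly q w)"
    using norm_geometric_mean_le(1)[OF w deg(2), folded pj]
    by (simp add: norm_mult norm_power poly_power mult_left_le power_le_one)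
  ultimately show ?thesis by (simp add: norm_minus_commute algebra_simps)
qed

text \<open>The unimodular factor \<open>cis t ^ N\<close> clears the negative frequencies, so
  estimates for polynomials on the unit circle apply with unchanged absolute values.\<close>

definition trig_deg :: "nat \<Rightarrow> (real \<Rightarrow> real) \<Rightarrow> bool" where
  "trig_deg N g \<longleftrightarrow>
     (\<exists>q. degree q \<le> 2 * N \<and> (\<forall>t. cis t ^ N * complex_of_real (g t) = poly q (cis t)))"

lemma trig_deg_const: "trig_deg N (\<lambda>_. c)"
  unfolding trig_deg_def
  by (rule exI[of _ "monom (of_real c) N"]) (auto simp: poly_monom intro: order.trans[OF degree_monom_le])

lemma trig_deg_add:
  assumes "trig_deg N f" "trig_deg N g" shows "trig_deg N (\<lambda>t. f t + g t)"
proof -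
  obtain p q where "degree p \<le> 2 * N" "\<forall>t. cis t ^ N * complex_of_real (f t) = poly p (cis t)"
    "degree q \<le> 2 * N" "\<forall>t. cis t ^ N * complex_of_real (g t) = poly q (cis t)"
    using assms unfolding trig_deg_def by blast
  then show ?thesis unfolding trig_deg_def
    by (intro exI[of _ "p + q"]) (auto simp: degree_add_le distrib_left)
qed

lemma trig_deg_mult:
  assumes "trig_deg M f" "trig_deg N g" shows "trig_deg (M + N) (\<lambda>t. f t * g t)"
proof -
  obtain p q where pq: "degree p \<le> 2 * M" "\<forall>t. cis t ^ M * complex_of_real (f t) = poly p (cis t)"
    "degree q \<le> 2 * N" "\<forall>t. cis t ^ N * complex_of_real (g t) = poly q (cis t)"
    using assms unfolding trig_deg_def by blast
  have "degree (p * q) \<le> 2 * (M + N)" using degree_mult_le[of p q] pq(1,3) by simp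
  moreover have "cis t ^ (M + N) * complex_of_real (f t * g t) = poly (p * q) (cis t)" for t
    by (simp add: power_add pq(2,4)[rule_format, symmetric])
  ultimately show ?thesis unfolding trig_deg_def by blast
qed

lemma trig_deg_mono: "trig_deg M f \<Longrightarrow> M \<le> N \<Longrightarrow> trig_deg N f"
  using trig_deg_mult[of M f "N - M" "\<lambda>_. 1"] trig_deg_const by auto

lemma trig_deg_cmult: "trig_deg N f \<Longrightarrow> trig_deg N (\<lambda>t. c * f t)"
  using trig_deg_mult[of 0 "\<lambda>_. c" N f] trig_deg_const by auto

lemma trig_deg_diff:
  assumes "trig_deg N f" "trig_deg N g" shows "trig_deg N (\<lambda>t. f t - g t)"
  using trig_deg_add[OF assms(1) trig_deg_cmult[OF assms(2), of "-1"]] by simp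

lemma trig_deg_sum: "(\<And>i. i \<in> A \<Longrightarrow> trig_deg N (f i)) \<Longrightarrow> trig_deg N (\<lambda>t. \<Sum>i\<in>A. f i t)"
  by (induction A rule: infinite_finite_induct) (auto intro: trig_deg_const trig_deg_add)

lemma trig_deg_prod:
  "(\<And>i. i \<in> A \<Longrightarrow> trig_deg (N i) (f i)) \<Longrightarrow> trig_deg (\<Sum>i\<in>A. N i) (\<lambda>t. \<Prod>i\<in>A. f i t)"
  by (induction A rule: infinite_finite_induct) (auto intro: trig_deg_const trig_deg_mult)

lemma trig_deg_power: "trig_deg N f \<Longrightarrow> trig_deg (k * N) (\<lambda>t. f t ^ k)"
  by (induction k) (auto intro: trig_deg_const trig_deg_mult)

lemma trig_deg_cos: "trig_deg 1 cos"
proof -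
  have "cis t ^ 1 * complex_of_real (cos t) = poly [:1/2, 0, 1/2:] (cis t)" for t
    using sin_cos_squared_add[of t]
    by (auto simp: complex_eq_iff power2_eq_square field_simps)
  then show ?thesis unfolding trig_deg_def by (intro exI[of _ "[:1/2, 0, 1/2:]"]) auto
qed

lemma trig_deg_sin: "trig_deg 1 sin"
proof -
  have "cis t ^ 1 * complex_of_real (sin t) = poly [:\<i>/2, 0, -\<i>/2:] (cis t)" for t
    using sin_cos_squared_add[of t]
    by (auto simp: complex_eq_iff power2_eq_square field_simps)
  then show ?thesis unfolding trig_deg_def by (intro exI[of _ "[:\<i>/2, 0, -\<i>/2:]"]) auto
qed

section \<open>Trigonometric polynomials on great circles\<close>

lemma exists_unit_orthogonal:
  fixes x :: "'a::euclidean_space"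
  assumes "2 \<le> DIM('a)"
  obtains y where "norm y = 1" "x \<bullet> y = 0"
proof -
  obtain y where "y \<noteq> 0" "orthogonal x y"
    using orthogonal_to_vector_exists[OF assms] by blast
  then show thesis
    using that[of "y /\<^sub>R norm y"] by (simp add: orthogonal_def)
qed

lemma norm_orthonormal_combination:
  fixes x u :: "'a::real_inner"
  assumes "norm x = 1" "norm u = 1" "x \<bullet> u = 0"
  shows "(norm (a *\<^sub>R x + b *\<^sub>R u))\<^sup>2 = a\<^sup>2 + b\<^sup>2"
  using assms
  unfolding power2_norm_eq_inner
  by (simp add: inner_simps inner_commute[of u x] norm_eq_1 power2_eq_square algebra_simps)

lemma orthonormal_decomposition:
  fixes x y :: "'a::euclidean_space"
  assumes "2 \<le> DIM('a)" and x: "norm x = 1" and y: "norm y = 1"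
  obtains u where "norm u = 1" "x \<bullet> u = 0" "y = (x \<bullet> y) *\<^sub>R x + sqrt (1 - (x \<bullet> y)\<^sup>2) *\<^sub>R u"
proof -
  define v where "v = y - (x \<bullet> y) *\<^sub>R x"
  have xx: "x \<bullet> x = 1" and yy: "y \<bullet> y = 1" using x y by (auto simp: norm_eq_1)
  have xv: "x \<bullet> v = 0" by (simp add: v_def inner_simps xx)
  have "v \<bullet> v = 1 - (x \<bullet> y)\<^sup>2"
    by (simp add: v_def inner_simps xx yy power2_eq_square inner_commute[of y x] algebra_simps)
  then have nv: "norm v = sqrt (1 - (x \<bullet> y)\<^sup>2)" by (simp add: norm_eq_sqrt_inner)
  show thesis
  proof (cases "v = 0")
    case True
    \<comment> \<open>Here y is x or -x and fixes no tangent direction; any orthogonal unit vector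
      will do, since its coefficient vanishes.\<close>
    obtain u where "norm u = 1" "x \<bullet> u = 0" using exists_unit_orthogonal[OF assms(1)] by blast
    then show thesis using that[of u] nv True by (simp add: v_def)
  next
    case False
    then show thesis
      using that[of "v /\<^sub>R norm v"] xv by (simp flip: nv) (simp add: v_def)
  qed
qed

lemma great_circle_through:
  fixes x y :: "'a::euclidean_space"
  assumes "2 \<le> DIM('a)" and x: "norm x = 1" and y: "norm y = 1"
  obtains u t where "norm u = 1" "x \<bullet> u = 0" "y = cos t *\<^sub>R x + sin t *\<^sub>R u"
proof -
  obtain u where u: "norm u = 1" "x \<bullet> u = 0" "y = (x \<bullet> y) *\<^sub>R x + sqrt (1 - (x \<bullet> y)\<^sup>2) *\<^sub>R u"
    using orthonormal_decomposition[OF assms] by blast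
  have "(x \<bullet> y)\<^sup>2 + (sqrt (1 - (x \<bullet> y)\<^sup>2))\<^sup>2 = 1"
    using Cauchy_Schwarz_ineq[of x y] x y by (simp add: norm_eq_1)
  then obtain t where "x \<bullet> y = cos t" "sqrt (1 - (x \<bullet> y)\<^sup>2) = sin t"
    using sincos_total_2pi[of "x \<bullet> y" "sqrt (1 - (x \<bullet> y)\<^sup>2)"] by metis
  then show thesis using that[of u t] u by metis
qed

text \<open>A great circle is an isometric copy of the unit circle for chordal distances, so weights
  in |w - 1| become weights in the Euclidean distance.\<close>

lemma norm_great_circle_diff:
  fixes x u :: "'a::real_inner"
  assumes "norm x = 1" "norm u = 1" "x \<bullet> u = 0"
  shows "norm (cos t *\<^sub>R x + sin t *\<^sub>R u - x) = norm (cis t - 1)"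
proof -
  have "cos t *\<^sub>R x + sin t *\<^sub>R u - x = (cos t - 1) *\<^sub>R x + sin t *\<^sub>R u"
    by (simp add: algebra_simps)
  then have "(norm (cos t *\<^sub>R x + sin t *\<^sub>R u - x))\<^sup>2 = (cos t - 1)\<^sup>2 + (sin t)\<^sup>2"
    by (simp only: norm_orthonormal_combination[OF assms])
  also have "\<dots> = (norm (cis t - 1))\<^sup>2"
    by (simp add: cmod_power2)
  finally show ?thesis by simp
qed

text \<open>The one-dimensional bound on the great circle through \<open>x\<close> and
  \<open>y\<close>; its constant does not depend on the circle, and 2N is the degree of the
  associated polynomial.\<close>

lemma trig_deg_lower_bound:
  fixes G :: "'a::euclidean_space \<Rightarrow> real"
  assumes dim: "2 \<le> DIM('a)" and N: "1 \<le> N"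
    and trig: "\<And>x u. norm x = 1 \<Longrightarrow> norm u = 1 \<Longrightarrow> x \<bullet> u = 0 \<Longrightarrow>
      trig_deg N (\<lambda>t. G (cos t *\<^sub>R x + sin t *\<^sub>R u))"
    and x: "norm x = 1" and y: "norm y = 1"
    and growth: "\<And>z. norm z = 1 \<Longrightarrow> \<bar>G z\<bar> \<le> \<bar>G x\<bar> * (1 + real (2 * N) * norm (z - x)) ^ K"
  shows "\<bar>G y\<bar> \<ge> \<bar>G x\<bar> - 3 ^ (K + 1) * real (K + 1) * real (2 * N) * \<bar>G x\<bar> * norm (y - x)"
proof -
  obtain u t where u: "norm u = 1" "x \<bullet> u = 0" and y_eq: "y = cos t *\<^sub>R x + sin t *\<^sub>R u"
    using great_circle_through[OF dim x y] by blast
  let ?c = "\<lambda>t. cos t *\<^sub>R x + sin t *\<^sub>R u"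
  obtain q where q: "degree q \<le> 2 * N"
    "\<And>t. cis t ^ N * complex_of_real (G (?c t)) = poly q (cis t)"
    using trig[OF x u] unfolding trig_deg_def by blast
  have nq: "norm (poly q (cis t)) = \<bar>G (?c t)\<bar>" for t
    by (simp add: norm_mult norm_power flip: q(2))
  have nc: "norm (?c t) = 1" for t
    using norm_orthonormal_combination[OF x u, of "cos t" "sin t"]
    by (metis sin_cos_squared_add2 norm_ge_zero one_power2 power2_eq_imp_eq zero_le_one)
  have "norm (poly q (cis t)) \<ge>
      norm (poly q 1) - 3 ^ (K + 1) * real (K + 1) * real (2 * N) * \<bar>G x\<bar> * norm (cis t - 1)"
  proof (rule poly_local_lower_bound[OF q(1)])
    fix w :: complex assume "norm w = 1"
    then obtain s where w: "w = cis s"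
      by (metis cis_Arg norm_zero zero_neq_one sgn_eq div_by_1 of_real_1)
    show "norm (poly q w) \<le> \<bar>G x\<bar> * (1 + (2 * N) * norm (w - 1)) ^ K"
      using growth[OF nc[of s]] norm_great_circle_diff[OF x u, of s] by (simp add: w nq)
  qed (use N in auto)
  moreover have "norm (poly q 1) = \<bar>G x\<bar>" using nq[of 0] by simp
  ultimately show ?thesis
    using norm_great_circle_diff[OF x u, of t] by (simp add: nq y_eq)
qed

text \<open>The weight is submultiplicative under the triangle inequality. A maximiser of |G|
  divided by the weight centred at \<open>y\<close> therefore inherits a growth bound centred at
  itself, which is what the lower bound on great circles asks for. This is the device behind
  Peetre's maximal function.\<close>

lemma localised_maximum:
  fixes G :: "'a::euclidean_space \<Rightarrow> real" and e :: 'a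
  defines "U \<equiv> {x. norm x = 1 \<and> 0 \<le> x \<bullet> e}"
  assumes dim: "2 \<le> DIM('a)" and N: "1 \<le> N" and e: "norm e = 1"
    and trig: "\<And>x u. norm x = 1 \<Longrightarrow> norm u = 1 \<Longrightarrow> x \<bullet> u = 0 \<Longrightarrow>
      trig_deg N (\<lambda>t. G (cos t *\<^sub>R x + sin t *\<^sub>R u))"
    and cont: "continuous_on U G"
    and refl: "\<And>x. norm x = 1 \<Longrightarrow> G (x - (2 * (x \<bullet> e)) *\<^sub>R e) = G x"
    and y: "y \<in> U"
  obtains x where "x \<in> U" "\<bar>G y\<bar> * (1 + real (2 * N) * norm (y - x)) ^ K \<le> \<bar>G x\<bar>"
    "\<And>z. norm z = 1 \<Longrightarrow>
      \<bar>G z\<bar> \<ge> \<bar>G x\<bar> - 3 ^ (K + 1) * real (K + 1) * real (2 * N) * \<bar>G x\<bar> * norm (z - x)"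
proof -
  define D where "D = real (2 * N)"
  have D: "0 \<le> D" by (simp add: D_def)
  let ?w = "\<lambda>x z. (1 + D * norm (z - x)) ^ K"
  have w1: "1 \<le> ?w x z" for x z using D by (simp add: one_le_power)
  have w_ne: "?w x z \<noteq> 0" for x z using w1[of z x] by linarith
  have w_tri: "?w x z \<le> ?w x v * ?w v z" for x z v
  proof -
    have n: "norm (z - x) \<le> norm (v - x) + norm (z - v)"
      using norm_triangle_ineq[of "v - x" "z - v"] by simp
    have "1 + D * norm (z - x) \<le> (1 + D * norm (v - x)) * (1 + D * norm (z - v))"
      using mult_left_mono[OF n D] mult_nonneg_nonneg[OF mult_nonneg_nonneg[OF D norm_ge_zero[of "v - x"]] mult_nonneg_nonneg[OF D norm_ge_zero[of "z - v"]]]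
      by (simp add: algebra_simps)
    then show ?thesis using D by (simp add: power_mono flip: power_mult_distrib)
  qed
  have "U = sphere 0 1 \<inter> {x. 0 \<le> x \<bullet> e}" by (auto simp: U_def)
  moreover have "closed {x. 0 \<le> x \<bullet> e}" by (intro closed_Collect_le continuous_intros)
  ultimately have "compact U" by (simp add: compact_Int_closed)
  moreover have "continuous_on U (\<lambda>x. \<bar>G x\<bar> / ?w y x)"
    using w_ne by (intro continuous_intros cont ballI)
  ultimately obtain x where x: "x \<in> U" "\<And>z. z \<in> U \<Longrightarrow> \<bar>G z\<bar> / ?w y z \<le> \<bar>G x\<bar> / ?w y x"
    using continuous_attains_sup[of U "\<lambda>x. \<bar>G x\<bar> / ?w y x"] y by blast
  have pos: "0 < ?w v z" for v z using w1[of z v] by linarith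
  have growth: "\<bar>G z\<bar> \<le> \<bar>G x\<bar> * ?w x z" if "z \<in> U" for z
  proof -
    have "\<bar>G z\<bar> * ?w y x \<le> \<bar>G x\<bar> * ?w y z"
      using x(2)[OF that] pos[of x y] pos[of z y] by (simp add: field_simps)
    also have "\<dots> \<le> \<bar>G x\<bar> * (?w y x * ?w x z)" using w_tri[of z y x] by (intro mult_left_mono) auto
    finally have "\<bar>G z\<bar> * ?w y x \<le> \<bar>G x\<bar> * ?w x z * ?w y x" by (simp only: mult_ac)
    then show ?thesis using pos[of x y] by (rule mult_right_le_imp_le)
  qed
  \<comment> \<open>Great circles leave the hemisphere. Reflection in the equator preserves
    \<open>G\<close> and, as \<open>x\<close> has nonnegative height, does not increase the distance
    to \<open>x\<close> of a point below the equator.\<close>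
  have growth_all: "\<bar>G z\<bar> \<le> \<bar>G x\<bar> * ?w x z" if z: "norm z = 1" for z
  proof (cases "0 \<le> z \<bullet> e")
    case True then show ?thesis using growth[of z] z by (simp add: U_def)
  next
    case False
    let ?z = "z - (2 * (z \<bullet> e)) *\<^sub>R e"
    have ee: "e \<bullet> e = 1" "x \<bullet> x = 1" "z \<bullet> z = 1" using e z x(1) by (auto simp: norm_eq_1 U_def)
    have nz: "norm ?z = 1"
      by (simp add: norm_eq_1 inner_simps ee inner_commute[of e z] algebra_simps)
    have "?z \<in> U" using False nz by (simp add: U_def inner_simps ee)
    have "(norm (?z - x))\<^sup>2 = (norm (z - x))\<^sup>2 + 4 * (z \<bullet> e) * (x \<bullet> e)"
      unfolding power2_norm_eq_inner
      by (simp add: inner_simps ee inner_commute[of e z] inner_commute[of e x] algebra_simps)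
    also have "\<dots> \<le> (norm (z - x))\<^sup>2"
      using False x(1) by (simp add: U_def mult_nonpos_nonneg)
    finally have "norm (?z - x) \<le> norm (z - x)" by (rule power2_le_imp_le) auto
    then have "?w x ?z \<le> ?w x z" using D by (intro power_mono add_left_mono mult_left_mono) auto
    then have "\<bar>G x\<bar> * ?w x ?z \<le> \<bar>G x\<bar> * ?w x z" by (rule mult_left_mono) auto
    then show ?thesis using growth[OF \<open>?z \<in> U\<close>] refl[OF z] by simp
  qed
  have "\<bar>G y\<bar> * ?w y x \<le> \<bar>G x\<bar>"
    using x(2)[OF y] pos[of x y] by (simp add: field_simps)
  then have "\<bar>G y\<bar> * (1 + real (2 * N) * norm (y - x)) ^ K \<le> \<bar>G x\<bar>"
    by (simp add: D_def norm_minus_commute)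
  then show thesis
  proof (rule that[OF x(1)])
    fix z :: 'a assume "norm z = 1"
    then show "\<bar>G z\<bar> \<ge> \<bar>G x\<bar> - 3 ^ (K + 1) * real (K + 1) * real (2 * N) * \<bar>G x\<bar> * norm (z - x)"
      using x(1) growth_all trig by (intro trig_deg_lower_bound[OF dim N]) (auto simp: U_def D_def)
  qed
qed

text \<open>The probability that a binomial variable with parameters \<open>m\<close> and \<open>1 - v\<close> is at least \<open>n\<close>.
  It is divisible by \<open>(1 - v) ^ n\<close>, and by the Chernoff bound it stays above \<open>1/2\<close>
  if \<open>m\<close> is a large multiple of \<open>n\<close>.\<close>

definition binomial_upper_tail :: "nat \<Rightarrow> nat \<Rightarrow> real \<Rightarrow> real" where
  "binomial_upper_tail n m v = (\<Sum>i=n..m. real (m choose i) * (1 - v) ^ i * v ^ (m - i))"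

lemma binomial_upper_tail_bounds:
  assumes v: "0 \<le> v" "v \<le> k" "k \<le> 1" and K: "((1 + k) / 2) ^ K \<le> 1 / 4" and n: "1 \<le> n"
  shows "binomial_upper_tail n (K * n) v \<le> 1" "1 / 2 \<le> binomial_upper_tail n (K * n) v"
proof -
  define m where "m = K * n"
  define a where "a i = real (m choose i) * (1 - v) ^ i * v ^ (m - i)" for i
  have a0: "0 \<le> a i" for i using v by (simp add: a_def)
  have "(\<Sum>i\<le>m. a i) = ((1 - v) + v) ^ m" unfolding a_def binomial_ring by simp
  then have one: "(\<Sum>i\<le>m. a i) = 1" by simp
  have tail: "binomial_upper_tail n m v = sum a {n..m}" by (simp add: binomial_upper_tail_def a_def)
  have "sum a {n..m} \<le> sum a {..m}" using a0 by (intro sum_mono2) auto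
  then show "binomial_upper_tail n (K * n) v \<le> 1" using one tail by (simp add: m_def)
  \<comment> \<open>Exponential tilting: below n the factor 2^n (1/2)^i is at least 1, and the
    tilted full sum is 2^n ((1 + v)/2)^m = (2 ((1 + v)/2)^K)^n. The bound 1/4 in the hypothesis
    makes this base at most 1/2.\<close>
  have "sum a ({..m} - {n..m}) \<le> (\<Sum>i\<in>{..m} - {n..m}. a i * 2 ^ n * (1/2) ^ i)"
  proof (rule sum_mono)
    fix i assume "i \<in> {..m} - {n..m}"
    then have "i \<le> n" by auto
    then have "(2::real) ^ n * (1/2) ^ i \<ge> 1"
      by (simp add: power_one_over field_simps power_increasing)
    then show "a i \<le> a i * 2 ^ n * (1/2) ^ i" using a0[of i] by (simp add: mult_le_cancel_left1 mult.assoc)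
  qed
  also have "\<dots> \<le> (\<Sum>i\<le>m. a i * 2 ^ n * (1/2) ^ i)"
    using a0 by (intro sum_mono2) auto
  also have "\<dots> = 2 ^ n * (\<Sum>i\<le>m. real (m choose i) * ((1 - v) / 2) ^ i * v ^ (m - i))"
    unfolding a_def sum_distrib_left by (intro sum.cong) (auto simp: power_divide)
  also have "\<dots> = 2 ^ n * ((1 - v) / 2 + v) ^ m" unfolding binomial_ring by simp
  also have "\<dots> = (2 * ((1 + v) / 2) ^ K) ^ n"
    by (simp add: m_def power_mult power_mult_distrib field_simps)
  also have "\<dots> \<le> (1 / 2) ^ n"
  proof (rule power_mono)
    have "((1 + v) / 2) ^ K \<le> ((1 + k) / 2) ^ K" using v by (intro power_mono) auto
    then show "2 * ((1 + v) / 2) ^ K \<le> 1 / 2" using K by linarith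
  qed (use v in auto)
  also have "\<dots> \<le> 1 / 2" using n power_decreasing[of 1 n "1/2::real"] by simp
  finally have "sum a ({..m} - {n..m}) \<le> 1 / 2" .
  moreover have "sum a ({..m} - {n..m}) = sum a {..m} - sum a {n..m}"
    by (intro sum_diff) auto
  ultimately show "1 / 2 \<le> binomial_upper_tail n (K * n) v" using one tail by (simp add: m_def)
qed

section \<open>The chart of a cap\<close>

text \<open>\<open>R\<close> stands for the tangent of half the cap radius, the radius of the
  stereographic image of the cap. \<open>B\<close> will be common to all admissible caps, so keeping
  it apart from \<open>R\<close> exhibits the uniformity of the constants.\<close>

locale cap_chart =
  fixes e :: "real ^ 'n::finite" and R B :: real
  assumes norm_e: "norm e = 1" and R_pos: "0 < R" and R_B: "1 + R\<^sup>2 \<le> B"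
begin

definition hemisphere :: "(real ^ 'n) set" where
  "hemisphere = {\<xi>. norm \<xi> = 1 \<and> 0 \<le> \<xi> \<bullet> e}"

definition cap :: "(real ^ 'n) set" where
  "cap = {x. norm x = 1 \<and> (1 - R\<^sup>2) / (1 + R\<^sup>2) \<le> x \<bullet> e}"

text \<open>On the sphere this is 1 + |z|^2 for the planar point z = R (\<xi> - (\<xi> \<bullet> e)
  e). The chart is the inverse stereographic projection of z, with numerator 2 z + (1 - |z|^2)
  e.\<close>

definition chart_denom :: "real ^ 'n \<Rightarrow> real" where
  "chart_denom \<xi> = 1 + R\<^sup>2 * (1 - (\<xi> \<bullet> e)\<^sup>2)"

definition chart_numer :: "real ^ 'n \<Rightarrow> real ^ 'n" where
  "chart_numer \<xi> = (2 * R) *\<^sub>R (\<xi> - (\<xi> \<bullet> e) *\<^sub>R e) + (2 - chart_denom \<xi>) *\<^sub>R e"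

definition chart :: "real ^ 'n \<Rightarrow> real ^ 'n" where
  "chart \<xi> = chart_numer \<xi> /\<^sub>R chart_denom \<xi>"

text \<open>The first summand is stereographic projection from -e scaled by 1/R; the second restores
  the height over the equatorial disc.\<close>

definition lift :: "real ^ 'n \<Rightarrow> real ^ 'n" where
  "lift x = (x - (x \<bullet> e) *\<^sub>R e) /\<^sub>R (R * (1 + x \<bullet> e))
     + sqrt (1 - (1 - x \<bullet> e) / (R\<^sup>2 * (1 + x \<bullet> e))) *\<^sub>R e"

section \<open>The chart, its inverse and its symmetry\<close>

lemma e_e [simp]: "e \<bullet> e = 1"
  using norm_e by (simp add: norm_eq_1)

lemma B_ge_1: "1 \<le> B"
  using R_B zero_le_power2[of R] by linarith

lemma cap_threshold: "(1 - R\<^sup>2) / (1 + R\<^sup>2) = 2 / (1 + R\<^sup>2) - 1"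
proof -
  have "1 - R\<^sup>2 = 2 - (1 + R\<^sup>2)" by simp
  moreover have "1 + R\<^sup>2 \<noteq> 0" using zero_le_power2[of R] by linarith
  ultimately show ?thesis by (metis diff_divide_distrib divide_self)
qed

lemma inner_e_le_1: "norm x = 1 \<Longrightarrow> (x \<bullet> e)\<^sup>2 \<le> 1"
  using Cauchy_Schwarz_ineq[of x e] by (simp add: norm_eq_1)

lemma inner_e_bounds: "norm x = 1 \<Longrightarrow> -1 \<le> x \<bullet> e \<and> x \<bullet> e \<le> 1"
  using inner_e_le_1[of x] by (simp add: abs_square_le_1 abs_le_iff)

lemma chart_denom_bounds:
  assumes "norm \<xi> = 1" shows "1 \<le> chart_denom \<xi>" "chart_denom \<xi> \<le> 1 + R\<^sup>2" "chart_denom \<xi> \<le> B"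
proof -
  show "1 \<le> chart_denom \<xi>" using inner_e_le_1[OF assms] by (simp add: chart_denom_def)
  have "R\<^sup>2 * (1 - (\<xi> \<bullet> e)\<^sup>2) \<le> R\<^sup>2 * 1" by (intro mult_left_mono) auto
  then show "chart_denom \<xi> \<le> 1 + R\<^sup>2" by (simp add: chart_denom_def)
  then show "chart_denom \<xi> \<le> B" using R_B by simp
qed

lemma chart_inner_e: "chart \<xi> \<bullet> e = (2 - chart_denom \<xi>) / chart_denom \<xi>"
  by (simp add: chart_def chart_numer_def inner_simps divide_inverse)

text \<open>The planar point ignores heights, so the bracket is the squared distance of the vertical
  projections; the rest is the chordal distance formula for stereographic projection.\<close>

lemma inner_chart:
  assumes "norm \<xi> = 1" "norm \<eta> = 1"
  shows "chart \<xi> \<bullet> chart \<eta> =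
    1 - 2 * R\<^sup>2 * ((norm (\<xi> - \<eta>))\<^sup>2 - (\<xi> \<bullet> e - \<eta> \<bullet> e)\<^sup>2) / (chart_denom \<xi> * chart_denom \<eta>)"
proof -
  have i: "\<xi> \<bullet> \<xi> = 1" "\<eta> \<bullet> \<eta> = 1" using assms by (auto simp: norm_eq_1)
  have D: "chart_denom \<xi> \<noteq> 0" "chart_denom \<eta> \<noteq> 0"
    using chart_denom_bounds(1)[OF assms(1)] chart_denom_bounds(1)[OF assms(2)] by auto
  have n: "(norm (\<xi> - \<eta>))\<^sup>2 = 2 - 2 * (\<xi> \<bullet> \<eta>)"
    by (simp add: power2_norm_eq_inner inner_simps i inner_commute[of \<eta> \<xi>])
  have "chart_numer \<xi> \<bullet> chart_numer \<eta> = 4 * R\<^sup>2 * (\<xi> \<bullet> \<eta> - (\<xi> \<bullet> e) * (\<eta> \<bullet> e))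
      + (2 - chart_denom \<xi>) * (2 - chart_denom \<eta>)"
    by (simp add: chart_numer_def inner_simps inner_commute[of e \<eta>] power2_eq_square algebra_simps)
  also have "\<dots> = chart_denom \<xi> * chart_denom \<eta>
      - 2 * R\<^sup>2 * ((norm (\<xi> - \<eta>))\<^sup>2 - (\<xi> \<bullet> e - \<eta> \<bullet> e)\<^sup>2)"
    unfolding n by (simp add: chart_denom_def power2_eq_square algebra_simps)
  finally show ?thesis using D by (simp add: chart_def field_simps)
qed

lemma norm_chart: "norm \<xi> = 1 \<Longrightarrow> norm (chart \<xi>) = 1"
  using inner_chart[of \<xi> \<xi>] by (simp add: norm_eq_1)

lemma norm_chart_diff:
  assumes "norm \<xi> = 1" "norm \<eta> = 1"
  shows "(norm (chart \<xi> - chart \<eta>))\<^sup>2 =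
    4 * R\<^sup>2 * ((norm (\<xi> - \<eta>))\<^sup>2 - (\<xi> \<bullet> e - \<eta> \<bullet> e)\<^sup>2) / (chart_denom \<xi> * chart_denom \<eta>)"
proof -
  have "(norm (chart \<xi> - chart \<eta>))\<^sup>2 = 2 - 2 * (chart \<xi> \<bullet> chart \<eta>)"
    using assms[THEN norm_chart]
    by (simp add: power2_norm_eq_inner inner_diff_left inner_diff_right norm_eq_1 inner_commute[of "chart \<eta>" "chart \<xi>"])
  then show ?thesis using inner_chart[OF assms] by simp
qed

lemma chart_in_cap: assumes "norm \<xi> = 1" shows "chart \<xi> \<in> cap"
proof -
  note D = chart_denom_bounds[OF assms]
  have "(1 - R\<^sup>2) / (1 + R\<^sup>2) = 2 / (1 + R\<^sup>2) - 1" by (rule cap_threshold)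
  also have "\<dots> \<le> 2 / chart_denom \<xi> - 1" using D by (simp add: frac_le)
  also have "\<dots> = chart \<xi> \<bullet> e" using D(1) by (simp add: chart_inner_e diff_divide_distrib)
  finally show ?thesis using norm_chart[OF assms] by (simp add: cap_def)
qed

lemma cap_inner_e_pos: "x \<in> cap \<Longrightarrow> 0 < 1 + x \<bullet> e"
proof -
  assume "x \<in> cap"
  then have "(1 - R\<^sup>2) / (1 + R\<^sup>2) \<le> x \<bullet> e" by (simp add: cap_def)
  moreover have "0 < 2 / (1 + R\<^sup>2)" using zero_le_power2[of R] by (intro divide_pos_pos) linarith+
  ultimately show ?thesis using cap_threshold by linarith
qed

lemma lift_inner_e: "lift x \<bullet> e = sqrt (1 - (1 - x \<bullet> e) / (R\<^sup>2 * (1 + x \<bullet> e)))"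
  by (simp add: lift_def inner_simps)

text \<open>Keeps the radicand in \<open>lift\<close> nonnegative, with the value 0 on the rim of
  the cap.\<close>

lemma cap_ratio_le_1:
  assumes "x \<in> cap" shows "(1 - x \<bullet> e) / (R\<^sup>2 * (1 + x \<bullet> e)) \<le> 1"
proof -
  have "0 < 1 + R\<^sup>2" using zero_le_power2[of R] by linarith
  then have "1 - R\<^sup>2 \<le> (x \<bullet> e) * (1 + R\<^sup>2)"
    using assms by (simp add: cap_def pos_divide_le_eq)
  moreover have "0 < R\<^sup>2 * (1 + x \<bullet> e)" using cap_inner_e_pos[OF assms] R_pos by simp
  ultimately show ?thesis by (simp add: pos_divide_le_eq algebra_simps)
qed

lemma lift_inner_e_sq:
  assumes "x \<in> cap" shows "(lift x \<bullet> e)\<^sup>2 = 1 - (1 - x \<bullet> e) / (R\<^sup>2 * (1 + x \<bullet> e))"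
  using cap_ratio_le_1[OF assms] by (simp add: lift_inner_e)

lemma norm_tangent_sq:
  assumes "norm x = 1" shows "(norm (x - (x \<bullet> e) *\<^sub>R e))\<^sup>2 = (1 - x \<bullet> e) * (1 + x \<bullet> e)"
  unfolding power2_norm_eq_inner using assms
  by (simp add: inner_simps norm_eq_1 inner_commute[of e x] algebra_simps)

lemma lift_in_hemisphere:
  assumes "x \<in> cap" shows "lift x \<in> hemisphere"
proof -
  let ?t = "x \<bullet> e" and ?v = "x - (x \<bullet> e) *\<^sub>R e" and ?s = "lift x \<bullet> e"
  have t: "0 < 1 + ?t" by (rule cap_inner_e_pos[OF assms])
  have nx: "norm x = 1" using assms by (simp add: cap_def)
  have "(norm (lift x))\<^sup>2 = (norm (?v /\<^sub>R (R * (1 + ?t))))\<^sup>2 + ?s\<^sup>2"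
    unfolding power2_norm_eq_inner
    by (simp add: lift_def inner_simps inner_commute[of e x] power2_eq_square algebra_simps)
  also have "(norm (?v /\<^sub>R (R * (1 + ?t))))\<^sup>2 = (norm ?v)\<^sup>2 / (R * (1 + ?t))\<^sup>2"
    by (simp add: power_mult_distrib power_inverse divide_inverse power2_abs mult.commute)
  also have "\<dots> = (1 - ?t) / (R\<^sup>2 * (1 + ?t))"
    unfolding norm_tangent_sq[OF nx] using t R_pos by (simp add: power2_eq_square)
  finally have "(norm (lift x))\<^sup>2 = 1" using lift_inner_e_sq[OF assms] by simp
  then have "norm (lift x) = 1" by (simp add: power2_eq_1_iff) (use norm_ge_zero[of "lift x"] in linarith)
  moreover have "0 \<le> ?s" using cap_ratio_le_1[OF assms] by (simp add: lift_inner_e)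
  ultimately show ?thesis by (simp add: hemisphere_def)
qed

lemma chart_denom_lift:
  assumes "x \<in> cap" shows "chart_denom (lift x) = 2 / (1 + x \<bullet> e)"
proof -
  define T where "T = 1 + x \<bullet> e"
  have T: "0 < T" "x \<bullet> e = T - 1" using cap_inner_e_pos[OF assms] by (auto simp: T_def)
  show ?thesis
    using T(1) R_pos by (simp add: chart_denom_def lift_inner_e_sq[OF assms] T(2) field_simps)
qed

lemma chart_lift:
  assumes "x \<in> cap" shows "chart (lift x) = x"
proof -
  let ?t = "x \<bullet> e"
  have t: "0 < 1 + ?t" by (rule cap_inner_e_pos[OF assms])
  have "lift x - (lift x \<bullet> e) *\<^sub>R e = (x - ?t *\<^sub>R e) /\<^sub>R (R * (1 + ?t))"
    by (simp add: lift_inner_e) (simp add: lift_def)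
  moreover have "2 * R * inverse (R * (1 + ?t)) = 2 / (1 + ?t)" using t R_pos by (simp add: divide_inverse)
  ultimately have "chart_numer (lift x) = (2 / (1 + ?t)) *\<^sub>R (x - ?t *\<^sub>R e) + (2 - 2 / (1 + ?t)) *\<^sub>R e"
    by (simp add: chart_numer_def chart_denom_lift[OF assms])
  also have "\<dots> = (2 / (1 + ?t)) *\<^sub>R ((x - ?t *\<^sub>R e) + ?t *\<^sub>R e)"
  proof -
    have "2 - 2 / (1 + ?t) = 2 / (1 + ?t) * ?t" using t by (simp add: field_simps)
    then show ?thesis by (simp only: scaleR_add_right scaleR_scaleR)
  qed
  finally have "chart_numer (lift x) = (2 / (1 + ?t)) *\<^sub>R x" by simp
  moreover have "inverse (2 / (1 + ?t)) * (2 / (1 + ?t)) = 1" using t by (intro left_inverse) simp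
  ultimately show ?thesis
    by (simp only: chart_def chart_denom_lift[OF assms] scaleR_scaleR scaleR_one)
qed

lemma lift_chart:
  assumes "\<xi> \<in> hemisphere" shows "lift (chart \<xi>) = \<xi>"
proof -
  have n: "norm \<xi> = 1" "0 \<le> \<xi> \<bullet> e" using assms by (auto simp: hemisphere_def)
  note D = chart_denom_bounds[OF n(1)]
  let ?D = "chart_denom \<xi>"
  have t: "1 + chart \<xi> \<bullet> e = 2 / ?D" "1 - chart \<xi> \<bullet> e = 2 * (?D - 1) / ?D"
    using D(1) by (auto simp: chart_inner_e field_simps)
  have "1 - (1 - chart \<xi> \<bullet> e) / (R\<^sup>2 * (1 + chart \<xi> \<bullet> e)) = 1 - (?D - 1) / R\<^sup>2"
    unfolding t using D(1) R_pos by (simp add: field_simps)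
  also have "\<dots> = (\<xi> \<bullet> e)\<^sup>2" using R_pos by (simp add: chart_denom_def)
  finally have s: "sqrt (1 - (1 - chart \<xi> \<bullet> e) / (R\<^sup>2 * (1 + chart \<xi> \<bullet> e))) = \<xi> \<bullet> e"
    using n by simp
  have "chart \<xi> - (chart \<xi> \<bullet> e) *\<^sub>R e = (2 * R / ?D) *\<^sub>R (\<xi> - (\<xi> \<bullet> e) *\<^sub>R e)"
    by (simp add: chart_inner_e) (simp add: chart_def chart_numer_def scaleR_add_right divide_inverse mult.commute)
  then have "(chart \<xi> - (chart \<xi> \<bullet> e) *\<^sub>R e) /\<^sub>R (R * (1 + chart \<xi> \<bullet> e)) = \<xi> - (\<xi> \<bullet> e) *\<^sub>R e"
    using D(1) R_pos by (simp add: t)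
  then show ?thesis unfolding lift_def s by simp
qed

lemma chart_denom_reflect: "chart_denom (\<xi> - (2 * (\<xi> \<bullet> e)) *\<^sub>R e) = chart_denom \<xi>"
  by (simp add: chart_denom_def inner_simps)

text \<open>The chart sees only the vertical projection and the squared height. This symmetry
  carries bounds from the hemisphere to the whole sphere.\<close>

lemma chart_reflect: "chart (\<xi> - (2 * (\<xi> \<bullet> e)) *\<^sub>R e) = chart \<xi>"
proof -
  have "\<xi> - (2 * (\<xi> \<bullet> e)) *\<^sub>R e - (- (\<xi> \<bullet> e)) *\<^sub>R e = \<xi> - (\<xi> \<bullet> e) *\<^sub>R e"
  proof -
    have "(2 * (\<xi> \<bullet> e)) *\<^sub>R e = (\<xi> \<bullet> e) *\<^sub>R e + (\<xi> \<bullet> e) *\<^sub>R e"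
      by (simp flip: scaleR_left_distrib)
    then show ?thesis by simp
  qed
  moreover have "(\<xi> - (2 * (\<xi> \<bullet> e)) *\<^sub>R e) \<bullet> e = - (\<xi> \<bullet> e)" by (simp add: inner_simps)
  ultimately show ?thesis unfolding chart_def chart_numer_def chart_denom_reflect by metis
qed

lemma continuous_on_chart: "continuous_on {\<xi>. norm \<xi> = 1} chart"
proof -
  have "chart_denom \<xi> \<noteq> 0" if "norm \<xi> = 1" for \<xi> using chart_denom_bounds(1)[OF that] by auto
  then show ?thesis
    unfolding chart_def [abs_def] chart_numer_def
    by (intro continuous_intros) (auto simp: chart_denom_def [abs_def] intro!: continuous_intros)
qed

section \<open>Trigonometric degree of polynomials in the chart\<close>

lemma trig_deg_great_circle:
  "trig_deg 1 (\<lambda>t. (cos t *\<^sub>R \<xi> + sin t *\<^sub>R \<eta>) \<bullet> v)"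
  unfolding inner_add_left inner_scaleR_left
  by (subst (1 2) mult.commute) (intro trig_deg_add trig_deg_cmult trig_deg_cos trig_deg_sin)

lemma trig_deg_chart_denom:
  "trig_deg 2 (\<lambda>t. chart_denom (cos t *\<^sub>R \<xi> + sin t *\<^sub>R \<eta>))"
  unfolding chart_denom_def
  using trig_deg_power[OF trig_deg_great_circle, of 2]
  by (intro trig_deg_add trig_deg_cmult trig_deg_diff trig_deg_const) auto

lemma trig_deg_chart_numer:
  "trig_deg 2 (\<lambda>t. chart_numer (cos t *\<^sub>R \<xi> + sin t *\<^sub>R \<eta>) $ i)"
proof -
  let ?c = "\<lambda>t. cos t *\<^sub>R \<xi> + sin t *\<^sub>R \<eta>"
  have "chart_numer x $ i = 2 * R * (x \<bullet> axis i 1 - e $ i * (x \<bullet> e)) + e $ i * (2 - chart_denom x)" for x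
    by (simp add: chart_numer_def inner_axis algebra_simps)
  moreover have "trig_deg 2 (\<lambda>t. 2 * R * (?c t \<bullet> axis i 1 - e $ i * (?c t \<bullet> e)) + e $ i * (2 - chart_denom (?c t)))"
    by (intro trig_deg_add trig_deg_cmult trig_deg_diff trig_deg_const trig_deg_chart_denom
        trig_deg_mono[OF trig_deg_great_circle]) auto
  ultimately show ?thesis by simp
qed

text \<open>The tail supplies the factor \<open>chart_denom ^ n\<close> that clears the denominators of \<open>P (chart \<xi>)\<close>.\<close>

definition lifted_poly :: "(real ^ 'n \<Rightarrow> real) \<Rightarrow> nat \<Rightarrow> nat \<Rightarrow> real ^ 'n \<Rightarrow> real" where
  "lifted_poly P n m \<xi> = P (chart \<xi>) * binomial_upper_tail n m (1 - chart_denom \<xi> / B)"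

text \<open>Along a great circle the numerators and the denominator of the chart have degree 2.
  Clearing denominators in \<open>P\<close> takes n factors \<open>chart_denom\<close>, giving
  degree 2n; the tail term of index i \<ge> n has i such factors and m - i complementary ones, so 2
  (m - n) is added.\<close>

lemma trig_deg_lifted_poly:
  assumes P: "poly_fun_deg_le n P" and x: "norm \<xi> = 1" "norm \<eta> = 1" "\<xi> \<bullet> \<eta> = 0"
  shows "trig_deg (2 * m) (\<lambda>t. lifted_poly P n m (cos t *\<^sub>R \<xi> + sin t *\<^sub>R \<eta>))"
proof -
  obtain a where a: "\<And>x. P x = (\<Sum>k | (\<Sum>i\<in>UNIV. k i) \<le> n. a k * (\<Prod>i\<in>UNIV. (x $ i) ^ k i))"
    using P unfolding poly_fun_deg_le_def by blast
  let ?c = "\<lambda>t. cos t *\<^sub>R \<xi> + sin t *\<^sub>R \<eta>"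
  have nc: "norm (?c t) = 1" for t
    using norm_orthonormal_combination[OF x, of "cos t" "sin t"]
    by (metis sin_cos_squared_add2 norm_ge_zero one_power2 power2_eq_imp_eq zero_le_one)
  have D: "chart_denom (?c t) \<noteq> 0" for t using chart_denom_bounds(1)[OF nc[of t]] by auto
  \<comment> \<open>Homogenisation of \<open>P\<close>: monomials of degree below n are filled up
    with powers of the denominator.\<close>
  define Q where "Q t = (\<Sum>k | (\<Sum>i\<in>UNIV. k i) \<le> n. a k *
    (chart_denom (?c t) ^ (n - (\<Sum>i\<in>UNIV. k i)) * (\<Prod>i\<in>UNIV. (chart_numer (?c t) $ i) ^ k i)))" for t
  have Q: "chart_denom (?c t) ^ n * P (chart (?c t)) = Q t" for t
    unfolding a Q_def sum_distrib_left
  proof (rule sum.cong[OF refl])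
    fix k :: "'n \<Rightarrow> nat" assume "k \<in> {k. (\<Sum>i\<in>UNIV. k i) \<le> n}"
    then have n: "chart_denom (?c t) ^ n =
        chart_denom (?c t) ^ (n - (\<Sum>i\<in>UNIV. k i)) * chart_denom (?c t) ^ (\<Sum>i\<in>UNIV. k i)"
      by (simp flip: power_add)
    have PD: "chart_denom (?c t) ^ (\<Sum>i\<in>UNIV. k i) * (\<Prod>i\<in>UNIV. (chart (?c t) $ i) ^ k i)
        = (\<Prod>i\<in>UNIV. (chart_numer (?c t) $ i) ^ k i)"
      unfolding power_sum prod.distrib[symmetric] power_mult_distrib[symmetric]
      using D[of t] by (simp add: chart_def mult.assoc[symmetric])
    show "chart_denom (?c t) ^ n * (a k * (\<Prod>i\<in>UNIV. (chart (?c t) $ i) ^ k i)) =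
      a k * (chart_denom (?c t) ^ (n - (\<Sum>i\<in>UNIV. k i)) * (\<Prod>i\<in>UNIV. (chart_numer (?c t) $ i) ^ k i))"
      unfolding n PD[symmetric] by (simp only: mult_ac)
  qed
  have tQ: "trig_deg (2 * n) Q"
    unfolding Q_def
  proof (intro trig_deg_sum trig_deg_cmult)
    fix k :: "'n \<Rightarrow> nat" assume "k \<in> {k. (\<Sum>i\<in>UNIV. k i) \<le> n}"
    then have eq: "(n - (\<Sum>i\<in>UNIV. k i)) * 2 + (\<Sum>i\<in>UNIV. k i * 2) = 2 * n"
      by (simp flip: sum_distrib_right)
    show "trig_deg (2 * n) (\<lambda>t. chart_denom (?c t) ^ (n - (\<Sum>i\<in>UNIV. k i)) *
       (\<Prod>i\<in>UNIV. (chart_numer (?c t) $ i) ^ k i))"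
      unfolding eq[symmetric]
      by (intro trig_deg_mult trig_deg_power trig_deg_prod trig_deg_chart_denom trig_deg_chart_numer)
  qed
  have "lifted_poly P n m (?c t) = (\<Sum>i=n..m. (real (m choose i) / B ^ i) *
      (Q t * (chart_denom (?c t) ^ (i - n) * (1 - (1 / B) * chart_denom (?c t)) ^ (m - i))))" for t
    unfolding lifted_poly_def binomial_upper_tail_def sum_distrib_left
  proof (rule sum.cong[OF refl])
    fix i assume "i \<in> {n..m}"
    then have "n + (i - n) = i" by auto
    then have *: "chart_denom (?c t) ^ i = chart_denom (?c t) ^ n * chart_denom (?c t) ^ (i - n)"
      by (metis power_add)
    show "P (chart (?c t)) * (real (m choose i) * (1 - (1 - chart_denom (?c t) / B)) ^ i *
        (1 - chart_denom (?c t) / B) ^ (m - i)) =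
      real (m choose i) / B ^ i *
        (Q t * (chart_denom (?c t) ^ (i - n) * (1 - 1 / B * chart_denom (?c t)) ^ (m - i)))"
      unfolding Q[symmetric] by (simp add: power_divide) (simp add: *)
  qed
  moreover have "trig_deg (2 * m) (\<lambda>t. \<Sum>i=n..m. (real (m choose i) / B ^ i) *
      (Q t * (chart_denom (?c t) ^ (i - n) * (1 - (1 / B) * chart_denom (?c t)) ^ (m - i))))"
  proof (intro trig_deg_sum trig_deg_cmult)
    fix i assume "i \<in> {n..m}"
    then have eq: "2 * n + ((i - n) * 2 + (m - i) * 2) = 2 * m" by auto
    show "trig_deg (2 * m)
      (\<lambda>t. Q t * (chart_denom (?c t) ^ (i - n) * (1 - (1 / B) * chart_denom (?c t)) ^ (m - i)))"
      unfolding eq[symmetric]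
      by (intro trig_deg_mult tQ trig_deg_power trig_deg_chart_denom trig_deg_diff trig_deg_const trig_deg_cmult)
  qed
  ultimately show ?thesis by simp
qed

end

section \<open>Metric estimates in the chart\<close>

lemma arctan_diff_bounds:
  fixes a b :: real
  assumes "0 \<le> a" "a \<le> b"
  shows "arctan b - arctan a \<le> b - a" "(b - a) / (1 + b\<^sup>2) \<le> arctan b - arctan a"
proof -
  have "arctan b - arctan a \<le> b - a \<and> (b - a) / (1 + b\<^sup>2) \<le> arctan b - arctan a"
  proof (cases "a = b")
    case False
    then have "a < b" using assms by simp
    then obtain z where z: "a < z" "z < b" "arctan b - arctan a = (b - a) * inverse (1 + z\<^sup>2)"
      using MVT2[of a b arctan "\<lambda>x. inverse (1 + x\<^sup>2)"] DERIV_arctan by blast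
    have "inverse (1 + z\<^sup>2) \<le> 1" by (intro inverse_le_1_iff[THEN iffD2]) auto
    then have "(b - a) * inverse (1 + z\<^sup>2) \<le> b - a"
      using \<open>a < b\<close> mult_left_mono[of "inverse (1 + z\<^sup>2)" 1 "b - a"] by simp
    moreover have "z\<^sup>2 \<le> b\<^sup>2" using z assms by (intro power_mono) auto
    then have "inverse (1 + b\<^sup>2) \<le> inverse (1 + z\<^sup>2)"
      by (intro le_imp_inverse_le) (auto intro: add_pos_nonneg)
    then have "(b - a) * inverse (1 + b\<^sup>2) \<le> (b - a) * inverse (1 + z\<^sup>2)"
      using \<open>a < b\<close> by (intro mult_left_mono) auto
    ultimately show ?thesis using z(3) by (simp add: divide_inverse)
  qed auto
  then show "arctan b - arctan a \<le> b - a" "(b - a) / (1 + b\<^sup>2) \<le> arctan b - arctan a" by auto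
qed

lemma cos_double_arctan: "cos (2 * arctan w) = (1 - w\<^sup>2) / (1 + w\<^sup>2)"
proof -
  have "0 < 1 + w\<^sup>2" by (intro add_pos_nonneg) auto
  moreover have "(cos (arctan w))\<^sup>2 = 1 / (1 + w\<^sup>2)"
    by (simp add: cos_arctan power_divide)
  ultimately show ?thesis unfolding cos_double_cos by (simp add: field_simps)
qed

lemma arccos_cayley:
  assumes "0 \<le> w" shows "arccos ((1 - w\<^sup>2) / (1 + w\<^sup>2)) = 2 * arctan w"
  unfolding cos_double_arctan[symmetric]
proof (rule arccos_cos)
  show "0 \<le> 2 * arctan w" using assms by simp
  show "2 * arctan w \<le> pi" using arctan_ubound[of w] by linarith
qed

text \<open>From x/2 \<le> tan(x/2) follows x cos(x/2)^2 \<le> sin x, and cos(x/2)^2 \<ge> 1/2 up to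
  a right angle.\<close>

lemma le_twice_sin:
  assumes "0 \<le> x" "x \<le> pi / 2" shows "x \<le> 2 * sin x"
proof -
  have c: "0 < cos (x / 2)" using assms by (intro cos_gt_zero_pi) (use pi_gt_zero in linarith)+
  have "x / 2 = arctan (tan (x / 2))"
    by (rule arctan_tan[symmetric]) (use assms pi_gt_zero in linarith)+
  also have "\<dots> \<le> tan (x / 2)"
  proof -
    have "0 \<le> sin (x / 2)" by (rule sin_ge_zero) (use assms pi_gt_zero in linarith)+
    then have "0 \<le> tan (x / 2)" using c by (simp add: tan_def)
    then show ?thesis using arctan_diff_bounds(1)[of 0 "tan (x / 2)"] by simp
  qed
  finally have "x / 2 * cos (x / 2) \<le> sin (x / 2)" using c by (simp only: tan_def pos_le_divide_eq)
  then have "x * (cos (x / 2))\<^sup>2 \<le> 2 * (sin (x / 2) * cos (x / 2))"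
    using c by (simp add: power2_eq_square field_simps)
  also have "\<dots> = sin x" using sin_double[of "x / 2"] by simp
  finally have "x * (cos (x / 2))\<^sup>2 \<le> sin x" .
  moreover have "1 / 2 \<le> (cos (x / 2))\<^sup>2"
    using cos_double_cos[of "x / 2"] cos_ge_zero[of x] assms by simp
  then have "x * (1 / 2) \<le> x * (cos (x / 2))\<^sup>2" using assms by (intro mult_left_mono) auto
  ultimately show ?thesis by linarith
qed

text \<open>The chord is twice the sine of half the geodesic distance.\<close>

lemma geo_dist_le_norm_diff:
  assumes "norm x = 1" "norm y = 1"
  shows "geo_dist x y \<le> 2 * norm (x - y)" "0 \<le> geo_dist x y"
proof -
  let ?d = "arccos (x \<bullet> y)"
  have b: "-1 \<le> x \<bullet> y" "x \<bullet> y \<le> 1"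
    using Cauchy_Schwarz_ineq2[of x y] assms by (auto simp: abs_le_iff)
  have d: "0 \<le> ?d" "?d \<le> pi" using arccos_lbound[OF b] arccos_ubound[OF b] by auto
  then show "0 \<le> geo_dist x y" by (simp add: geo_dist_def)
  have s: "0 \<le> sin (?d / 2)" using d by (intro sin_ge_zero) auto
  have "(norm (x - y))\<^sup>2 = 2 - 2 * (x \<bullet> y)"
    using assms by (simp add: power2_norm_eq_inner inner_diff_left inner_diff_right norm_eq_1 inner_commute[of y x])
  also have "\<dots> = (2 * sin (?d / 2))\<^sup>2"
    using cos_double_sin[of "?d / 2"] b by (simp add: power_mult_distrib)
  finally have "norm (x - y) = 2 * sin (?d / 2)"
    by (rule power2_eq_imp_eq) (use s in auto)
  then show "geo_dist x y \<le> 2 * norm (x - y)"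
    using le_twice_sin[of "?d / 2"] d by (simp add: geo_dist_def)
qed

context cap_chart
begin

section \<open>Depth, \<open>\<rho>\<close> and weight in hemisphere coordinates\<close>

abbreviation \<alpha> :: real where "\<alpha> \<equiv> 2 * arctan R"

lemma one_plus_R_sq_pos: "0 < 1 + R\<^sup>2"
  by (intro add_pos_nonneg) auto

lemma alpha_bounds: "2 * R / B \<le> \<alpha>" "\<alpha> \<le> 2 * R" "0 < \<alpha>"
proof -
  note d = arctan_diff_bounds[of 0 R, simplified]
  have "R / B \<le> R / (1 + R\<^sup>2)" using R_B R_pos B_ge_1 one_plus_R_sq_pos by (intro divide_left_mono mult_pos_pos) auto
  then show "2 * R / B \<le> \<alpha>" using d R_pos by simp
  show "\<alpha> \<le> 2 * R" using d R_pos by simp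
  show "0 < \<alpha>" using R_pos by simp
qed

lemma sph_cap_eq: "sph_cap e \<alpha> = cap"
proof -
  have "geo_dist x e \<le> \<alpha> \<longleftrightarrow> (1 - R\<^sup>2) / (1 + R\<^sup>2) \<le> x \<bullet> e" if "norm x = 1" for x
  proof -
    have "\<bar>cos \<alpha>\<bar> \<le> 1" by (simp add: abs_cos_le_one)
    then have c: "\<bar>(1 - R\<^sup>2) / (1 + R\<^sup>2)\<bar> \<le> 1" by (simp only: cos_double_arctan)
    have "\<bar>x \<bullet> e\<bar> \<le> 1" using inner_e_bounds[OF that] by (simp add: abs_le_iff)
    then show ?thesis
      using arccos_le_mono[OF _ c, of "x \<bullet> e"] arccos_cayley[of R] R_pos by (simp add: geo_dist_def)
  qed
  then show ?thesis by (auto simp: sph_cap_def cap_def)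
qed

lemma norm_proj_sq:
  assumes "norm x = 1" shows "(norm (x - (x \<bullet> e) *\<^sub>R e))\<^sup>2 = 1 - (x \<bullet> e)\<^sup>2"
  using norm_tangent_sq[OF assms] by (simp add: power2_eq_square algebra_simps)

lemma norm_proj:
  assumes "norm x = 1" shows "norm (x - (x \<bullet> e) *\<^sub>R e) = sqrt (1 - (x \<bullet> e)\<^sup>2)"
  using real_sqrt_unique[OF norm_proj_sq[OF assms]] by simp

lemma geo_dist_chart:
  assumes "norm \<xi> = 1"
  shows "geo_dist (chart \<xi>) e = 2 * arctan (R * sqrt (1 - (\<xi> \<bullet> e)\<^sup>2))"
proof -
  let ?w = "R * sqrt (1 - (\<xi> \<bullet> e)\<^sup>2)"
  have "?w\<^sup>2 = R\<^sup>2 * (1 - (\<xi> \<bullet> e)\<^sup>2)" using inner_e_le_1[OF assms] by (simp add: power_mult_distrib)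
  then have "chart \<xi> \<bullet> e = (1 - ?w\<^sup>2) / (1 + ?w\<^sup>2)"
    unfolding chart_inner_e chart_denom_def by simp
  moreover have "0 \<le> ?w" using R_pos inner_e_le_1[OF assms] by simp
  ultimately show ?thesis unfolding geo_dist_def using arccos_cayley by simp
qed

lemma cap_depth_chart:
  assumes "norm \<xi> = 1"
  shows "cap_depth e \<alpha> (chart \<xi>) = 2 * (arctan R - arctan (R * sqrt (1 - (\<xi> \<bullet> e)\<^sup>2)))"
  using geo_dist_chart[OF assms] by (simp add: cap_depth_def)

text \<open>With q the radius of the vertical projection, 1 - q and the squared height 1 - q^2 agree
  up to a factor 2, so depth is quadratic in height. The mean value bounds for arctan bring in R and
  B.\<close>

lemma cap_depth_chart_bounds:
  assumes "norm \<xi> = 1"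
  shows "R / B * (\<xi> \<bullet> e)\<^sup>2 \<le> cap_depth e \<alpha> (chart \<xi>)" "cap_depth e \<alpha> (chart \<xi>) \<le> 2 * R * (\<xi> \<bullet> e)\<^sup>2"
proof -
  let ?q = "sqrt (1 - (\<xi> \<bullet> e)\<^sup>2)"
  have q: "0 \<le> ?q" "?q \<le> 1" "?q\<^sup>2 = 1 - (\<xi> \<bullet> e)\<^sup>2" using inner_e_le_1[OF assms] by auto
  have Rq: "0 \<le> R * ?q" "R * ?q \<le> R" using q R_pos by auto
  note d = arctan_diff_bounds[OF Rq]
  have "?q\<^sup>2 \<le> ?q" using mult_left_mono[OF q(2,1)] by (simp only: power2_eq_square mult_1_right)
  then have "1 - ?q \<le> (\<xi> \<bullet> e)\<^sup>2" using q(3) by linarith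
  then have "R * (1 - ?q) \<le> R * (\<xi> \<bullet> e)\<^sup>2" using R_pos by (intro mult_left_mono) auto
  then show "cap_depth e \<alpha> (chart \<xi>) \<le> 2 * R * (\<xi> \<bullet> e)\<^sup>2"
    unfolding cap_depth_chart[OF assms] using d(1) by (simp add: algebra_simps)
  have "(1 - q) * (1 + q) = 1 - q\<^sup>2" for q :: real by (simp add: power2_eq_square algebra_simps)
  then have "(\<xi> \<bullet> e)\<^sup>2 = (1 - ?q) * (1 + ?q)" using q(3) by (metis diff_diff_eq2 add_diff_cancel_left')
  also have "\<dots> \<le> (1 - ?q) * 2" using q by (intro mult_left_mono) auto
  finally have "R / B * (\<xi> \<bullet> e)\<^sup>2 \<le> R / B * ((1 - ?q) * 2)"
    using R_pos B_ge_1 by (intro mult_left_mono) auto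
  also have "\<dots> = 2 * ((R - R * ?q) / B)"
    by (simp add: diff_divide_distrib right_diff_distrib mult_ac)
  also have "\<dots> \<le> 2 * ((R - R * ?q) / (1 + R\<^sup>2))"
    using Rq R_B B_ge_1 one_plus_R_sq_pos by (intro mult_left_mono divide_left_mono mult_pos_pos) auto
  also have "\<dots> \<le> cap_depth e \<alpha> (chart \<xi>)" unfolding cap_depth_chart[OF assms] by (rule mult_left_mono[OF d(2)]) simp
  finally show "R / B * (\<xi> \<bullet> e)\<^sup>2 \<le> cap_depth e \<alpha> (chart \<xi>)" .
qed

lemma inner_e_diff_le: "\<bar>x \<bullet> e - y \<bullet> e\<bar> \<le> norm (x - y)"
  using Cauchy_Schwarz_ineq2[of "x - y" e] norm_e by (simp add: inner_diff_left)

text \<open>The point is the factor of heights on the right: it cancels later against a sum of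
  square roots of depths. If the heights add up to at least 1/2, the plain Lipschitz bound suffices;
  otherwise both radii are at least 1/2, and the difference of their squares contains the
  factor.\<close>

lemma radius_diff_le:
  assumes "\<xi> \<in> hemisphere" "\<eta> \<in> hemisphere"
  shows "\<bar>sqrt (1 - (\<xi> \<bullet> e)\<^sup>2) - sqrt (1 - (\<eta> \<bullet> e)\<^sup>2)\<bar> \<le> 2 * (\<xi> \<bullet> e + \<eta> \<bullet> e) * norm (\<xi> - \<eta>)"
proof -
  have n: "norm \<xi> = 1" "norm \<eta> = 1" "0 \<le> \<xi> \<bullet> e" "0 \<le> \<eta> \<bullet> e"
    using assms by (auto simp: hemisphere_def)
  let ?s = "\<xi> \<bullet> e" and ?t = "\<eta> \<bullet> e"
  let ?q = "sqrt (1 - ?s\<^sup>2)" and ?r = "sqrt (1 - ?t\<^sup>2)"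
  have sq: "?q\<^sup>2 = 1 - ?s\<^sup>2" "?r\<^sup>2 = 1 - ?t\<^sup>2" using inner_e_le_1 n by auto
  show ?thesis
  proof (cases "1 / 2 \<le> ?s + ?t")
    case True
    let ?v = "(\<xi> - \<eta>) - ((\<xi> - \<eta>) \<bullet> e) *\<^sub>R e"
    have "\<bar>?q - ?r\<bar> \<le> norm ((\<xi> - ?s *\<^sub>R e) - (\<eta> - ?t *\<^sub>R e))"
      unfolding norm_proj[OF n(1), symmetric] norm_proj[OF n(2), symmetric] by (rule norm_triangle_ineq3)
    also have "(\<xi> - ?s *\<^sub>R e) - (\<eta> - ?t *\<^sub>R e) = ?v"
      by (simp add: inner_diff_left scaleR_diff_left)
    also have "norm ?v \<le> norm (\<xi> - \<eta>)"
    proof (rule power2_le_imp_le)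
      show "(norm ?v)\<^sup>2 \<le> (norm (\<xi> - \<eta>))\<^sup>2"
        unfolding power2_norm_eq_inner
        by (simp add: inner_diff_left[of "\<xi> - \<eta>"] inner_diff_right[of _ "\<xi> - \<eta>"] inner_commute[of e "\<xi> - \<eta>"])
    qed auto
    also have "\<dots> \<le> 2 * (?s + ?t) * norm (\<xi> - \<eta>)"
      using True mult_right_mono[of 1 "2 * (?s + ?t)" "norm (\<xi> - \<eta>)"] by simp
    finally show ?thesis .
  next
    case False
    then have "?s\<^sup>2 \<le> (1/2)\<^sup>2" "?t\<^sup>2 \<le> (1/2)\<^sup>2" using n by (auto intro!: power_mono)
    then have st: "(1/2)\<^sup>2 \<le> 1 - ?s\<^sup>2" "(1/2)\<^sup>2 \<le> 1 - ?t\<^sup>2" by (auto simp: power_divide)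
    have "1 / 2 \<le> ?q" "1 / 2 \<le> ?r" using st[THEN real_le_rsqrt] by auto
    then have "1 \<le> ?q + ?r" by linarith
    then have "\<bar>?q - ?r\<bar> * 1 \<le> \<bar>?q - ?r\<bar> * (?q + ?r)" by (rule mult_left_mono) simp
    also have "\<dots> = \<bar>?q\<^sup>2 - ?r\<^sup>2\<bar>"
    proof -
      have "\<bar>a - b\<bar> * (a + b) = \<bar>a\<^sup>2 - b\<^sup>2\<bar>" if "0 \<le> a + b" for a b :: real
        using that by (simp add: power2_eq_square square_diff_square_factored abs_mult)
      then show ?thesis using \<open>1 \<le> ?q + ?r\<close> by (rule meta_mp) linarith
    qed
    also have "?q\<^sup>2 - ?r\<^sup>2 = (?s + ?t) * (?t - ?s)" unfolding sq by (simp add: power2_eq_square algebra_simps)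
    also have "\<bar>(?s + ?t) * (?t - ?s)\<bar> = (?s + ?t) * \<bar>?s - ?t\<bar>"
      using n by (simp add: abs_mult abs_minus_commute)
    also have "\<dots> \<le> (?s + ?t) * norm (\<xi> - \<eta>)"
      using n inner_e_diff_le by (intro mult_left_mono) auto
    also have "\<dots> \<le> 2 * (?s + ?t) * norm (\<xi> - \<eta>)"
      using n by (intro mult_right_mono) auto
    finally show ?thesis by simp
  qed
qed

text \<open>Multiplying by the sum of the roots gives the difference of the depths, which carries
  the sum of the heights as a factor; the sum of the roots is at least sqrt(R/B) times that same
  factor.\<close>

lemma sqrt_depth_diff_le:
  assumes "\<xi> \<in> hemisphere" "\<eta> \<in> hemisphere"
  shows "\<bar>sqrt (cap_depth e \<alpha> (chart \<xi>)) - sqrt (cap_depth e \<alpha> (chart \<eta>))\<bar>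
    \<le> 4 * sqrt (R * B) * norm (\<xi> - \<eta>)"
proof -
  have n: "norm \<xi> = 1" "norm \<eta> = 1" "0 \<le> \<xi> \<bullet> e" "0 \<le> \<eta> \<bullet> e"
    using assms by (auto simp: hemisphere_def)
  let ?s = "\<xi> \<bullet> e" and ?t = "\<eta> \<bullet> e"
  let ?b = "cap_depth e \<alpha> (chart \<xi>)" and ?c = "cap_depth e \<alpha> (chart \<eta>)"
  note b = cap_depth_chart_bounds[OF n(1)] and c = cap_depth_chart_bounds[OF n(2)]
  have RB: "0 < R / B" using R_pos B_ge_1 by simp
  show ?thesis
  proof (cases "?s + ?t = 0")
    case True
    \<comment> \<open>Both points lie on the equator, where the factor to be cancelled is 0; their
      images are on the rim and have depth 0.\<close>
    then have "?s = 0" "?t = 0" using n by auto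
    then have "?b = 0" "?c = 0" using b c by auto
    then show ?thesis using R_pos B_ge_1 by simp
  next
    case False
    then have st: "0 < ?s + ?t" using n by auto
    have "0 \<le> R / B * ?s\<^sup>2" "0 \<le> R / B * ?t\<^sup>2"
      by (intro mult_nonneg_nonneg less_imp_le[OF RB] zero_le_power2)+
    then have bc: "0 \<le> ?b" "0 \<le> ?c" using order_trans[OF _ b(1)] order_trans[OF _ c(1)] by blast+
    have rt: "sqrt (R / B) * ?s = sqrt (R / B * ?s\<^sup>2)" "sqrt (R / B) * ?t = sqrt (R / B * ?t\<^sup>2)"
      unfolding real_sqrt_mult[of "R / B"] using n by simp_all
    have low: "sqrt (R / B) * (?s + ?t) \<le> sqrt ?b + sqrt ?c"
      unfolding distrib_left rt by (rule add_mono[OF b(1)[THEN real_sqrt_le_mono] c(1)[THEN real_sqrt_le_mono]])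
    have arct: "\<bar>arctan (R * u) - arctan (R * v)\<bar> \<le> R * \<bar>u - v\<bar>" if "0 \<le> u" "0 \<le> v" for u v
    proof (cases "u \<le> v")
      case True
      then have "R * u \<le> R * v" using R_pos by simp
      then show ?thesis using arctan_diff_bounds(1)[of "R * u" "R * v"] that R_pos True
        arctan_monotone'[of "R * u" "R * v"]
        by (simp add: abs_if algebra_simps)
    next
      case False
      then have "R * v \<le> R * u" using R_pos by simp
      then show ?thesis using arctan_diff_bounds(1)[of "R * v" "R * u"] that R_pos False
        arctan_monotone'[of "R * v" "R * u"]
        by (simp add: abs_if algebra_simps)
    qed
    have "\<bar>sqrt ?b - sqrt ?c\<bar> * (sqrt ?b + sqrt ?c) = \<bar>?b - ?c\<bar>"
    proof -
      have "?b - ?c = (sqrt ?b - sqrt ?c) * (sqrt ?b + sqrt ?c)"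
        using bc by (simp add: algebra_simps)
      moreover have "0 \<le> sqrt ?b + sqrt ?c" using bc by simp
      ultimately show ?thesis by (simp add: abs_mult)
    qed
    also have "\<dots> \<le> 2 * (R * \<bar>sqrt (1 - ?s\<^sup>2) - sqrt (1 - ?t\<^sup>2)\<bar>)"
      using arct[of "sqrt (1 - ?s\<^sup>2)" "sqrt (1 - ?t\<^sup>2)"] inner_e_le_1[OF n(1)] inner_e_le_1[OF n(2)]
      unfolding cap_depth_chart[OF n(1)] cap_depth_chart[OF n(2)] by simp
    also have "\<dots> \<le> 2 * (R * (2 * (?s + ?t) * norm (\<xi> - \<eta>)))"
      using radius_diff_le[OF assms] R_pos by (intro mult_left_mono) auto
    also have "\<dots> = 4 * R * norm (\<xi> - \<eta>) * (?s + ?t)" by simp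
    finally have "\<bar>sqrt ?b - sqrt ?c\<bar> * (sqrt ?b + sqrt ?c) \<le> 4 * R * norm (\<xi> - \<eta>) * (?s + ?t)" .
    moreover have "\<bar>sqrt ?b - sqrt ?c\<bar> * (sqrt (R / B) * (?s + ?t)) \<le> \<bar>sqrt ?b - sqrt ?c\<bar> * (sqrt ?b + sqrt ?c)"
      using low by (intro mult_left_mono) auto
    ultimately have "(\<bar>sqrt ?b - sqrt ?c\<bar> * sqrt (R / B)) * (?s + ?t) \<le> (4 * R * norm (\<xi> - \<eta>)) * (?s + ?t)"
      by (simp add: mult.assoc)
    then have *: "\<bar>sqrt ?b - sqrt ?c\<bar> * sqrt (R / B) \<le> 4 * R * norm (\<xi> - \<eta>)"
      using st by (rule mult_right_le_imp_le)
    have "sqrt (R * B) * sqrt (R / B) = R"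
      using R_pos B_ge_1 by (simp flip: real_sqrt_mult)
    then have eq: "4 * R * norm (\<xi> - \<eta>) = 4 * sqrt (R * B) * norm (\<xi> - \<eta>) * sqrt (R / B)" by simp
    show ?thesis using *[unfolded eq] by (rule mult_right_le_imp_le) (use RB in simp)
  qed
qed

text \<open>By 2 R \<le> \<alpha> B the geodesic part contributes 4 and the depth part 8 to the
  coefficient of (\<alpha> B)^2, together below 16; the 1/\<alpha> in \<open>cap_rho\<close> then
  cancels.\<close>

lemma cap_rho_chart_le:
  assumes "\<xi> \<in> hemisphere" "\<eta> \<in> hemisphere"
  shows "cap_rho e \<alpha> (chart \<xi>) (chart \<eta>) \<le> 4 * B * norm (\<xi> - \<eta>)"
proof -
  have n: "norm \<xi> = 1" "norm \<eta> = 1" using assms by (auto simp: hemisphere_def)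
  let ?x = "chart \<xi>" and ?y = "chart \<eta>" and ?m = "norm (\<xi> - \<eta>)"
  have "(norm (?x - ?y))\<^sup>2 \<le> (2 * R * ?m)\<^sup>2"
  proof -
    let ?D = "chart_denom \<xi> * chart_denom \<eta>"
    have "1 \<le> ?D" using mult_mono[OF n[THEN chart_denom_bounds(1)]] chart_denom_bounds(1)[OF n(1)] by simp
    have "(norm (?x - ?y))\<^sup>2 = 4 * R\<^sup>2 * (?m\<^sup>2 - (\<xi> \<bullet> e - \<eta> \<bullet> e)\<^sup>2) / ?D" by (rule norm_chart_diff[OF n])
    also have "\<dots> \<le> 4 * R\<^sup>2 * ?m\<^sup>2 / ?D" using \<open>1 \<le> ?D\<close> by (intro divide_right_mono mult_left_mono) auto
    also have "\<dots> \<le> 4 * R\<^sup>2 * ?m\<^sup>2 / 1" using \<open>1 \<le> ?D\<close> by (intro divide_left_mono) auto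
    finally show ?thesis by (simp add: power_mult_distrib)
  qed
  then have "norm (?x - ?y) \<le> 2 * R * ?m" by (rule power2_le_imp_le) (use R_pos in simp)
  then have "geo_dist ?x ?y \<le> 4 * R * ?m"
    using geo_dist_le_norm_diff(1)[OF norm_chart[OF n(1)] norm_chart[OF n(2)]] by linarith
  then have g: "(geo_dist ?x ?y)\<^sup>2 \<le> (4 * R * ?m)\<^sup>2"
    using geo_dist_le_norm_diff(2)[OF norm_chart[OF n(1)] norm_chart[OF n(2)]] by (intro power_mono)
  have "\<bar>sqrt (cap_depth e \<alpha> ?x) - sqrt (cap_depth e \<alpha> ?y)\<bar>\<^sup>2 \<le> (4 * sqrt (R * B) * ?m)\<^sup>2"
    using sqrt_depth_diff_le[OF assms] by (intro power_mono) auto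
  then have h: "(sqrt (cap_depth e \<alpha> ?x) - sqrt (cap_depth e \<alpha> ?y))\<^sup>2 \<le> 16 * (R * B) * ?m\<^sup>2"
    using R_pos B_ge_1 by (simp add: power_mult_distrib)
  have a: "0 < \<alpha>" "2 * R \<le> \<alpha> * B" using alpha_bounds B_ge_1 by (auto simp: field_simps)
  have aB: "0 \<le> \<alpha> * B" by (rule order_trans[OF _ a(2)]) (use R_pos in simp)
  have "(2 * R) * (2 * R) \<le> (\<alpha> * B) * (\<alpha> * B)"
    by (rule mult_mono[OF a(2) a(2) aB]) (use R_pos in simp)
  then have r1: "16 * R\<^sup>2 \<le> 4 * (\<alpha> * B)\<^sup>2" by (simp add: power2_eq_square)
  have "\<alpha> * B * (2 * R) \<le> \<alpha> * B * (\<alpha> * B)" by (rule mult_left_mono[OF a(2) aB])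
  then have r2: "16 * (\<alpha> * (R * B)) \<le> 8 * (\<alpha> * B)\<^sup>2" by (simp add: power2_eq_square mult_ac)
  have "(geo_dist ?x ?y)\<^sup>2 + \<alpha> * (sqrt (cap_depth e \<alpha> ?x) - sqrt (cap_depth e \<alpha> ?y))\<^sup>2
      \<le> (4 * R * ?m)\<^sup>2 + \<alpha> * (16 * (R * B) * ?m\<^sup>2)"
    using g h a by (intro add_mono mult_left_mono) auto
  also have "\<dots> = (16 * R\<^sup>2 + 16 * (\<alpha> * (R * B))) * ?m\<^sup>2" by (simp add: power_mult_distrib algebra_simps)
  also have "\<dots> \<le> (16 * (\<alpha> * B)\<^sup>2) * ?m\<^sup>2"
  proof (rule mult_right_mono)
    show "16 * R\<^sup>2 + 16 * (\<alpha> * (R * B)) \<le> 16 * (\<alpha> * B)\<^sup>2"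
      using r1 r2 zero_le_power2[of "\<alpha> * B"] by linarith
  qed auto
  also have "\<dots> = (4 * \<alpha> * B * ?m)\<^sup>2" by (simp add: power_mult_distrib)
  finally have "sqrt ((geo_dist ?x ?y)\<^sup>2 + \<alpha> * (sqrt (cap_depth e \<alpha> ?x) - sqrt (cap_depth e \<alpha> ?y))\<^sup>2)
      \<le> 4 * \<alpha> * B * ?m"
    using a B_ge_1 by (intro real_le_lsqrt) auto
  then show ?thesis using a by (simp add: cap_rho_def divide_le_eq mult_ac)
qed

text \<open>At height s the square root in the weight is at most B s, because the depth is at most 2
  R s^2 and 2 R \<le> \<alpha> B.\<close>

lemma cap_weight_chart_le:
  assumes "\<xi> \<in> hemisphere" "0 \<le> r"
  shows "cap_weight d e \<alpha> r (chart \<xi>) \<le> (2 * R) ^ d * r ^ d * (r + B * (\<xi> \<bullet> e))"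
proof -
  have n: "norm \<xi> = 1" "0 \<le> \<xi> \<bullet> e" using assms by (auto simp: hemisphere_def)
  have a: "0 < \<alpha>" "2 * R \<le> \<alpha> * B" using alpha_bounds B_ge_1 by (auto simp: field_simps)
  have "1 - geo_dist (chart \<xi>) e / \<alpha> = cap_depth e \<alpha> (chart \<xi>) / \<alpha>"
    using a(1) by (simp add: cap_depth_def diff_divide_distrib)
  also have "\<dots> \<le> 2 * R * (\<xi> \<bullet> e)\<^sup>2 / \<alpha>"
    using cap_depth_chart_bounds(2)[OF n(1)] a by (intro divide_right_mono) auto
  also have "\<dots> \<le> \<alpha> * B * (\<xi> \<bullet> e)\<^sup>2 / \<alpha>"
    using a by (intro divide_right_mono mult_right_mono) auto
  also have "\<dots> = B * 1 * (\<xi> \<bullet> e)\<^sup>2" using a by simp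
  also have "\<dots> \<le> B * B * (\<xi> \<bullet> e)\<^sup>2" using B_ge_1 by (intro mult_right_mono mult_left_mono) auto
  finally have "sqrt (1 - geo_dist (chart \<xi>) e / \<alpha>) \<le> B * (\<xi> \<bullet> e)"
    using B_ge_1 n by (intro real_le_lsqrt) (auto simp: power2_eq_square mult_ac)
  then have "r ^ (d + 1) + r ^ d * sqrt (1 - geo_dist (chart \<xi>) e / \<alpha>) \<le> r ^ (d + 1) + r ^ d * (B * (\<xi> \<bullet> e))"
    using assms by (intro add_left_mono mult_left_mono) auto
  then have "cap_weight d e \<alpha> r (chart \<xi>) \<le> \<alpha> ^ d * (r ^ (d + 1) + r ^ d * (B * (\<xi> \<bullet> e)))"
    unfolding cap_weight_def using a by (intro mult_left_mono) auto
  also have "\<dots> \<le> (2 * R) ^ d * (r ^ (d + 1) + r ^ d * (B * (\<xi> \<bullet> e)))"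
    using alpha_bounds assms(2) n B_ge_1 by (intro mult_right_mono power_mono) auto
  finally show ?thesis by (simp add: algebra_simps)
qed

text \<open>The tail lies in [1/2, 1], so replacing \<open>lifted_poly\<close> by the pulled back
  polynomial costs at most a factor 2; with the halving on the small ball this makes 4. The
  hypothesis on \<open>L\<close> is the Chernoff condition for v = 1 - chart_denom / B, which is at
  most 1 - 1/B. The trigonometric degree 2 L n gives the frequency 4 L n.\<close>

lemma localised_maximum_chart:
  assumes dim: "2 \<le> CARD('n)" and P: "poly_fun_deg_le n P" and n: "1 \<le> n"
    and L: "1 \<le> L" "((1 + (1 - 1 / B)) / 2) ^ L \<le> 1 / 4" and y: "y \<in> hemisphere"
  obtains x where "x \<in> hemisphere"
    "\<bar>P (chart y)\<bar> * (1 + real (4 * L * n) * norm (y - x)) ^ K \<le> 2 * \<bar>P (chart x)\<bar>"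
    "\<forall>z\<in>hemisphere. 2 * (3 ^ (K + 1) * real (K + 1) * real (4 * L * n)) * norm (z - x) \<le> 1 \<longrightarrow>
      \<bar>P (chart x)\<bar> \<le> 4 * \<bar>P (chart z)\<bar>"
proof -
  let ?G = "lifted_poly P n (L * n)"
  have W: "binomial_upper_tail n (L * n) (1 - chart_denom x / B) \<le> 1"
    "1 / 2 \<le> binomial_upper_tail n (L * n) (1 - chart_denom x / B)" if "norm x = 1" for x
  proof -
    have "0 \<le> 1 - chart_denom x / B" "1 - chart_denom x / B \<le> 1 - 1 / B" "1 - 1 / B \<le> 1"
      using chart_denom_bounds[OF that] B_ge_1 by (auto simp: field_simps)
    then show "binomial_upper_tail n (L * n) (1 - chart_denom x / B) \<le> 1"
      "1 / 2 \<le> binomial_upper_tail n (L * n) (1 - chart_denom x / B)"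
      using binomial_upper_tail_bounds[of _ "1 - 1 / B" L n] L n by auto
  qed
  have G: "\<bar>?G x\<bar> \<le> \<bar>P (chart x)\<bar>" "\<bar>P (chart x)\<bar> \<le> 2 * \<bar>?G x\<bar>" if "norm x = 1" for x
    using W[OF that] mult_left_mono[OF W(1)[OF that], of "\<bar>P (chart x)\<bar>"]
      mult_left_mono[OF W(2)[OF that], of "\<bar>P (chart x)\<bar>"]
    by (auto simp: lifted_poly_def abs_mult)
  have cont: "continuous_on hemisphere ?G"
  proof -
    obtain c where c: "P = (\<lambda>x. \<Sum>k | (\<Sum>i\<in>UNIV. k i) \<le> n. c k * (\<Prod>i\<in>UNIV. (x $ i) ^ k i))"
      using P unfolding poly_fun_deg_le_def by blast
    have "hemisphere \<subseteq> {\<xi>. norm \<xi> = 1}" by (auto simp: hemisphere_def)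
    then have ch: "continuous_on hemisphere chart" by (rule continuous_on_subset[OF continuous_on_chart])
    have B: "B \<noteq> 0" using B_ge_1 by auto
    show ?thesis
      unfolding lifted_poly_def [abs_def] binomial_upper_tail_def chart_denom_def c
      using B by (intro continuous_intros ch) auto
  qed
  have refl: "?G (x - (2 * (x \<bullet> e)) *\<^sub>R e) = ?G x" for x
    by (simp add: lifted_poly_def chart_reflect chart_denom_reflect)
  have h: "hemisphere = {x. norm x = 1 \<and> 0 \<le> x \<bullet> e}" by (simp add: hemisphere_def)
  have "1 \<le> 2 * (L * n)" using L n by (simp add: Suc_leI)
  show thesis
  proof (rule localised_maximum[of "2 * (L * n)" e ?G y K, folded h])
    show "2 \<le> DIM(real ^ 'n)" "1 \<le> 2 * (L * n)" "norm e = 1" "continuous_on hemisphere ?G" "y \<in> hemisphere"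
      using dim \<open>1 \<le> 2 * (L * n)\<close> norm_e cont y by simp_all
    show "?G (x - (2 * (x \<bullet> e)) *\<^sub>R e) = ?G x" for x by (rule refl)
    show "trig_deg (2 * (L * n)) (\<lambda>t. ?G (cos t *\<^sub>R x + sin t *\<^sub>R u))"
      if "norm x = 1" "norm u = 1" "x \<bullet> u = 0" for x u
      by (rule trig_deg_lifted_poly[OF P that])
  next
    fix x
    assume x: "x \<in> hemisphere"
      "\<bar>?G y\<bar> * (1 + real (2 * (2 * (L * n))) * norm (y - x)) ^ K \<le> \<bar>?G x\<bar>"
      "\<And>z. norm z = 1 \<Longrightarrow> \<bar>?G z\<bar> \<ge>
        \<bar>?G x\<bar> - 3 ^ (K + 1) * real (K + 1) * real (2 * (2 * (L * n))) * \<bar>?G x\<bar> * norm (z - x)"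
    have nx: "norm x = 1" "norm y = 1" using x(1) y by (auto simp: hemisphere_def)
    show thesis
    proof (rule that[OF x(1)])
      have w: "0 \<le> (1 + real (4 * L * n) * norm (y - x)) ^ K" by simp
      have "\<bar>P (chart y)\<bar> * (1 + real (4 * L * n) * norm (y - x)) ^ K
          \<le> (2 * \<bar>?G y\<bar>) * (1 + real (4 * L * n) * norm (y - x)) ^ K"
        using G(2)[OF nx(2)] w by (intro mult_right_mono)
      also have "\<dots> \<le> 2 * \<bar>?G x\<bar>" using x(2) by (simp add: mult.assoc)
      also have "\<dots> \<le> 2 * \<bar>P (chart x)\<bar>" using G(1)[OF nx(1)] by simp
      finally show "\<bar>P (chart y)\<bar> * (1 + real (4 * L * n) * norm (y - x)) ^ K \<le> 2 * \<bar>P (chart x)\<bar>" .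
    next
      show "\<forall>z\<in>hemisphere. 2 * (3 ^ (K + 1) * real (K + 1) * real (4 * L * n)) * norm (z - x) \<le> 1 \<longrightarrow>
        \<bar>P (chart x)\<bar> \<le> 4 * \<bar>P (chart z)\<bar>"
      proof (intro ballI impI)
        fix z assume z: "z \<in> hemisphere" and close: "2 * (3 ^ (K + 1) * real (K + 1) * real (4 * L * n)) * norm (z - x) \<le> 1"
        then have nz: "norm z = 1" by (simp add: hemisphere_def)
        define A where "A = 3 ^ (K + 1) * real (K + 1) * real (4 * L * n) * norm (z - x)"
        have "A \<le> 1 / 2" using close by (simp add: A_def)
        then have "A * \<bar>?G x\<bar> \<le> 1 / 2 * \<bar>?G x\<bar>" by (intro mult_right_mono) auto
        moreover have "\<bar>?G z\<bar> \<ge> \<bar>?G x\<bar> - A * \<bar>?G x\<bar>"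
          using x(3)[OF nz] by (simp add: A_def mult_ac)
        ultimately show "\<bar>P (chart x)\<bar> \<le> 4 * \<bar>P (chart z)\<bar>"
          using G(2)[OF nx(1)] G(1)[OF nz] by linarith
      qed
    qed
  qed
qed

end

section \<open>Measure of boxes and counting of points\<close>

definition stretch :: "'a::real_inner \<Rightarrow> real \<Rightarrow> 'a \<Rightarrow> 'a" where
  "stretch u c y = y + ((c - 1) * (y \<bullet> u)) *\<^sub>R u"

lemma linear_stretch: "linear (stretch u c)"
  by (rule linearI) (simp_all add: stretch_def inner_add_left algebra_simps)

text \<open>Conjugation by an orthogonal map that takes a coordinate axis to \<open>u\<close> makes
  the stretch diagonal.\<close>

lemma det_stretch:
  fixes u :: "real ^ 'n::{finite,wellorder}"
  assumes "norm u = 1"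
  shows "det (matrix (stretch u c)) = c"
proof -
  fix k :: 'n
  have "norm (axis k (1::real)) = norm u" using assms by simp
  then obtain T :: "(real, 'n) vec \<Rightarrow> (real, 'n) vec" where T: "orthogonal_transformation T" "T (axis k 1) = u"
    by (rule orthogonal_transformation_exists)
  have linT: "linear T" using T(1) by (rule orthogonal_transformation_linear)
  let ?S = "stretch (axis k (1::real)) c"
  have "stretch u c \<circ> T = T \<circ> ?S"
  proof
    fix y
    have "T y \<bullet> T (axis k 1) = y \<bullet> axis k 1"
      using T(1) by (simp add: orthogonal_transformation_def)
    then have "T y \<bullet> u = y \<bullet> axis k 1" by (simp only: T(2))
    then show "(stretch u c \<circ> T) y = (T \<circ> ?S) y"
      using T(2) by (simp add: stretch_def linear_add[OF linT] linear_cmul[OF linT])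
  qed
  then have "det (matrix (stretch u c \<circ> T)) = det (matrix (T \<circ> ?S))" by simp
  then have "det (matrix (stretch u c)) * det (matrix T) = det (matrix T) * det (matrix ?S)"
    by (simp only: matrix_compose[OF linT linear_stretch] matrix_compose[OF linear_stretch linT] det_mul)
  moreover have "det (matrix T) \<noteq> 0"
    using orthogonal_transformation_det[OF T(1)] by auto
  ultimately have "det (matrix (stretch u c)) = det (matrix ?S)" by simp
  also have "\<dots> = (\<Prod>i\<in>UNIV. matrix ?S $ i $ i)"
    by (rule det_diagonal) (simp add: matrix_def stretch_def inner_axis, simp add: axis_def)
  also have "\<dots> = (\<Prod>i\<in>UNIV. if i = k then c else 1)"
    by (rule prod.cong) (simp_all add: matrix_def stretch_def inner_axis, simp add: axis_def)
  also have "\<dots> = c" by simp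
  finally show ?thesis .
qed

text \<open>For orthonormal \<open>x\<close> and \<open>u\<close> the factors are 1 along
  \<open>x\<close>, \<open>h\<close> along \<open>u\<close> and \<open>r\<close> on their orthogonal
  complement.\<close>

definition anisotropic :: "'a::real_inner \<Rightarrow> 'a \<Rightarrow> real \<Rightarrow> real \<Rightarrow> 'a \<Rightarrow> 'a" where
  "anisotropic x u h r y = r *\<^sub>R y + ((h - r) * (y \<bullet> u)) *\<^sub>R u + ((1 - r) * (y \<bullet> x)) *\<^sub>R x"

lemma measure_anisotropic_image:
  fixes x u :: "real ^ 'n::{finite,wellorder}"
  assumes "norm x = 1" "norm u = 1" "x \<bullet> u = 0" "0 < h" "0 < r" "2 \<le> CARD('n)" and S: "S \<in> lmeasurable"
  defines "L \<equiv> anisotropic x u h r"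
  shows "L ` S \<in> lmeasurable" "measure lebesgue (L ` S) = h * r ^ (CARD('n) - 2) * measure lebesgue S"
proof -
  \<comment> \<open>Scale everything by r, then correct the two exceptional directions.\<close>
  have L: "L = stretch x (1 / r) \<circ> stretch u (h / r) \<circ> (*\<^sub>R) r"
    using assms
    by (auto simp: L_def anisotropic_def stretch_def inner_commute[of u x] inner_add_left algebra_simps fun_eq_iff)
  have lin: "linear ((*\<^sub>R) r :: (real, 'n) vec \<Rightarrow> (real, 'n) vec)" by (simp add: linear_scaleR)
  have linL: "linear L" unfolding L by (intro linear_compose linear_stretch lin)
  have "det (matrix L) = (1 / r) * ((h / r) * r ^ CARD('n))"
    unfolding L comp_assoc
    using assms(1,2) by (simp add: matrix_compose linear_stretch lin linear_compose det_mul det_stretch)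
  also have "r ^ CARD('n) = r ^ (CARD('n) - 2) * r\<^sup>2"
    using assms(6) by (metis power_add le_add_diff_inverse2)
  finally have det: "\<bar>det (matrix L)\<bar> = h * r ^ (CARD('n) - 2)"
    using assms(4,5) by (simp add: power2_eq_square)
  show "measure lebesgue (L ` S) = h * r ^ (CARD('n) - 2) * measure lebesgue S"
    by (simp only: measure_linear_image[OF linL S] det)
  show "L ` S \<in> lmeasurable" by (rule measurable_linear_image[OF linL S])
qed

text \<open>The library states the transformation formula for linear maps only for index types in
  \<open>wellorder\<close>; an arbitrary finite index type is replaced by an initial segment of the naturals.\<close>

typedef (overloaded) ('a::finite) index = "{..<CARD('a)}"
  by (rule exI[of _ 0]) simp

instantiation index :: (finite) "{finite, wellorder}"
begin

definition less_eq_index :: "'a index \<Rightarrow> 'a index \<Rightarrow> bool" where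
  "less_eq_index i j \<longleftrightarrow> Rep_index i \<le> Rep_index j"

definition less_index :: "'a index \<Rightarrow> 'a index \<Rightarrow> bool" where
  "less_index i j \<longleftrightarrow> Rep_index i < Rep_index j"

instance
proof
  interpret type_definition "Rep_index :: 'a index \<Rightarrow> nat" Abs_index "{..<CARD('a)}"
    by (rule type_definition_index)
  show "finite (UNIV :: 'a index set)" by (simp add: univ)
  fix P :: "'a index \<Rightarrow> bool" and i
  assume step: "\<And>i. (\<And>j. j < i \<Longrightarrow> P j) \<Longrightarrow> P i"
  have "\<forall>i. Rep_index i = k \<longrightarrow> P i" for k
    by (induction k rule: less_induct) (metis step less_index_def)
  then show "P i" by blast
qed (auto simp: less_eq_index_def less_index_def Rep_index_inject)

end

lemma ex_bij_index: "\<exists>g :: 'a::finite \<Rightarrow> 'a index. bij g"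
proof -
  interpret type_definition "Rep_index :: 'a index \<Rightarrow> nat" Abs_index "{..<CARD('a)}"
    by (rule type_definition_index)
  have "CARD('a index) = CARD('a)" using card by simp
  then show ?thesis by (intro finite_same_card_bij) simp_all
qed

lemma prod_Basis_cart: "(\<Prod>b\<in>Basis. F b) = (\<Prod>i\<in>UNIV. F (axis i (1::real) :: real ^ 'n::finite))"
proof -
  have B: "(Basis :: (real ^ 'n) set) = (\<lambda>i. axis i 1) ` UNIV" by (auto simp: Basis_vec_def)
  have "inj (\<lambda>i::'n. axis i (1::real))" by (auto simp: inj_on_def axis_eq_axis)
  then show ?thesis unfolding B by (simp add: prod.reindex)
qed

lemma lborel_reindex:
  fixes g :: "'n::finite \<Rightarrow> 'm::finite"
  assumes "bij g"
  shows "distr lborel borel (\<lambda>y :: real ^ 'm. (\<chi> i. y $ g i) :: real ^ 'n) = lborel"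
proof (rule lborel_eqI[symmetric])
  let ?Q = "\<lambda>y :: real ^ 'm. (\<chi> i. y $ g i) :: real ^ 'n"
  let ?P = "\<lambda>y :: real ^ 'n. (\<chi> j. y $ inv g j) :: real ^ 'm"
  fix l u :: "real ^ 'n" assume lu: "\<And>b. b \<in> Basis \<Longrightarrow> l \<bullet> b \<le> u \<bullet> b"
  have lu': "l $ i \<le> u $ i" for i using lu[of "axis i 1"] by (simp add: inner_axis)
  have inv: "inv g (g i) = i" "g (inv g j) = j" for i j
    using assms by (simp_all add: bij_is_inj bij_is_surj surj_f_inv_f)
  have cont: "continuous_on UNIV ?Q" by (intro continuous_intros)
  have "?Q -` box l u = box (?P l) (?P u)"
    by (auto simp: mem_box_cart) (metis inv)+
  then have "emeasure (distr lborel borel ?Q) (box l u) = emeasure lborel (box (?P l) (?P u))"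
    using borel_measurable_continuous_onI[OF cont] by (subst emeasure_distr) auto
  also have "\<dots> = (\<Prod>b\<in>Basis. (?P u - ?P l) \<bullet> b)"
    using lu' by (intro emeasure_lborel_box) (auto simp: Basis_vec_def inner_axis)
  also have "\<dots> = (\<Prod>b\<in>Basis. (u - l) \<bullet> b)"
  proof -
    have "bij (inv g)" by (rule bij_imp_bij_inv[OF assms])
    then have "(\<Prod>j\<in>UNIV. u $ inv g j - l $ inv g j) = (\<Prod>i\<in>UNIV. u $ i - l $ i)"
      by (rule prod.reindex_bij_betw)
    then show ?thesis by (simp add: prod_Basis_cart inner_axis)
  qed
  finally show "emeasure (distr lborel borel ?Q) (box l u) = (\<Prod>b\<in>Basis. (u - l) \<bullet> b)" .
qed auto

text \<open>A reindexing of coordinates preserves inner products and Lebesgue measure, which reduces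
  the claim to the determinant formula. Stating it for a Borel superset \<open>C\<close> of the
  image keeps the conclusion within Borel measure.\<close>

lemma measure_anisotropic_image_le:
  fixes x u q :: "real ^ 'n::finite"
  assumes xu: "norm x = 1" "norm u = 1" "x \<bullet> u = 0" and hr: "0 < h" "0 < r" and n: "2 \<le> CARD('n)"
    and C: "C \<in> sets borel" "emeasure lborel C < \<infinity>" and sub: "anisotropic x u h r ` ball q s \<subseteq> C"
  shows "h * r ^ (CARD('n) - 2) * measure lborel (ball q s) \<le> measure lborel C"
proof -
  obtain g :: "'n \<Rightarrow> 'n index" where g: "bij g" using ex_bij_index by blast
  have inv: "inv g (g i) = i" "g (inv g j) = j" for i j
    using g by (simp_all add: bij_is_inj bij_is_surj surj_f_inv_f)
  let ?Q = "\<lambda>y :: real ^ 'n index. (\<chi> i. y $ g i) :: real ^ 'n"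
  let ?P = "\<lambda>y :: real ^ 'n. (\<chi> j. y $ inv g j) :: real ^ 'n index"
  have QP: "?Q (?P y) = y" "?P (?Q z) = z" for y z by (simp_all add: vec_eq_iff inv)
  have innerQ: "?Q y \<bullet> ?Q z = y \<bullet> z" for y z
    using sum.reindex_bij_betw[OF g, of "\<lambda>j. y $ j * z $ j"] by (simp add: inner_vec_def)
  have innerP: "?P y \<bullet> ?P z = y \<bullet> z" for y z using innerQ[of "?P y" "?P z"] by (simp only: QP)
  have Qm: "?Q \<in> borel_measurable borel"
    by (intro borel_measurable_continuous_onI continuous_intros)
  have pres: "emeasure lborel (?Q -` A) = emeasure lborel A" if "A \<in> sets borel" for A
  proof -
    have "emeasure (distr lborel borel ?Q) A = emeasure lborel (?Q -` A)"
      using that Qm by (simp add: emeasure_distr)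
    then show ?thesis by (simp only: lborel_reindex[OF g])
  qed
  have QL: "?Q (anisotropic (?P x) (?P u) h r y) = anisotropic x u h r (?Q y)" for y
    unfolding anisotropic_def innerQ[of y "?P x", unfolded QP, symmetric] innerQ[of y "?P u", unfolded QP, symmetric]
    by (simp add: vec_eq_iff inv)
  have distQ: "dist (?P q) y = dist q (?Q y)" for y
  proof -
    have "?Q (?P q - y) = q - ?Q y" by (simp add: vec_eq_iff inv)
    then show ?thesis using innerQ[of "?P q - y" "?P q - y"] by (simp add: dist_norm norm_eq_sqrt_inner)
  qed
  have ball: "?Q -` ball q s = ball (?P q) s" by (auto simp: distQ)
  have sub': "anisotropic (?P x) (?P u) h r ` ball (?P q) s \<subseteq> ?Q -` C"
    unfolding ball[symmetric] using sub by (auto simp: QL)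
  have card: "CARD('n index) = CARD('n)" using bij_betw_same_card[OF g] by simp
  have C': "?Q -` C \<in> sets borel" using measurable_sets[OF Qm C(1)] by simp
  then have Cl: "?Q -` C \<in> lmeasurable" using C pres[OF C(1)] by (auto simp: fmeasurable_def)
  have x': "norm (?P x) = 1" "norm (?P u) = 1" "?P x \<bullet> ?P u = 0"
    using xu innerP by (simp_all add: norm_eq_1)
  note img = measure_anisotropic_image[OF x' hr, of "ball (?P q) s"]
  have "h * r ^ (CARD('n) - 2) * measure lborel (ball q s) = h * r ^ (CARD('n) - 2) * measure lborel (ball (?P q) s)"
    using pres[of "ball q s"] unfolding ball by (simp add: measure_def)
  also have "\<dots> = measure lebesgue (anisotropic (?P x) (?P u) h r ` ball (?P q) s)"
    using img(2) n by (simp add: card)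
  also have "\<dots> \<le> measure lebesgue (?Q -` C)"
    using img(1) n sub' Cl by (intro measure_mono_fmeasurable) (auto simp: card fmeasurableD)
  also have "\<dots> = measure lborel C" using C' pres[OF C(1)] by (simp add: measure_def)
  finally show ?thesis .
qed

section \<open>Surface measure of boxes from below\<close>

lemma finite_measure_sphere_measure: "finite_measure (sphere_measure :: (real ^ 'n::finite) measure)"
proof
  have "emeasure sphere_measure (sphere (0 :: real ^ 'n) 1) =
      of_nat CARD('n) * emeasure lborel {x \<in> cball (0 :: real ^ 'n) 1 - {0}. x /\<^sub>R norm x \<in> sphere 0 1}"
    by (rule emeasure_sphere_measure) auto
  also have "\<dots> \<le> of_nat CARD('n) * emeasure lborel (cball (0 :: real ^ 'n) 1)"
    by (intro mult_left_mono emeasure_mono) auto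
  also have "\<dots> < \<infinity>"
    using emeasure_lborel_cball_finite[of "0 :: real ^ 'n" 1]
    by (simp add: ennreal_mult_less_top of_nat_less_top)
  finally show "emeasure (sphere_measure :: (real ^ 'n) measure) (space sphere_measure) \<noteq> \<infinity>"
    by simp
qed

text \<open>Surface measure is the volume of a cone, and the cone over the box contains the image of
  a fixed ball under \<open>anisotropic\<close>, as radial projection divides out the coefficient
  along \<open>x\<close>. The range of b is one-sided, so that the box can point into the
  cap.\<close>

lemma sphere_measure_lower_bound:
  fixes x u :: "real ^ 'n::finite"
  assumes xu: "norm x = 1" "norm u = 1" "x \<bullet> u = 0" and hr: "0 < h" "h \<le> 1" "0 < r" "r \<le> 1"
    and n: "2 \<le> CARD('n)" and A: "A \<in> sets borel" "A \<subseteq> sphere 0 1"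
    and box: "\<And>b w. \<lbrakk>h \<le> b; b \<le> 3 * h; w \<bullet> x = 0; w \<bullet> u = 0; norm w \<le> r\<rbrakk> \<Longrightarrow>
      (x + b *\<^sub>R u + w) /\<^sub>R norm (x + b *\<^sub>R u + w) \<in> A"
  shows "h * r ^ (CARD('n) - 2) * measure lborel (ball (0 :: real ^ 'n) (1 / 16)) \<le> measure sphere_measure A"
proof -
  define L where "L = anisotropic x u h r"
  \<comment> \<open>On the ball of radius 1/16 about q the coefficients a along x and c along u
    satisfy 1 \<le> c/a \<le> 3, the remainder is at most a in norm, and the image stays in the unit
    ball.\<close>
  define q where "q = (3 / 8) *\<^sub>R x + (11 / 16) *\<^sub>R u"
  define S where "S = ball q (1 / 16)"
  define C where "C = {y \<in> cball 0 1 - {0}. y /\<^sub>R norm y \<in> A}"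
  have xx: "x \<bullet> x = 1" "u \<bullet> u = 1" "u \<bullet> x = 0" using xu by (auto simp: norm_eq_1 inner_commute)
  have "L ` S \<subseteq> C"
  proof clarify
    fix y assume "y \<in> S"
    then have d: "norm (y - q) < 1 / 16" by (simp add: S_def dist_norm norm_minus_commute)
    define a where "a = y \<bullet> x"
    define c where "c = y \<bullet> u"
    define w where "w = y - a *\<^sub>R x - c *\<^sub>R u"
    have "a - 3 / 8 = (y - q) \<bullet> x" "c - 11 / 16 = (y - q) \<bullet> u"
      by (simp_all add: q_def a_def c_def inner_diff_left inner_add_left xx xu)
    then have "\<bar>a - 3 / 8\<bar> < 1 / 16" "\<bar>c - 11 / 16\<bar> < 1 / 16"
      using d Cauchy_Schwarz_ineq2[of "y - q" x] Cauchy_Schwarz_ineq2[of "y - q" u] xu by auto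
    then have a: "5 / 16 \<le> a" "a \<le> 7 / 16" and c: "10 / 16 \<le> c" "c \<le> 12 / 16"
      by linarith+
    have w: "w \<bullet> x = 0" "w \<bullet> u = 0"
      by (simp_all add: w_def inner_diff_left xx xu a_def c_def)
    have "y - q = (a - 3 / 8) *\<^sub>R x + (c - 11 / 16) *\<^sub>R u + w"
      by (simp add: w_def q_def algebra_simps)
    then have "(norm (y - q))\<^sup>2 = (a - 3 / 8)\<^sup>2 + (c - 11 / 16)\<^sup>2 + (norm w)\<^sup>2"
      unfolding power2_norm_eq_inner
      by (simp add: inner_add_left inner_add_right xx xu w inner_commute[of x w] inner_commute[of u w] power2_eq_square)
    then have "(norm w)\<^sup>2 \<le> (norm (y - q))\<^sup>2" by simp
    then have "norm w \<le> norm (y - q)" by (rule power2_le_imp_le) simp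
    then have nw: "norm w \<le> 1 / 16" using d by linarith
    have Ly: "L y = a *\<^sub>R x + (h * c) *\<^sub>R u + r *\<^sub>R w"
      by (simp add: L_def anisotropic_def w_def a_def c_def algebra_simps)
    then have L2: "L y = a *\<^sub>R (x + (h * c / a) *\<^sub>R u + (r / a) *\<^sub>R w)" using a by (simp add: scaleR_add_right)
    have "(norm (L y))\<^sup>2 = a\<^sup>2 + (h * c)\<^sup>2 + (r * norm w)\<^sup>2"
      unfolding power2_norm_eq_inner Ly
      by (simp add: inner_add_left inner_add_right xx xu w inner_commute[of x w] inner_commute[of u w]
          power2_eq_square norm_eq_sqrt_inner[of w] mult.assoc)
    also have "\<dots> \<le> (7 / 16)\<^sup>2 + (1 * (12 / 16))\<^sup>2 + (1 * (1 / 16))\<^sup>2"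
      using a c hr nw by (intro add_mono power_mono mult_mono) auto
    also have "\<dots> \<le> 1\<^sup>2" by (simp add: power2_eq_square)
    finally have n1: "norm (L y) \<le> 1" by (rule power2_le_imp_le) simp
    have n0: "L y \<noteq> 0"
    proof
      assume "L y = 0"
      then have "L y \<bullet> x = 0" by simp
      then show False using a by (simp add: Ly inner_add_left xx xu w)
    qed
    have "h * a \<le> h * c" "h * c \<le> h * (3 * a)" using a c hr by (intro mult_left_mono; simp)+
    then have "h \<le> h * c / a" "h * c / a \<le> 3 * h" using a by (simp_all add: field_simps)
    moreover have "norm ((r / a) *\<^sub>R w) \<le> r"
    proof -
      have "norm w \<le> a" using nw a by linarith
      then have "r * norm w \<le> r * a" using hr by simp
      then show ?thesis using a hr by (simp add: field_simps)
    qed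
    ultimately have "(x + (h * c / a) *\<^sub>R u + (r / a) *\<^sub>R w) /\<^sub>R
        norm (x + (h * c / a) *\<^sub>R u + (r / a) *\<^sub>R w) \<in> A"
      using w by (intro box) auto
    moreover have "L y /\<^sub>R norm (L y) = (x + (h * c / a) *\<^sub>R u + (r / a) *\<^sub>R w) /\<^sub>R
        norm (x + (h * c / a) *\<^sub>R u + (r / a) *\<^sub>R w)"
      unfolding L2 using a by simp
    ultimately show "L y \<in> C" using n0 n1 by (simp add: C_def)
  qed
  have "(\<lambda>y::real^'n. y /\<^sub>R norm y) \<in> borel_measurable borel" by measurable
  then have "(\<lambda>y::real^'n. y /\<^sub>R norm y) -` A \<inter> space borel \<in> sets borel"
    using A(1) by (rule measurable_sets)
  moreover have "C = ((\<lambda>y. y /\<^sub>R norm y) -` A \<inter> space borel) \<inter> (cball 0 1 - {0})"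
    by (auto simp: C_def)
  ultimately have C: "C \<in> sets borel" by auto
  have "C \<subseteq> cball 0 1" by (auto simp: C_def)
  then have Cfin: "emeasure lborel C < \<infinity>"
    using emeasure_mono[of C "cball 0 1" lborel] emeasure_lborel_cball_finite[of "0 :: real ^ 'n" 1]
    by (simp add: order_le_less_trans)
  have "measure lborel S = measure lborel (ball (0 :: real ^ 'n) (1 / 16))"
    using content_ball_conv_unit_ball[of "1/16" q] content_ball_conv_unit_ball[of "1/16" "0 :: real ^ 'n"]
    by (simp add: S_def)
  then have "h * r ^ (CARD('n) - 2) * measure lborel (ball (0 :: real ^ 'n) (1 / 16)) \<le> measure lborel C"
    using measure_anisotropic_image_le[OF xu hr(1,3) n C Cfin, of q "1 / 16"] \<open>L ` S \<subseteq> C\<close>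
    by (simp add: S_def L_def)
  also have "\<dots> \<le> real CARD('n) * measure lborel C"
    using n mult_right_mono[of 1 "real CARD('n)" "measure lborel C"] by simp
  also have "\<dots> = measure sphere_measure A"
    unfolding measure_def emeasure_sphere_measure[OF A] C_def[symmetric]
    by (simp add: enn2real_mult)
  finally show ?thesis .
qed

section \<open>Weighted counting over a lattice of cells\<close>

lemma sum_inverse_squares_le_2: "(\<Sum>k\<le>n. 1 / (1 + real k)\<^sup>2) \<le> 2 - 1 / (1 + real n)"
proof (induction n)
  case (Suc n)
  have "1 / (2 + real n)\<^sup>2 \<le> 1 / ((1 + real n) * (2 + real n))"
    by (intro divide_left_mono) (auto simp: power2_eq_square intro!: mult_right_mono)
  also have "\<dots> = 1 / (1 + real n) - 1 / (2 + real n)" by (simp add: field_simps)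
  finally show ?case using Suc by (simp add: algebra_simps)
qed auto

lemma sum_int_inverse_squares_le:
  fixes j0 :: int
  assumes "finite J"
  shows "(\<Sum>j\<in>J. 1 / (1 + real_of_int \<bar>j - j0\<bar>)\<^sup>2) \<le> 4"
proof -
  define n where "n = (\<Sum>j\<in>J. nat \<bar>j - j0\<bar>)"
  let ?g = "\<lambda>j. 1 / (1 + real_of_int \<bar>j - j0\<bar>)\<^sup>2"
  have "J \<subseteq> (\<lambda>k. j0 + int k) ` {..n} \<union> (\<lambda>k. j0 - int k) ` {..n}"
  proof
    fix j assume "j \<in> J"
    then have "nat \<bar>j - j0\<bar> \<le> n" unfolding n_def using assms by (intro member_le_sum) auto
    moreover have "j = j0 + int (nat \<bar>j - j0\<bar>) \<or> j = j0 - int (nat \<bar>j - j0\<bar>)" by auto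
    ultimately show "j \<in> (\<lambda>k. j0 + int k) ` {..n} \<union> (\<lambda>k. j0 - int k) ` {..n}" by blast
  qed
  then have "sum ?g J \<le> sum ?g ((\<lambda>k. j0 + int k) ` {..n} \<union> (\<lambda>k. j0 - int k) ` {..n})"
    by (intro sum_mono2) auto
  also have "\<dots> \<le> sum ?g ((\<lambda>k. j0 + int k) ` {..n}) + sum ?g ((\<lambda>k. j0 - int k) ` {..n})"
    by (subst sum.union_inter[symmetric]) (auto intro!: sum_nonneg)
  also have "\<dots> = 2 * (\<Sum>k\<le>n. 1 / (1 + real k)\<^sup>2)"
    by (subst (1 2) sum.reindex) (auto simp: inj_on_def)
  also have "\<dots> \<le> 2 * (2 - 1 / (1 + real n))"
    using sum_inverse_squares_le_2[of n] by (intro mult_left_mono) auto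
  also have "\<dots> \<le> 4" by simp
  finally show ?thesis .
qed

text \<open>In dimension m, cells of side c / (m N) have diameter at most c / N by comparison with
  the l1 norm, so each holds at most t points. The exponent 2 m leaves an inverse square for every
  coordinate, and the sum over cells is dominated by a product of m convergent sums.\<close>

lemma weighted_count_le:
  fixes p :: "'a \<Rightarrow> real ^ 'n::finite"
  assumes fin: "finite A" and N: "0 < N" and c: "0 < c" "c \<le> 1"
    and count: "\<And>a. a \<in> A \<Longrightarrow> card {b \<in> A. norm (p a - p b) \<le> c / N} \<le> t"
  shows "(\<Sum>a\<in>A. 1 / (1 + N * norm (p a - x)) ^ (2 * CARD('n)))
    \<le> (16 * (CARD('n) / c)\<^sup>2) ^ CARD('n) * real t"
proof -
  define M where "M = CARD('n) / c"
  have "1 \<le> CARD('n)" by (simp add: Suc_leI)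
  then have "c \<le> real CARD('n)" using c by linarith
  then have M: "1 \<le> M" using c by (simp add: M_def)
  define cell :: "real ^ 'n \<Rightarrow> 'n \<Rightarrow> int" where "cell y = (\<lambda>i. \<lfloor>M * N * (y $ i)\<rfloor>)" for y
  \<comment> \<open>The factor (2 M)^2 absorbs the passage from scale N to M N and the rounding to
    cells.\<close>
  define g where "g i j = (2 * M)\<^sup>2 * (1 / (1 + real_of_int \<bar>j - cell x i\<bar>)\<^sup>2)" for i j
  have g0: "0 \<le> g i j" for i j by (simp add: g_def)
  have single: "1 / (1 + N * norm (y - x)) ^ (2 * CARD('n)) \<le> (\<Prod>i\<in>UNIV. g i (cell y i))" for y
  proof -
    have pos: "0 < 1 + N * norm (y - x)" using N by (intro add_pos_nonneg) auto
    have "1 / (1 + N * norm (y - x))\<^sup>2 \<le> g i (cell y i)" for i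
    proof -
      have "\<bar>y $ i - x $ i\<bar> \<le> norm (y - x)" using component_le_norm_cart[of "y - x" i] by simp
      then have "M * N * \<bar>y $ i - x $ i\<bar> \<le> M * N * norm (y - x)" using M N by (intro mult_left_mono) auto
      then have "\<bar>M * N * (y $ i) - M * N * (x $ i)\<bar> \<le> M * N * norm (y - x)"
        using M N by (simp add: abs_mult flip: right_diff_distrib)
      moreover have "real_of_int \<bar>cell y i - cell x i\<bar> \<le> \<bar>M * N * (y $ i) - M * N * (x $ i)\<bar> + 1"
        unfolding cell_def by linarith
      ultimately have "1 + real_of_int \<bar>cell y i - cell x i\<bar> \<le> 2 + M * N * norm (y - x)" by linarith
      also have "\<dots> \<le> 2 * M * (1 + N * norm (y - x))"
      proof -
        have "2 * M * (1 + N * norm (y - x)) = 2 * M + 2 * (M * N * norm (y - x))" by (simp add: algebra_simps)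
        moreover have "0 \<le> M * N * norm (y - x)" using M N by simp
        ultimately show ?thesis using M by linarith
      qed
      finally have "(1 + real_of_int \<bar>cell y i - cell x i\<bar>)\<^sup>2 \<le> (2 * M * (1 + N * norm (y - x)))\<^sup>2"
        by (intro power_mono) auto
      then have "(1 + real_of_int \<bar>cell y i - cell x i\<bar>)\<^sup>2 \<le> (2 * M)\<^sup>2 * (1 + N * norm (y - x))\<^sup>2"
        by (simp only: power_mult_distrib)
      moreover have "0 < (1 + real_of_int \<bar>cell y i - cell x i\<bar>)\<^sup>2" by (intro zero_less_power) linarith
      ultimately show ?thesis using pos by (simp add: g_def field_simps)
    qed
    then have "(\<Prod>i\<in>(UNIV::'n set). 1 / (1 + N * norm (y - x))\<^sup>2) \<le> (\<Prod>i\<in>UNIV. g i (cell y i))"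
      by (intro prod_mono) auto
    then show ?thesis by (simp add: power_mult power_divide)
  qed
  define K where "K = (\<lambda>a. cell (p a)) ` A"
  define J where "J = (\<Union>a\<in>A. range (cell (p a)))"
  have finJ: "finite J" using fin by (auto simp: J_def)
  have cell_card: "card {a \<in> A. cell (p a) = k} \<le> t" if "k \<in> K" for k
  proof -
    from that obtain a where a: "a \<in> A" "k = cell (p a)" unfolding K_def by (rule imageE)
    have "{b \<in> A. cell (p b) = k} \<subseteq> {b \<in> A. norm (p a - p b) \<le> c / N}"
    proof clarify
      fix b assume b: "k = cell (p b)"
      have fl: "\<lfloor>M * N * (p b $ i)\<rfloor> = \<lfloor>M * N * (p a $ i)\<rfloor>" for i
        using fun_cong[OF trans[OF b[symmetric] a(2)], of i] by (simp add: cell_def)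
      have "\<bar>M * N * (p a $ i) - M * N * (p b $ i)\<bar> \<le> 1" for i
        using fl[of i] floor_correct[of "M * N * (p a $ i)"] floor_correct[of "M * N * (p b $ i)"]
        unfolding abs_le_iff by (intro conjI; linarith)
      then have "M * N * \<bar>(p a - p b) $ i\<bar> \<le> 1" for i
        using M N by (simp add: abs_mult flip: right_diff_distrib)
      then have "\<bar>(p a - p b) $ i\<bar> \<le> 1 / (M * N)" for i
        using M N by (simp add: pos_le_divide_eq mult.commute)
      then have "norm (p a - p b) \<le> (\<Sum>i\<in>(UNIV::'n set). 1 / (M * N))"
        by (intro order_trans[OF norm_le_l1_cart] sum_mono)
      also have "\<dots> = c / N" using c N by (simp add: M_def)
      finally show "norm (p a - p b) \<le> c / N" .
    qed
    then have "card {b \<in> A. cell (p b) = k} \<le> card {b \<in> A. norm (p a - p b) \<le> c / N}"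
      using fin by (intro card_mono) auto
    then show ?thesis using count[OF a(1)] by linarith
  qed
  have "(\<Sum>a\<in>A. 1 / (1 + N * norm (p a - x)) ^ (2 * CARD('n))) \<le> (\<Sum>a\<in>A. \<Prod>i\<in>UNIV. g i (cell (p a) i))"
    by (intro sum_mono single)
  also have "\<dots> = (\<Sum>k\<in>K. \<Sum>a\<in>{a \<in> A. cell (p a) = k}. \<Prod>i\<in>UNIV. g i (cell (p a) i))"
    unfolding K_def by (rule sum.image_gen[OF fin])
  also have "\<dots> = (\<Sum>k\<in>K. real (card {a \<in> A. cell (p a) = k}) * (\<Prod>i\<in>UNIV. g i (k i)))"
    by (intro sum.cong) auto
  also have "\<dots> \<le> (\<Sum>k\<in>K. real t * (\<Prod>i\<in>UNIV. g i (k i)))"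
    using cell_card g0 by (intro sum_mono mult_right_mono prod_nonneg) auto
  \<comment> \<open>Enlarging the occupied cells to a full product set turns the sum of products
    into a product of sums.\<close>
  also have "\<dots> \<le> (\<Sum>k\<in>PiE UNIV (\<lambda>_. J). real t * (\<Prod>i\<in>UNIV. g i (k i)))"
    using finJ g0 by (intro sum_mono2 mult_nonneg_nonneg prod_nonneg finite_PiE) (auto simp: K_def J_def)
  also have "\<dots> = real t * (\<Prod>i\<in>UNIV. \<Sum>j\<in>J. g i j)"
    using finJ by (simp add: prod_sum_PiE sum_distrib_left)
  also have "\<dots> \<le> real t * (\<Prod>i\<in>(UNIV::'n set). (2 * M)\<^sup>2 * 4)"
  proof (intro mult_left_mono prod_mono conjI sum_nonneg)
    fix i :: 'n
    show "(\<Sum>j\<in>J. g i j) \<le> (2 * M)\<^sup>2 * 4"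
      unfolding g_def sum_distrib_left[symmetric]
      by (intro mult_left_mono sum_int_inverse_squares_le finJ) auto
  qed (auto intro: g0)
  also have "\<dots> = (16 * (CARD('n) / c)\<^sup>2) ^ CARD('n) * real t"
  proof -
    have "(2 * M)\<^sup>2 * 4 = 16 * (CARD('n) / c)\<^sup>2" by (simp add: M_def power_mult_distrib power_divide)
    then show ?thesis by simp
  qed
  finally show ?thesis .
qed

section \<open>Boxes in the cap\<close>

text \<open>A tangential displacement changes the norm only to second order; this is what lets a
  first order gain of height survive normalisation.\<close>

lemma normalize_near_unit:
  fixes x v :: "'a::real_inner"
  assumes "norm x = 1" "x \<bullet> v = 0"
  shows "norm ((x + v) /\<^sub>R norm (x + v) - x) \<le> 2 * norm v"
    and "1 \<le> norm (x + v)" "norm (x + v) \<le> 1 + (norm v)\<^sup>2 / 2"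
proof -
  let ?m = "norm (x + v)"
  have sq: "?m\<^sup>2 = 1 + (norm v)\<^sup>2"
    using assms unfolding power2_norm_eq_inner
    by (simp add: inner_add_left inner_add_right inner_commute[of v x] norm_eq_1)
  have "1\<^sup>2 \<le> ?m\<^sup>2" unfolding sq by simp
  then show m: "1 \<le> ?m" by (rule power2_le_imp_le) simp
  have "?m\<^sup>2 \<le> (1 + (norm v)\<^sup>2 / 2)\<^sup>2"
    unfolding sq by (simp add: power2_sum)
  then show "?m \<le> 1 + (norm v)\<^sup>2 / 2" by (rule power2_le_imp_le) simp
  have "(x + v) /\<^sub>R ?m - x = ((x + v) /\<^sub>R ?m - (x + v)) + v" by simp
  then have "norm ((x + v) /\<^sub>R ?m - x) \<le> norm ((x + v) /\<^sub>R ?m - (x + v)) + norm v"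
    by (metis norm_triangle_ineq)
  also have "(x + v) /\<^sub>R ?m - (x + v) = (inverse ?m - 1) *\<^sub>R (x + v)" by (simp add: scaleR_diff_left)
  also have "norm ((inverse ?m - 1) *\<^sub>R (x + v)) = \<bar>(inverse ?m - 1) * ?m\<bar>" by (simp add: abs_mult)
  also have "(inverse ?m - 1) * ?m = 1 - ?m"
  proof -
    have "inverse ?m * ?m = 1" by (rule left_inverse) (use m in linarith)
    then show ?thesis by (simp only: left_diff_distrib mult_1_left)
  qed
  also have "\<bar>1 - ?m\<bar> \<le> norm v"
    using m norm_triangle_ineq[of x v] assms by simp
  finally show "norm ((x + v) /\<^sub>R ?m - x) \<le> 2 * norm v" by simp
qed

lemma stereographic_diff:
  fixes e x y :: "'a::real_inner"
  assumes e: "norm e = 1" and x: "norm x = 1" and y: "norm y = 1"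
    and p: "0 < 1 + x \<bullet> e" "0 < 1 + y \<bullet> e"
  shows "(norm ((x - (x \<bullet> e) *\<^sub>R e) /\<^sub>R (1 + x \<bullet> e) - (y - (y \<bullet> e) *\<^sub>R e) /\<^sub>R (1 + y \<bullet> e)))\<^sup>2
    = (norm (x - y))\<^sup>2 / ((1 + x \<bullet> e) * (1 + y \<bullet> e))"
proof -
  define P where "P = 1 + x \<bullet> e"
  define Q where "Q = 1 + y \<bullet> e"
  define v where "v = x - (x \<bullet> e) *\<^sub>R e"
  define w where "w = y - (y \<bullet> e) *\<^sub>R e"
  have PQ: "0 < P" "0 < Q" "x \<bullet> e = P - 1" "y \<bullet> e = Q - 1" using p by (auto simp: P_def Q_def)
  have i: "e \<bullet> e = 1" "x \<bullet> x = 1" "y \<bullet> y = 1" using e x y by (auto simp: norm_eq_1)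
  have vv: "v \<bullet> v = P * (2 - P)" "w \<bullet> w = Q * (2 - Q)" "v \<bullet> w = x \<bullet> y - (P - 1) * (Q - 1)"
    by (simp_all add: v_def w_def inner_diff_left inner_diff_right i inner_commute[of e x]
        inner_commute[of e y] PQ(3,4) algebra_simps)
  have "(norm (v /\<^sub>R P - w /\<^sub>R Q))\<^sup>2 = (v \<bullet> v) / P\<^sup>2 - 2 * (v \<bullet> w) / (P * Q) + (w \<bullet> w) / Q\<^sup>2"
    unfolding power2_norm_eq_inner
    by (simp add: inner_diff_left inner_diff_right inner_commute[of w v] power2_eq_square divide_inverse algebra_simps)
  also have "\<dots> = (2 - 2 * (x \<bullet> y)) / (P * Q)"
    unfolding vv using PQ(1,2) by (simp add: field_simps power2_eq_square)
  also have "2 - 2 * (x \<bullet> y) = (norm (x - y))\<^sup>2"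
    by (simp add: power2_norm_eq_inner inner_diff_left inner_diff_right i inner_commute[of y x])
  finally show ?thesis by (simp add: v_def w_def P_def Q_def)
qed

text \<open>Here c is the gain of height of a displaced point and m its norm. Since m - 1 \<le> c,
  dividing by m neither undoes the gain nor more than doubles it.\<close>

lemma slice_bounds:
  fixes t0 c m :: real
  assumes "\<bar>t0\<bar> \<le> 1" "0 \<le> c" "1 \<le> m" "m \<le> 1 + c"
  shows "t0 \<le> (t0 + c) / m" "(t0 + c) / m \<le> t0 + 2 * c"
proof -
  have "t0 * (m - 1) \<le> 1 * (m - 1)" using assms by (intro mult_right_mono) auto
  then have "t0 * m \<le> t0 + c" using assms by (simp add: algebra_simps)
  then show "t0 \<le> (t0 + c) / m" using assms by (simp add: pos_le_divide_eq)
  have "- 1 * (m - 1) \<le> t0 * (m - 1)" using assms by (intro mult_right_mono) auto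
  then have "t0 + c \<le> t0 * m + 2 * c" using assms by (simp add: algebra_simps)
  also have "\<dots> \<le> t0 * m + 2 * c * m" using assms mult_left_mono[of 1 m "2 * c"] by simp
  finally show "(t0 + c) / m \<le> t0 + 2 * c" using assms by (simp add: pos_divide_le_eq algebra_simps)
qed

context cap_chart
begin

section \<open>Stereographic coordinates of the cap\<close>

definition planar :: "real ^ 'n \<Rightarrow> real ^ 'n" where
  "planar x = (x - (x \<bullet> e) *\<^sub>R e) /\<^sub>R (R * (1 + x \<bullet> e))"

lemma lift_planar: "lift x = planar x + (lift x \<bullet> e) *\<^sub>R e"
  by (simp add: lift_inner_e) (simp add: lift_def planar_def)

lemma planar_inner_e: "planar x \<bullet> e = 0"
  by (simp add: planar_def inner_diff_left)

lemma norm_planar_sq: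
  assumes "norm x = 1" "0 < 1 + x \<bullet> e"
  shows "(norm (planar x))\<^sup>2 = (2 / (1 + x \<bullet> e) - 1) / R\<^sup>2"
proof -
  define T where "T = 1 + x \<bullet> e"
  have T: "0 < T" "x \<bullet> e = T - 1" using assms by (auto simp: T_def)
  have "(norm (planar x))\<^sup>2 = (1 - x \<bullet> e) * (1 + x \<bullet> e) / (R * (1 + x \<bullet> e))\<^sup>2"
    unfolding norm_tangent_sq[OF assms(1), symmetric]
    by (simp add: planar_def power_mult_distrib power_divide divide_inverse power_inverse mult.commute)
  also have "\<dots> = (2 / (1 + x \<bullet> e) - 1) / R\<^sup>2"
    unfolding T(2) using T(1) R_pos by (simp add: field_simps power2_eq_square)
  finally show ?thesis .
qed

lemma in_cap_iff_planar:
  assumes "norm x = 1" "0 < 1 + x \<bullet> e"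
  shows "x \<in> cap \<longleftrightarrow> norm (planar x) \<le> 1"
proof -
  have "x \<in> cap \<longleftrightarrow> 2 / (1 + R\<^sup>2) \<le> 1 + x \<bullet> e"
    using assms(1) by (auto simp: cap_def cap_threshold)
  also have "\<dots> \<longleftrightarrow> 2 / (1 + x \<bullet> e) \<le> 1 + R\<^sup>2"
    using assms(2) one_plus_R_sq_pos by (simp add: pos_divide_le_eq mult.commute)
  also have "\<dots> \<longleftrightarrow> (2 / (1 + x \<bullet> e) - 1) / R\<^sup>2 \<le> 1"
    using R_pos by (simp add: pos_divide_le_eq diff_le_eq add.commute)
  also have "\<dots> \<longleftrightarrow> (norm (planar x))\<^sup>2 \<le> 1" by (simp only: norm_planar_sq[OF assms])
  also have "\<dots> \<longleftrightarrow> norm (planar x) \<le> 1" by (simp add: power_le_one_iff abs_square_le_1)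
  finally show ?thesis .
qed

lemma lift_inner_e_planar:
  assumes "x \<in> cap" shows "(lift x \<bullet> e)\<^sup>2 = 1 - (norm (planar x))\<^sup>2"
  using lift_in_hemisphere[OF assms] norm_proj_sq[of "lift x"] lift_planar[of x]
  by (simp add: hemisphere_def) (metis add_diff_cancel_right' diff_diff_eq2 add_diff_cancel_left')

lemma norm_lift_diff_sq:
  "(norm (lift x - lift y))\<^sup>2 = (norm (planar x - planar y))\<^sup>2 + (lift x \<bullet> e - lift y \<bullet> e)\<^sup>2"
proof -
  have eq: "lift x - lift y = (planar x - planar y) + (lift x \<bullet> e - lift y \<bullet> e) *\<^sub>R e"
    using lift_planar[of x] lift_planar[of y] by (simp add: algebra_simps)
  define p where "p = planar x - planar y"
  have "p \<bullet> e = 0" by (simp add: p_def inner_diff_left planar_inner_e)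
  then show ?thesis
    unfolding eq p_def[symmetric] power2_norm_eq_inner
    by (simp add: inner_add_left inner_add_right inner_commute[of e p] power2_eq_square)
qed

lemma cap_inner_e_lower: "x \<in> cap \<Longrightarrow> 2 / B \<le> 1 + x \<bullet> e"
proof -
  assume "x \<in> cap"
  then have "2 / (1 + R\<^sup>2) \<le> 1 + x \<bullet> e" by (auto simp: cap_def cap_threshold)
  moreover have "2 / B \<le> 2 / (1 + R\<^sup>2)" using R_B one_plus_R_sq_pos by (intro divide_left_mono) auto
  ultimately show ?thesis by linarith
qed

lemma R_le_B: "R \<le> B"
proof -
  have "0 \<le> (R - 1)\<^sup>2" by simp
  then have "2 * R \<le> 1 + R\<^sup>2" by (simp add: power2_eq_square algebra_simps)
  then show ?thesis using R_B R_pos by linarith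
qed

text \<open>The point \<open>x\<close> is not assumed to lie in the cap. On the cap 1 + y \<bullet>
  e is at least 2/B, and a displacement of at most 1/B leaves 1/B, so the stereographic projection
  expands distances at most by B and \<open>planar\<close> by B / R.\<close>

lemma planar_near:
  assumes y: "y \<in> cap" and x: "norm x = 1" and close: "norm (x - y) \<le> R * \<eta> / B\<^sup>2" and \<eta>: "\<eta> \<le> 1"
  shows "0 < 1 + x \<bullet> e" "norm (planar x - planar y) \<le> \<eta>"
proof -
  have B: "0 < B" using B_ge_1 by linarith
  have y1: "norm y = 1" using y by (simp add: cap_def)
  have "0 \<le> R * \<eta> / B\<^sup>2" using close norm_ge_zero order_trans by blast
  then have \<eta>0: "0 \<le> \<eta>" using R_pos B by (simp add: zero_le_divide_iff zero_le_mult_iff)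
  have "R * \<eta> \<le> B * 1" using R_le_B \<eta> \<eta>0 R_pos B by (intro mult_mono) auto
  then have "R * \<eta> / B\<^sup>2 \<le> B / B\<^sup>2" by (intro divide_right_mono) auto
  then have "norm (x - y) \<le> 1 / B" using close B by (simp add: power2_eq_square)
  then have "\<bar>x \<bullet> e - y \<bullet> e\<bar> \<le> 1 / B" using inner_e_diff_le[of x y] by linarith
  then have p: "1 / B \<le> 1 + x \<bullet> e" using cap_inner_e_lower[OF y] by (simp add: abs_le_iff)
  then show pos: "0 < 1 + x \<bullet> e" using B by (smt (verit) divide_pos_pos)
  have ypos: "0 < 1 + y \<bullet> e" by (rule cap_inner_e_pos[OF y])
  have pl: "planar z = inverse R *\<^sub>R ((z - (z \<bullet> e) *\<^sub>R e) /\<^sub>R (1 + z \<bullet> e))" for z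
    by (simp add: planar_def)
  have "1 / B * (1 / B) \<le> (1 + x \<bullet> e) * (1 + y \<bullet> e)"
  proof (intro mult_mono)
    show "1 / B \<le> 1 + y \<bullet> e" using cap_inner_e_lower[OF y] B by (smt (verit) divide_right_mono)
  qed (use p pos B in auto)
  then have den: "1 / B\<^sup>2 \<le> (1 + x \<bullet> e) * (1 + y \<bullet> e)" by (simp add: power2_eq_square)
  have "(norm (planar x - planar y))\<^sup>2 = (inverse R)\<^sup>2 * ((norm (x - y))\<^sup>2 / ((1 + x \<bullet> e) * (1 + y \<bullet> e)))"
    unfolding stereographic_diff[OF norm_e x y1 pos ypos, symmetric] pl scaleR_diff_right[of "inverse R", symmetric]
    by (simp add: power_mult_distrib power_inverse power_divide divide_inverse)
  also have "\<dots> \<le> (inverse R)\<^sup>2 * ((norm (x - y))\<^sup>2 / (1 / B\<^sup>2))"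
    using den B pos ypos by (intro mult_left_mono divide_left_mono) auto
  also have "\<dots> = (B * norm (x - y) / R)\<^sup>2"
    by (simp add: power_mult_distrib power_divide divide_inverse power_inverse)
  finally have "norm (planar x - planar y) \<le> B * norm (x - y) / R"
    by (rule power2_le_imp_le) (use B R_pos in simp)
  also have "\<dots> \<le> B * (R * \<eta> / B\<^sup>2) / R"
    using close B R_pos by (intro divide_right_mono mult_left_mono) auto
  also have "\<dots> = \<eta> / B" using B R_pos by (simp add: power2_eq_square)
  also have "\<dots> \<le> \<eta>" using \<eta>0 B mult_left_mono[of 1 B \<eta>] B_ge_1 by (simp add: pos_divide_le_eq)
  finally show "norm (planar x - planar y) \<le> \<eta>" .
qed

text \<open>The box of \<open>sphere_measure_lower_bound\<close> points from \<open>y\<close> towards the centre of the cap.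
  It is shorter in this direction, because \<open>lift\<close> stretches it near the boundary of the cap.\<close>

lemma lift_box_near:
  assumes y: "y \<in> cap" and \<delta>: "0 < \<delta>" "\<delta> \<le> 1 / 4"
    and u: "norm u = 1" "y \<bullet> u = 0" "e = (y \<bullet> e) *\<^sub>R y + sqrt (1 - (y \<bullet> e)\<^sup>2) *\<^sub>R u"
    and b: "R * \<delta> * (\<delta> + lift y \<bullet> e) / (48 * B\<^sup>2) \<le> b" "b \<le> 3 * (R * \<delta> * (\<delta> + lift y \<bullet> e) / (48 * B\<^sup>2))"
    and w: "w \<bullet> y = 0" "w \<bullet> u = 0" "norm w \<le> R * \<delta> / (10 * B\<^sup>2)"
  defines "x \<equiv> (y + b *\<^sub>R u + w) /\<^sub>R norm (y + b *\<^sub>R u + w)"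
  shows "x \<in> cap" "norm (lift x - lift y) \<le> \<delta>"
proof -
  define s where "s = lift y \<bullet> e"
  define h where "h = R * \<delta> * (\<delta> + s) / (48 * B\<^sup>2)"
  define v where "v = b *\<^sub>R u + w"
  have B: "1 \<le> B" "0 < B" using B_ge_1 by auto
  have y1: "norm y = 1" "y \<bullet> y = 1" using y by (auto simp: cap_def norm_eq_1)
  have lh: "norm (lift y) = 1" "0 \<le> s" using lift_in_hemisphere[OF y] by (auto simp: hemisphere_def s_def)
  have s: "0 \<le> s" "s \<le> 1" using lh inner_e_bounds[OF lh(1)] by (auto simp: s_def)
  have hb: "h \<le> b" "b \<le> 3 * h" using b by (auto simp: h_def s_def)
  have h0: "0 < h" using R_pos \<delta> s B by (auto simp: h_def intro!: mult_pos_pos divide_pos_pos)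
  have yv: "y \<bullet> v = 0" using u w by (simp add: v_def inner_add_right inner_commute[of y w])
  have x: "x = (y + v) /\<^sub>R norm (y + v)" by (simp add: x_def v_def add.assoc)
  note nr = normalize_near_unit[OF y1(1) yv]
  have vv: "(norm v)\<^sup>2 = b\<^sup>2 + (norm w)\<^sup>2"
    unfolding power2_norm_eq_inner using u w
    by (simp add: v_def inner_add_left inner_add_right inner_commute[of u w] norm_eq_1 power2_eq_square)
  have x1: "norm x = 1" 
  proof -
    have "y + v \<noteq> 0" using nr(2) by auto
    then show ?thesis by (simp add: x)
  qed
  define k where "k = R * \<delta> / B\<^sup>2"
  have k0: "0 < k" using R_pos \<delta> B by (simp add: k_def)
  have hk: "h = k * (\<delta> + s) / 48" by (simp add: h_def k_def)
  have "k * (\<delta> + s) \<le> k * (5 / 4)" using \<delta> s k0 by (intro mult_left_mono) auto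
  then have hk': "h \<le> k * (5 / 192)" by (simp add: hk)
  have wk: "norm w \<le> k / 10" using w(3) by (simp add: k_def)
  have "norm v \<le> b + norm w"
    using norm_triangle_ineq[of "b *\<^sub>R u" w] u(1) hb h0 by (simp add: v_def)
  \<comment> \<open>The 36/100 covers 2 (3 * 5/192 + 1/10), from b \<le> 3 h and the bounds on h and
    w.\<close>
  then have "2 * norm v \<le> k * (36 / 100)" using hb hk' wk k0 by linarith
  then have "norm (x - y) \<le> R * (\<delta> * (36 / 100)) / B\<^sup>2" using nr(1) by (simp add: x k_def)
  note near = planar_near[OF y x1 this]
  have pos: "0 < 1 + x \<bullet> e" and pd: "norm (planar x - planar y) \<le> \<delta> * (36 / 100)"
    using near \<delta> by auto
  have ypos: "0 < 1 + y \<bullet> e" by (rule cap_inner_e_pos[OF y])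
  have sy: "s\<^sup>2 = 1 - (norm (planar y))\<^sup>2" unfolding s_def by (rule lift_inner_e_planar[OF y])
  \<comment> \<open>Near the centre both heights stay above 8/10, where height is a Lipschitz
    function of the planar radius. Near the rim the displacement along u has a definite slope
    towards e, which keeps x inside the cap.\<close>
  have "x \<in> cap \<and> \<bar>lift x \<bullet> e - s\<bar> \<le> \<delta> / 2"
  proof (cases "1 / 2 \<le> norm (planar y)")
    case False
    have "norm (planar x) \<le> norm (planar y) + norm (planar x - planar y)" by (rule norm_triangle_sub)
    then have px: "norm (planar x) \<le> 6 / 10" using False pd \<delta> by linarith
    then have xc: "x \<in> cap" using in_cap_iff_planar[OF x1 pos] by linarith
    let ?r = "lift x \<bullet> e"
    have r: "0 \<le> ?r" using lift_in_hemisphere[OF xc] by (simp add: hemisphere_def)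
    have rx: "?r\<^sup>2 = 1 - (norm (planar x))\<^sup>2" by (rule lift_inner_e_planar[OF xc])
    have "(norm (planar x))\<^sup>2 \<le> (6 / 10)\<^sup>2" "(norm (planar y))\<^sup>2 \<le> (6 / 10)\<^sup>2"
      using px False by (intro power_mono; simp)+
    then have "(8 / 10)\<^sup>2 \<le> ?r\<^sup>2" "(8 / 10)\<^sup>2 \<le> s\<^sup>2" unfolding rx sy by (simp_all add: power2_eq_square)
    then have rs: "8 / 10 \<le> ?r" "8 / 10 \<le> s" using r s power2_le_imp_le by blast+
    have "\<bar>?r - s\<bar> * (16 / 10) \<le> \<bar>?r - s\<bar> * (?r + s)" using rs by (intro mult_left_mono) auto
    also have "\<dots> = \<bar>?r\<^sup>2 - s\<^sup>2\<bar>"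
    proof -
      have "?r\<^sup>2 - s\<^sup>2 = (?r - s) * (?r + s)" by (simp add: power2_eq_square algebra_simps)
      then show ?thesis using r s by (simp add: abs_mult)
    qed
    also have "?r\<^sup>2 - s\<^sup>2 = (norm (planar y) - norm (planar x)) * (norm (planar y) + norm (planar x))"
      unfolding rx sy by (simp add: power2_eq_square algebra_simps)
    also have "\<bar>\<dots>\<bar> = \<bar>norm (planar x) - norm (planar y)\<bar> * (norm (planar y) + norm (planar x))"
      by (simp add: abs_mult abs_minus_commute)
    also have "\<dots> \<le> \<delta> * (36 / 100) * (12 / 10)"
      using order_trans[OF norm_triangle_ineq3 pd] px False \<delta>(1) by (intro mult_mono) auto
    also have "\<dots> \<le> \<delta> / 2 * (16 / 10)" using \<delta>(1) by simp
    finally have "\<bar>?r - s\<bar> \<le> \<delta> / 2" by (rule mult_right_le_imp_le) simp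
    then show ?thesis using xc by simp
  next
    case True
    define D where "D = 2 / (1 + y \<bullet> e)"
    have D0: "0 < D" using ypos by (simp add: D_def)
    have yD: "1 + y \<bullet> e = 2 / D" using ypos by (simp add: D_def)
    have py: "(norm (planar y))\<^sup>2 = (D - 1) / R\<^sup>2" using norm_planar_sq[OF y1(1) ypos] by (simp add: D_def)
    then have "D - 1 = (R * norm (planar y))\<^sup>2" using R_pos by (simp add: power_mult_distrib)
    then have D: "D = 1 + (R * norm (planar y))\<^sup>2" by simp
    have D1: "1 \<le> D" unfolding D by simp
    have DB: "D \<le> B" using cap_inner_e_lower[OF y] D0 B unfolding yD by (simp add: field_simps)
    \<comment> \<open>The rate at which moving along u raises the inner product with e. It is
      comparable to R because y is away from the centre.\<close>
    define \<sigma> where "\<sigma> = sqrt (1 - (y \<bullet> e)\<^sup>2)"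
    have "1 - (y \<bullet> e)\<^sup>2 = (1 + y \<bullet> e) * (2 - (1 + y \<bullet> e))" by (simp add: power2_eq_square algebra_simps)
    also have "\<dots> = 4 * (D - 1) / D\<^sup>2" unfolding yD using D0 by (simp add: field_simps power2_eq_square)
    also have "\<dots> = (2 * (R * norm (planar y)) / D)\<^sup>2" unfolding D by (simp add: power_mult_distrib power_divide)
    finally have \<sigma>: "\<sigma> = 2 * (R * norm (planar y)) / D" using R_pos D0 by (simp add: \<sigma>_def)
    have pyle: "norm (planar y) \<le> 1" using in_cap_iff_planar[OF y1(1) ypos] y by simp
    have "R / B \<le> R / D" using DB D0 R_pos by (intro divide_left_mono) (auto intro: mult_pos_pos B)
    also have "R * 1 \<le> R * (2 * norm (planar y))" using True R_pos by (intro mult_left_mono) auto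
    then have "R / D \<le> \<sigma>" unfolding \<sigma> using D0 by (intro divide_right_mono) auto
    finally have \<sigma>1: "R / B \<le> \<sigma>" .
    have "2 * (R * norm (planar y)) \<le> 2 * R" using pyle R_pos by (simp add: mult_left_le)
    then have "\<sigma> \<le> 2 * R / D" unfolding \<sigma> using D0 by (intro divide_right_mono) auto
    also have "\<dots> \<le> 2 * R / 1" using D1 R_pos by (intro divide_left_mono) auto
    finally have \<sigma>2: "\<sigma> \<le> 2 * R" by simp
    have \<sigma>0: "0 < \<sigma>" using \<sigma>1 R_pos B by (smt (verit) divide_pos_pos)
    have b0: "0 < b" using hb h0 by linarith
    have "3 * h \<le> R / B"
    proof -
      have "\<delta> * (\<delta> + s) \<le> 1 * 2" using \<delta> s by (intro mult_mono) auto
      then have "R * (\<delta> * (\<delta> + s)) \<le> R * 2" using R_pos by (intro mult_left_mono) auto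
      then have "3 * h \<le> 3 * (R * 2 / (48 * B\<^sup>2))" unfolding h_def by (intro mult_left_mono divide_right_mono) (auto simp: mult.assoc)
      also have "\<dots> \<le> R / B\<^sup>2" using R_pos B by (simp add: field_simps)
      also have "\<dots> \<le> R / B" using R_pos B by (intro divide_left_mono) (auto simp: power2_eq_square)
      finally show ?thesis .
    qed
    then have "b \<le> \<sigma>" using hb \<sigma>1 by linarith
    then have bb: "b\<^sup>2 \<le> b * \<sigma>" using b0 by (simp add: power2_eq_square)
    \<comment> \<open>The sideways displacement enters only through its square, so the gain b
      \<sigma> dominates it even though w may be much longer than b.\<close>
    have "(norm w)\<^sup>2 \<le> (k / 10)\<^sup>2" using wk by (intro power_mono) auto
    also have "\<dots> = (k * \<delta> / 48) * (R / B) * (48 / (100 * B))"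
      using B by (simp add: k_def power2_eq_square field_simps)
    also have "\<dots> \<le> (k * \<delta> / 48) * (R / B) * 1"
      using k0 \<delta> R_pos B by (intro mult_left_mono) auto
    also have "\<dots> \<le> h * \<sigma>"
    proof -
      have "k * \<delta> / 48 \<le> h" unfolding hk using k0 s by (intro divide_right_mono mult_left_mono) auto
      moreover have "0 \<le> R / B" using R_pos B by simp
      ultimately have "k * \<delta> / 48 * (R / B) \<le> h * \<sigma>" using \<sigma>1 h0 by (intro mult_mono) auto
      then show ?thesis by simp
    qed
    also have "\<dots> \<le> b * \<sigma>" using hb \<sigma>0 by (intro mult_right_mono) auto
    finally have ww: "(norm w)\<^sup>2 \<le> b * \<sigma>" .
    have m: "norm (y + v) \<le> 1 + b * \<sigma>" 
    proof -
      have "((norm v)\<^sup>2) / 2 \<le> (b * \<sigma> + b * \<sigma>) / 2" unfolding vv using bb ww by (intro divide_right_mono add_mono) auto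
      also have "\<dots> = b * \<sigma>" by simp
      finally show ?thesis using nr(3) by (meson add_left_mono order_trans)
    qed
    have xe: "x \<bullet> e = (y \<bullet> e + b * \<sigma>) / norm (y + v)"
    proof -
      have "(y + v) \<bullet> e = (y + v) \<bullet> ((y \<bullet> e) *\<^sub>R y + \<sigma> *\<^sub>R u)" using u(3) by (simp add: \<sigma>_def)
      also have "\<dots> = y \<bullet> e + b * \<sigma>"
        using u(1,2) w y1 yv by (simp add: inner_add_left inner_add_right v_def norm_eq_1 inner_commute[of u y])
      finally show ?thesis by (simp add: x divide_inverse mult.commute)
    qed
    have "\<bar>y \<bullet> e\<bar> \<le> 1" using inner_e_bounds[OF y1(1)] by (simp add: abs_le_iff)
    note sl = slice_bounds[OF this _ nr(2) m, folded xe]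
    have bs0: "0 \<le> b * \<sigma>" using b0 \<sigma>0 by simp
    have t1: "y \<bullet> e \<le> x \<bullet> e" and t2: "x \<bullet> e \<le> y \<bullet> e + 2 * (b * \<sigma>)" using sl[OF bs0] by auto
    have "b * \<sigma> \<le> 3 * h * (2 * R)" using hb \<sigma>2 b0 \<sigma>0 h0 by (intro mult_mono) auto
    also have "3 * h * (2 * R) = 6 * R * h" by simp
    finally have tt: "x \<bullet> e - y \<bullet> e \<le> 12 * R * h" using t2 by simp
    have px: "(norm (planar x))\<^sup>2 = (2 / (1 + x \<bullet> e) - 1) / R\<^sup>2" by (rule norm_planar_sq[OF x1 pos])
    have diff: "(norm (planar y))\<^sup>2 - (norm (planar x))\<^sup>2
        = 2 * (x \<bullet> e - y \<bullet> e) / (R\<^sup>2 * ((1 + x \<bullet> e) * (1 + y \<bullet> e)))"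
    proof -
      define P where "P = 1 + x \<bullet> e"
      define Q where "Q = 1 + y \<bullet> e"
      have PQ: "x \<bullet> e = P - 1" "y \<bullet> e = Q - 1" "0 < P" "0 < Q" using pos ypos by (auto simp: P_def Q_def)
      show ?thesis
        unfolding px norm_planar_sq[OF y1(1) ypos] PQ(1,2) using PQ(3,4) R_pos
        by (simp add: field_simps)
    qed
    have den: "2 / B * (2 / B) \<le> (1 + x \<bullet> e) * (1 + y \<bullet> e)"
      using cap_inner_e_lower[OF y] t1 B pos by (intro mult_mono) auto
    have d0: "0 \<le> (norm (planar y))\<^sup>2 - (norm (planar x))\<^sup>2"
      unfolding diff using t1 pos ypos by auto
    have "(norm (planar y))\<^sup>2 - (norm (planar x))\<^sup>2 \<le> 2 * (12 * R * h) / (R\<^sup>2 * (2 / B * (2 / B)))"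
      unfolding diff using tt t1 den R_pos B h0 by (intro frac_le mult_left_mono mult_pos_pos) auto
    also have "\<dots> = \<delta> * (\<delta> + s) / 8"
      using R_pos B by (simp add: h_def power2_eq_square field_simps)
    finally have d1: "(norm (planar y))\<^sup>2 - (norm (planar x))\<^sup>2 \<le> \<delta> * (\<delta> + s) / 8" .
    have "(norm (planar x))\<^sup>2 \<le> (norm (planar y))\<^sup>2" using d0 by (simp only: diff_ge_0_iff_ge)
    then have "norm (planar x) \<le> norm (planar y)" by (rule power2_le_imp_le) simp
    then have "norm (planar x) \<le> 1" using pyle by linarith
    then have xc: "x \<in> cap" using in_cap_iff_planar[OF x1 pos] by simp
    let ?r = "lift x \<bullet> e"
    have r: "0 \<le> ?r" using lift_in_hemisphere[OF xc] by (simp add: hemisphere_def)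
    have rx: "?r\<^sup>2 = 1 - (norm (planar x))\<^sup>2" by (rule lift_inner_e_planar[OF xc])
    have "s\<^sup>2 \<le> ?r\<^sup>2" using d0 rx sy by linarith
    then have "s \<le> ?r" using r by (rule power2_le_imp_le)
    \<comment> \<open>The factor \<delta> + s in h is made for this completion of the square, and
      its 48 produces the 8.\<close>
    have "?r\<^sup>2 \<le> s\<^sup>2 + \<delta> * (\<delta> + s) / 8" using d1 rx sy by linarith
    also have "\<dots> \<le> (s + \<delta> / 2)\<^sup>2"
      using mult_nonneg_nonneg[of \<delta> s] mult_nonneg_nonneg[of \<delta> \<delta>] \<delta> s
      by (simp add: power2_eq_square algebra_simps)
    finally have "?r \<le> s + \<delta> / 2" by (rule power2_le_imp_le) (use \<delta> s in simp)
    then show ?thesis using xc \<open>s \<le> ?r\<close> by simp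
  qed
  then show "x \<in> cap" and "norm (lift x - lift y) \<le> \<delta>"
  proof -
    assume a: "x \<in> cap \<and> \<bar>lift x \<bullet> e - s\<bar> \<le> \<delta> / 2"
    then show "x \<in> cap" by simp
    have "(norm (lift x - lift y))\<^sup>2 \<le> (\<delta> * (36 / 100))\<^sup>2 + (\<delta> / 2)\<^sup>2"
    proof -
      have "\<bar>lift x \<bullet> e - lift y \<bullet> e\<bar>\<^sup>2 \<le> (\<delta> / 2)\<^sup>2" using a unfolding s_def by (intro power_mono) auto
      moreover have "(norm (planar x - planar y))\<^sup>2 \<le> (\<delta> * (36 / 100))\<^sup>2" using pd by (intro power_mono) auto
      ultimately show ?thesis unfolding norm_lift_diff_sq by simp
    qed
    also have "\<dots> \<le> \<delta>\<^sup>2" by (simp add: power_mult_distrib power_divide)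
    finally show "norm (lift x - lift y) \<le> \<delta>" by (rule power2_le_imp_le) (use \<delta> in simp)
  qed
qed

end

section \<open>The Marcinkiewicz inequality\<close>

context cap_chart
begin

section \<open>Measurability and measure of lifted balls\<close>

lemma cap_borel: "cap \<in> sets borel"
proof -
  have "cap = sphere 0 1 \<inter> {x. (1 - R\<^sup>2) / (1 + R\<^sup>2) \<le> x \<bullet> e}" by (auto simp: cap_def)
  moreover have "closed {x. (1 - R\<^sup>2) / (1 + R\<^sup>2) \<le> x \<bullet> e}"
    by (intro closed_Collect_le continuous_intros)
  ultimately show ?thesis by (auto intro!: borel_closed closed_Int)
qed

lemma lift_borel_measurable: "lift \<in> borel_measurable borel"
  unfolding lift_def [abs_def] by measurable

lemma lift_ball_borel: "{x \<in> cap. norm (lift x - c) \<le> \<delta>} \<in> sets borel"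
proof -
  have "(\<lambda>x. norm (lift x - c)) \<in> borel_measurable borel"
    using lift_borel_measurable by measurable
  then have "{x \<in> space borel. norm (lift x - c) \<le> \<delta>} \<in> sets borel" by measurable
  then have "cap \<inter> {x \<in> space borel. norm (lift x - c) \<le> \<delta>} \<in> sets borel" using cap_borel by blast
  moreover have "cap \<inter> {x \<in> space borel. norm (lift x - c) \<le> \<delta>} = {x \<in> cap. norm (lift x - c) \<le> \<delta>}" by auto
  ultimately show ?thesis by simp
qed

text \<open>One side of the box is a multiple of R \<delta> (\<delta> + s), with s the height of the
  lifted centre, and d - 1 sides are multiples of R \<delta>. Their product (R \<delta>)^d (\<delta>
  + s) has the shape of the weight.\<close>

lemma measure_lift_ball:
  assumes y: "y \<in> cap" and \<delta>: "0 < \<delta>" "\<delta> \<le> 1 / 4" and n: "2 \<le> CARD('n)"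
  shows "(1 / (48 * B\<^sup>2)) * (1 / (10 * B\<^sup>2)) ^ (CARD('n) - 2) * measure lborel (ball (0 :: real ^ 'n) (1 / 16))
      * ((R * \<delta>) ^ (CARD('n) - 1) * (\<delta> + lift y \<bullet> e))
    \<le> measure sphere_measure {x \<in> cap. norm (lift x - lift y) \<le> \<delta>}"
proof -
  let ?s = "lift y \<bullet> e" and ?V = "measure lborel (ball (0 :: real ^ 'n) (1 / 16))"
  define h where "h = R * \<delta> * (\<delta> + ?s) / (48 * B\<^sup>2)"
  define r where "r = R * \<delta> / (10 * B\<^sup>2)"
  have y1: "norm y = 1" using y by (simp add: cap_def)
  have B: "1 \<le> B" "0 < B" using B_ge_1 by auto
  have lh: "norm (lift y) = 1" "0 \<le> ?s" using lift_in_hemisphere[OF y] by (auto simp: hemisphere_def)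
  have s: "0 \<le> ?s" "?s \<le> 1" using lh inner_e_bounds[OF lh(1)] by auto
  have "2 \<le> DIM(real ^ 'n)" using n by simp
  then obtain u where u: "norm u = 1" "y \<bullet> u = 0" "e = (y \<bullet> e) *\<^sub>R y + sqrt (1 - (y \<bullet> e)\<^sup>2) *\<^sub>R u"
    using y1 norm_e by (rule orthonormal_decomposition)
  have "B * 1 \<le> B * B" using B by (intro mult_left_mono) auto
  then have RB: "R \<le> B\<^sup>2" using R_le_B by (simp add: power2_eq_square)
  have "R * \<delta> \<le> B\<^sup>2 * 1" using RB \<delta> R_pos by (intro mult_mono) auto
  then have Rd: "R * \<delta> \<le> B\<^sup>2" by simp
  have "R * \<delta> * (\<delta> + ?s) \<le> B\<^sup>2 * 2" using Rd \<delta> s R_pos by (intro mult_mono) auto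
  also have "\<dots> \<le> 48 * B\<^sup>2" by simp
  finally have h1: "h \<le> 1" using B by (simp add: h_def)
  have "R * \<delta> \<le> 10 * B\<^sup>2" by (rule order_trans[OF Rd]) simp
  then have r1: "r \<le> 1" using B by (simp add: r_def)
  have hr: "0 < h" "0 < r" using R_pos \<delta> s B by (auto simp: h_def r_def intro!: divide_pos_pos mult_pos_pos)
  have "h * r ^ (CARD('n) - 2) * ?V \<le> measure sphere_measure {x \<in> cap. norm (lift x - lift y) \<le> \<delta>}"
  proof (rule sphere_measure_lower_bound[OF y1 u(1,2) hr(1) h1 hr(2) r1 n lift_ball_borel])
    show "{x \<in> cap. norm (lift x - lift y) \<le> \<delta>} \<subseteq> sphere 0 1" by (auto simp: cap_def)
    fix b and w :: "real ^ 'n"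
    assume "h \<le> b" "b \<le> 3 * h" "w \<bullet> y = 0" "w \<bullet> u = 0" "norm w \<le> r"
    then show "(y + b *\<^sub>R u + w) /\<^sub>R norm (y + b *\<^sub>R u + w) \<in> {x \<in> cap. norm (lift x - lift y) \<le> \<delta>}"
      using lift_box_near[OF y \<delta> u, of b w] by (simp add: h_def r_def)
  qed
  moreover have "(1 / (48 * B\<^sup>2)) * (1 / (10 * B\<^sup>2)) ^ (CARD('n) - 2) * ?V * ((R * \<delta>) ^ (CARD('n) - 1) * (\<delta> + ?s))
      = h * r ^ (CARD('n) - 2) * ?V"
  proof -
    have "CARD('n) - 1 = Suc (CARD('n) - 2)" using n by simp
    then have "(R * \<delta>) ^ (CARD('n) - 1) = (R * \<delta>) * (R * \<delta>) ^ (CARD('n) - 2)" by simp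
    moreover have "r ^ (CARD('n) - 2) = (R * \<delta>) ^ (CARD('n) - 2) * (1 / (10 * B\<^sup>2)) ^ (CARD('n) - 2)"
      by (simp add: r_def flip: power_mult_distrib)
    ultimately show ?thesis by (simp only: h_def times_divide_eq_left times_divide_eq_right mult_1_left mult_ac)
  qed
  ultimately show ?thesis by simp
qed

lemma sphere_measure_sets: "A \<in> sets borel \<Longrightarrow> A \<subseteq> sphere 0 1 \<Longrightarrow> A \<in> sets (sphere_measure :: (real ^ 'n) measure)"
  by (auto simp: sets_restrict_space_iff)

lemma integrable_poly_powr:
  assumes P: "poly_fun_deg_le n P" and p: "0 \<le> p" and A: "A \<in> sets borel" "A \<subseteq> sphere 0 1"
  shows "integrable sphere_measure (\<lambda>x. indicator A x * \<bar>P x\<bar> powr p)"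
proof -
  obtain c where c: "P = (\<lambda>x. \<Sum>k | (\<Sum>i\<in>UNIV. k i) \<le> n. c k * (\<Prod>i\<in>UNIV. (x $ i) ^ k i))"
    using P unfolding poly_fun_deg_le_def by blast
  have cont: "continuous_on S P" for S unfolding c by (intro continuous_intros)
  have "compact (P ` sphere 0 1)" by (intro compact_continuous_image cont) simp
  then obtain b where b: "\<And>x. x \<in> sphere 0 1 \<Longrightarrow> \<bar>P x\<bar> \<le> b"
    using compact_imp_bounded[of "P ` sphere 0 1"] unfolding bounded_iff real_norm_def by blast
  show ?thesis
  proof (rule finite_measure.integrable_const_bound[OF finite_measure_sphere_measure, where B = "b powr p"])
    show "AE x in sphere_measure. norm (indicator A x * \<bar>P x\<bar> powr p) \<le> b powr p"
      using b p by (intro AE_I2) (auto simp: indicator_def intro!: powr_mono2)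
    have "P \<in> borel_measurable borel" by (rule borel_measurable_continuous_onI[OF cont])
    then have "(\<lambda>x. indicator A x * \<bar>P x\<bar> powr p) \<in> borel_measurable borel"
      using A(1) by measurable
    then show "(\<lambda>x. indicator A x * \<bar>P x\<bar> powr p) \<in> borel_measurable sphere_measure"
      by (subst measurable_cong_sets[OF sets_sphere_measure refl]) (rule measurable_restrict_space1)
  qed
qed

end

text \<open>The lower bound of \<open>localised_maximum_chart\<close> with \<open>K = 2 * m + 1\<close> holds on the ball of radius
  \<open>1 / (mz_scale m L * n)\<close>.\<close>

definition mz_scale :: "nat \<Rightarrow> nat \<Rightarrow> real" where
  "mz_scale m L = 2 * (3 ^ (2 * m + 2) * real (2 * m + 2)) * real (4 * L)"

text \<open>With m = d + 1: \<open>8 powr p\<close> compares values of the polynomial, the numerator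
  compares the weight with (R \<delta>)^d (\<delta> + s), and the denominator is the constant of
  \<open>measure_lift_ball\<close>.\<close>

definition mz_local_constant :: "nat \<Rightarrow> real \<Rightarrow> nat \<Rightarrow> real \<Rightarrow> real \<Rightarrow> real" where
  "mz_local_constant m B L V p =
     8 powr p * (2 ^ (m - 1) * B * mz_scale m L ^ m / ((1 / (48 * B\<^sup>2)) * (1 / (10 * B\<^sup>2)) ^ (m - 2) * V))"

lemma mz_scale_ge_1: "1 \<le> L \<Longrightarrow> 8 \<le> mz_scale m L"
proof -
  assume "1 \<le> L"
  have "2 * (1 * 1) * 4 \<le> mz_scale m L"
    unfolding mz_scale_def using \<open>1 \<le> L\<close> by (intro mult_mono one_le_power) auto
  then show ?thesis by simp
qed

context cap_chart
begin

text \<open>The point y is the image of the localised maximum for \<omega>. Of the 2 (d + 1) + 1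
  powers of decay, one is spent on comparing the weight at \<omega> with the measure of the ball
  around y; the others remain for counting.\<close>

lemma local_bound:
  assumes m: "2 \<le> CARD('n)" and d: "CARD('n) = d + 1" and P: "poly_fun_deg_le n P" and n: "1 \<le> n"
    and L: "1 \<le> L" "((1 + (1 - 1 / B)) / 2) ^ L \<le> 1 / 4" and p: "1 \<le> p" and \<omega>: "\<omega> \<in> cap"
  defines "N \<equiv> real (4 * L * n)"
  defines "\<delta> \<equiv> 1 / (mz_scale CARD('n) L * real n)"
  obtains y where "y \<in> cap"
    "\<bar>P \<omega>\<bar> powr p * cap_weight d e \<alpha> (1 / real n) \<omega> * (1 + N * norm (lift \<omega> - lift y)) ^ (2 * CARD('n))
      \<le> mz_local_constant CARD('n) B L (measure lborel (ball (0 :: real ^ 'n) (1 / 16))) p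
        * (\<integral>x. indicator {x \<in> cap. norm (lift x - lift y) \<le> \<delta>} x * \<bar>P x\<bar> powr p \<partial>sphere_measure)"
proof -
  define K where "K = 2 * CARD('n) + 1"
  define T where "T = mz_scale CARD('n) L"
  define V where "V = measure lborel (ball (0 :: real ^ 'n) (1 / 16))"
  define \<kappa> where "\<kappa> = (1 / (48 * B\<^sup>2)) * (1 / (10 * B\<^sup>2)) ^ (CARD('n) - 2) * V"
  have B: "1 \<le> B" "0 < B" using B_ge_1 by auto
  have V: "0 < V" unfolding V_def by (rule content_ball_pos) simp
  have \<kappa>: "0 < \<kappa>" using B V by (simp add: \<kappa>_def)
  have T: "8 \<le> T" unfolding T_def by (rule mz_scale_ge_1[OF L(1)])
  have \<delta>T: "\<delta> = 1 / (T * real n)" by (simp add: \<delta>_def T_def)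
  have n0: "1 \<le> real n" "0 < real n" using n by auto
  have "8 * 1 \<le> T * real n" using T n0 by (intro mult_mono) auto
  then have \<delta>: "0 < \<delta>" "\<delta> \<le> 1 / 4" unfolding \<delta>T by (auto simp: field_simps)
  have NT: "2 * (3 ^ (K + 1) * real (K + 1) * real (4 * L * n)) = T * real n"
    by (simp add: T_def mz_scale_def K_def)
  obtain x where x: "x \<in> hemisphere"
    "\<bar>P (chart (lift \<omega>))\<bar> * (1 + real (4 * L * n) * norm (lift \<omega> - x)) ^ K \<le> 2 * \<bar>P (chart x)\<bar>"
    "\<forall>z\<in>hemisphere. 2 * (3 ^ (K + 1) * real (K + 1) * real (4 * L * n)) * norm (z - x) \<le> 1 \<longrightarrow>
      \<bar>P (chart x)\<bar> \<le> 4 * \<bar>P (chart z)\<bar>"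
    by (rule localised_maximum_chart[OF m P n L lift_in_hemisphere[OF \<omega>], of K])
  define y where "y = chart x"
  have y: "y \<in> cap" unfolding y_def using x(1) chart_in_cap by (simp add: hemisphere_def)
  have ly: "lift y = x" unfolding y_def by (rule lift_chart[OF x(1)])
  define S where "S = {z \<in> cap. norm (lift z - lift y) \<le> \<delta>}"
  define I where "I = (\<integral>x. indicator S x * \<bar>P x\<bar> powr p \<partial>sphere_measure)"
  define t where "t = 1 + N * norm (lift \<omega> - lift y)"
  have N: "0 \<le> N" "real n \<le> N" using L n by (auto simp: N_def)
  have t: "1 \<le> t" using N by (simp add: t_def)
  have S: "S \<in> sets borel" "S \<subseteq> sphere 0 1"
    unfolding S_def by (rule lift_ball_borel) (auto simp: cap_def)
  have on_S: "\<bar>P y\<bar> / 4 \<le> \<bar>P z\<bar>" if "z \<in> S" for z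
  proof -
    have z: "z \<in> cap" "norm (lift z - x) \<le> \<delta>" using that by (auto simp: S_def ly)
    have "T * real n * norm (lift z - x) \<le> T * real n * \<delta>" using z T n0 by (intro mult_left_mono) auto
    also have "\<dots> = 1" using T n0 by (simp add: \<delta>T)
    finally have "2 * (3 ^ (K + 1) * real (K + 1) * real (4 * L * n)) * norm (lift z - x) \<le> 1" by (simp only: NT)
    then show ?thesis
      using bspec[OF x(3) lift_in_hemisphere[OF z(1)]] by (simp add: chart_lift[OF z(1)] y_def)
  qed
  have I_low: "measure sphere_measure S * (\<bar>P y\<bar> / 4) powr p \<le> I"
  proof -
    interpret finite_measure "sphere_measure :: (real ^ 'n) measure" by (rule finite_measure_sphere_measure)
    have Ss: "S \<in> sets sphere_measure" by (rule sphere_measure_sets[OF S])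
    have "measure sphere_measure S * (\<bar>P y\<bar> / 4) powr p
        = (\<integral>x. indicator S x * (\<bar>P y\<bar> / 4) powr p \<partial>sphere_measure)"
      using Ss S(2) by (simp add: Int_absorb2)
    also have "\<dots> \<le> I"
      unfolding I_def
    proof (rule integral_mono)
      show "integrable sphere_measure (\<lambda>x. indicator S x * (\<bar>P y\<bar> / 4) powr p)"
        using Ss by (intro integrable_mult_left integrable_real_indicator) (auto simp: emeasure_eq_measure)
      show "integrable sphere_measure (\<lambda>x. indicator S x * \<bar>P x\<bar> powr p)"
        using p by (intro integrable_poly_powr[OF P _ S]) simp
      show "indicator S z * (\<bar>P y\<bar> / 4) powr p \<le> indicator S z * \<bar>P z\<bar> powr p" for z
        using on_S[of z] p by (auto simp: indicator_def intro!: powr_mono2)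
    qed
    finally show ?thesis .
  qed
  have value_le: "\<bar>P \<omega>\<bar> powr p * t ^ K \<le> 8 powr p * (\<bar>P y\<bar> / 4) powr p"
  proof -
    have tK: "1 \<le> t ^ K" using t by (rule one_le_power)
    \<comment> \<open>This is where p \<ge> 1 keeps K independent of p.\<close>
    then have "t ^ K \<le> (t ^ K) powr p" using p powr_mono[of 1 p "t ^ K"] by simp
    then have "\<bar>P \<omega>\<bar> powr p * t ^ K \<le> \<bar>P \<omega>\<bar> powr p * (t ^ K) powr p" by (intro mult_left_mono) auto
    also have "\<dots> = (\<bar>P \<omega>\<bar> * t ^ K) powr p" using tK by (simp add: powr_mult)
    also have "\<dots> \<le> (2 * \<bar>P y\<bar>) powr p"
      using x(2) p t by (intro powr_mono2) (auto simp: chart_lift[OF \<omega>] y_def t_def N_def ly[unfolded y_def])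
    also have "2 * \<bar>P y\<bar> = 8 * (\<bar>P y\<bar> / 4)" by simp
    also have "\<dots> powr p = 8 powr p * (\<bar>P y\<bar> / 4) powr p" by (rule powr_mult)
    finally show ?thesis .
  qed
  have sy: "0 \<le> lift y \<bullet> e"
    using lift_in_hemisphere[OF y] by (simp add: hemisphere_def)
  have "cap_weight d e \<alpha> (1 / real n) \<omega>
      \<le> 2 ^ (CARD('n) - 1) * B * T ^ CARD('n) * ((R * \<delta>) ^ (CARD('n) - 1) * (\<delta> + lift y \<bullet> e)) * t"
  proof -
    have "cap_weight d e \<alpha> (1 / real n) \<omega> \<le> (2 * R) ^ d * (1 / real n) ^ d * (1 / real n + B * (lift \<omega> \<bullet> e))"
      using cap_weight_chart_le[OF lift_in_hemisphere[OF \<omega>], of "1 / real n" d] by (simp add: chart_lift[OF \<omega>])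
    \<comment> \<open>Heights are 1-Lipschitz, so at scale 1/n the move from \<omega> to y costs one
      factor t.\<close>
    also have "1 / real n + B * (lift \<omega> \<bullet> e) \<le> B * (T * (\<delta> + lift y \<bullet> e) * t)"
    proof -
      have nd: "1 / real n = T * \<delta>" using T by (simp add: \<delta>T)
      have "lift \<omega> \<bullet> e \<le> lift y \<bullet> e + norm (lift \<omega> - lift y)"
        using inner_e_diff_le[of "lift \<omega>" "lift y"] by (simp add: abs_le_iff)
      also have "norm (lift \<omega> - lift y) = 1 / real n * (real n * norm (lift \<omega> - lift y))" using n0 by simp
      also have "\<dots> \<le> 1 / real n * (N * norm (lift \<omega> - lift y))"
        using N by (intro mult_left_mono mult_right_mono) auto
      finally have "1 / real n + lift \<omega> \<bullet> e \<le> 1 / real n * t + lift y \<bullet> e" by (simp add: t_def distrib_left)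
      also have "\<dots> \<le> 1 / real n * t + lift y \<bullet> e * t" using sy t by (simp add: mult_left_mono[of 1 t, simplified])
      also have "\<dots> = (T * \<delta> + 1 * (lift y \<bullet> e)) * t" unfolding nd by (simp add: distrib_right)
      also have "\<dots> \<le> (T * \<delta> + T * (lift y \<bullet> e)) * t"
        using T sy t by (intro mult_right_mono add_left_mono) auto
      finally have *: "1 / real n + lift \<omega> \<bullet> e \<le> T * (\<delta> + lift y \<bullet> e) * t" by (simp only: distrib_left)
      have "1 * (1 / real n) + B * (lift \<omega> \<bullet> e) \<le> B * (1 / real n) + B * (lift \<omega> \<bullet> e)"
        using B by (intro add_right_mono mult_right_mono) auto
      also have "\<dots> = B * (1 / real n + lift \<omega> \<bullet> e)" by (simp only: distrib_left)
      also have "\<dots> \<le> B * (T * (\<delta> + lift y \<bullet> e) * t)" using * B by (intro mult_left_mono) auto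
      finally show ?thesis by simp
    qed
    then have "(2 * R) ^ d * (1 / real n) ^ d * (1 / real n + B * (lift \<omega> \<bullet> e))
        \<le> (2 * R) ^ d * (1 / real n) ^ d * (B * (T * (\<delta> + lift y \<bullet> e) * t))"
      using R_pos by (intro mult_left_mono) auto
    also have "\<dots> = 2 ^ d * B * T ^ (d + 1) * ((R * \<delta>) ^ d * (\<delta> + lift y \<bullet> e)) * t"
    proof -
      have nd: "1 / real n = T * \<delta>" using T by (simp add: \<delta>T)
      show ?thesis unfolding nd by (simp add: power_mult_distrib)
    qed
    finally show ?thesis by (simp add: d)
  qed
  also have "\<dots> \<le> 2 ^ (CARD('n) - 1) * B * T ^ CARD('n) * (measure sphere_measure S / \<kappa>) * t"
  proof -
    have "\<kappa> * ((R * \<delta>) ^ (CARD('n) - 1) * (\<delta> + lift y \<bullet> e)) \<le> measure sphere_measure S"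
      using measure_lift_ball[OF y \<delta> m] by (simp only: \<kappa>_def V_def S_def)
    then have "(R * \<delta>) ^ (CARD('n) - 1) * (\<delta> + lift y \<bullet> e) \<le> measure sphere_measure S / \<kappa>"
      using \<kappa> by (simp add: pos_le_divide_eq mult.commute)
    then show ?thesis using B T t by (intro mult_right_mono mult_left_mono) auto
  qed
  finally have w: "cap_weight d e \<alpha> (1 / real n) \<omega>
      \<le> (2 ^ (CARD('n) - 1) * B * T ^ CARD('n) / \<kappa>) * measure sphere_measure S * t" by simp
  define C where "C = 2 ^ (CARD('n) - 1) * B * T ^ CARD('n) / \<kappa>"
  have C: "0 \<le> C" using B T \<kappa> by (simp add: C_def)
  have "\<bar>P \<omega>\<bar> powr p * cap_weight d e \<alpha> (1 / real n) \<omega> * t ^ (2 * CARD('n))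
      \<le> \<bar>P \<omega>\<bar> powr p * (C * measure sphere_measure S * t) * t ^ (2 * CARD('n))"
    using w t by (intro mult_right_mono mult_left_mono) (auto simp: C_def)
  also have "\<dots> = C * measure sphere_measure S * (\<bar>P \<omega>\<bar> powr p * t ^ K)" by (simp add: K_def)
  also have "\<dots> \<le> C * measure sphere_measure S * (8 powr p * (\<bar>P y\<bar> / 4) powr p)"
    using C value_le by (intro mult_left_mono) auto
  also have "\<dots> = 8 powr p * C * (measure sphere_measure S * (\<bar>P y\<bar> / 4) powr p)" by simp
  also have "\<dots> \<le> 8 powr p * C * I" using C I_low by (intro mult_left_mono) auto
  also have "8 powr p * C = mz_local_constant CARD('n) B L V p"
    by (simp add: mz_local_constant_def C_def T_def \<kappa>_def)
  finally have final: "\<bar>P \<omega>\<bar> powr p * cap_weight d e \<alpha> (1 / real n) \<omega> * t ^ (2 * CARD('n))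
      \<le> mz_local_constant CARD('n) B L V p * I" .
  show thesis by (rule that[OF y final[unfolded t_def I_def S_def V_def]])
qed

text \<open>The radius 1 / (4 B N) makes \<open>\<rho>\<close> at most 1/N \<le> 1/n by the
  Lipschitz bound 4 B.\<close>

lemma cap_rho_ball_count:
  assumes fin: "finite \<Lambda>" and sub: "\<Lambda> \<subseteq> cap" and n: "1 \<le> n" and N: "real n \<le> N" and a: "a \<in> \<Lambda>"
  shows "card {b \<in> \<Lambda>. norm (lift a - lift b) \<le> (1 / (4 * B)) / N}
    \<le> Max ((\<lambda>x. card (\<Lambda> \<inter> cap_rho_ball e \<alpha> x (1 / real n))) ` cap)"
proof -
  have B: "0 < B" using B_ge_1 by linarith
  have aC: "a \<in> cap" using a sub by auto
  have "{b \<in> \<Lambda>. norm (lift a - lift b) \<le> (1 / (4 * B)) / N} \<subseteq> \<Lambda> \<inter> cap_rho_ball e \<alpha> a (1 / real n)"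
  proof
    fix b assume "b \<in> {b \<in> \<Lambda>. norm (lift a - lift b) \<le> (1 / (4 * B)) / N}"
    then have b: "b \<in> \<Lambda>" "norm (lift a - lift b) \<le> (1 / (4 * B)) / N" by auto
    have bC: "b \<in> cap" using b sub by auto
    have "cap_rho e \<alpha> a b \<le> 4 * B * norm (lift a - lift b)"
      using cap_rho_chart_le[OF lift_in_hemisphere[OF aC] lift_in_hemisphere[OF bC]]
      by (simp add: chart_lift[OF aC] chart_lift[OF bC])
    also have "\<dots> \<le> 4 * B * ((1 / (4 * B)) / N)" using b B by (intro mult_left_mono) auto
    also have "\<dots> = 1 / N" using B by simp
    also have "\<dots> \<le> 1 / real n" using n N by (intro divide_left_mono) auto
    finally show "b \<in> \<Lambda> \<inter> cap_rho_ball e \<alpha> a (1 / real n)"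
      using b bC by (simp add: cap_rho_ball_def sph_cap_eq)
  qed
  then have "card {b \<in> \<Lambda>. norm (lift a - lift b) \<le> (1 / (4 * B)) / N} \<le> card (\<Lambda> \<inter> cap_rho_ball e \<alpha> a (1 / real n))"
    using fin by (intro card_mono) auto
  also have "\<dots> \<le> Max ((\<lambda>x. card (\<Lambda> \<inter> cap_rho_ball e \<alpha> x (1 / real n))) ` cap)"
  proof (rule Max_ge)
    \<comment> \<open>\<open>Max\<close> is meaningful although x runs over an infinite cap: the
      counts are bounded by the cardinality of \<Lambda>.\<close>
    have "(\<lambda>x. card (\<Lambda> \<inter> cap_rho_ball e \<alpha> x (1 / real n))) ` cap \<subseteq> {..card \<Lambda>}"
      using fin by (auto intro!: card_mono)
    then show "finite ((\<lambda>x. card (\<Lambda> \<inter> cap_rho_ball e \<alpha> x (1 / real n))) ` cap)"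
      by (rule finite_subset) simp
  qed (use aC in auto)
  finally show ?thesis .
qed

text \<open>Summing the local bounds and exchanging sum and integral leaves a pointwise bound for a
  weighted overlap of the lifted balls, which the cell count provides.\<close>

lemma marcinkiewicz_upper:
  assumes m: "2 \<le> CARD('n)" and d: "CARD('n) = d + 1" and P: "poly_fun_deg_le n P" and n: "1 \<le> n"
    and L: "1 \<le> L" "((1 + (1 - 1 / B)) / 2) ^ L \<le> 1 / 4" and p: "1 \<le> p"
    and fin: "finite \<Lambda>" and sub: "\<Lambda> \<subseteq> cap"
  shows "(\<Sum>\<omega>\<in>\<Lambda>. \<bar>P \<omega>\<bar> powr p * cap_weight d e \<alpha> (1 / real n) \<omega>)
    \<le> mz_local_constant CARD('n) B L (measure lborel (ball (0 :: real ^ 'n) (1 / 16))) p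
        * 2 ^ (2 * CARD('n)) * (16 * (CARD('n) / (1 / (4 * B)))\<^sup>2) ^ CARD('n)
        * real (Max ((\<lambda>x. card (\<Lambda> \<inter> cap_rho_ball e \<alpha> x (1 / real n))) ` cap))
        * (\<integral>x. indicator cap x * \<bar>P x\<bar> powr p \<partial>sphere_measure)"
proof -
  define N where "N = real (4 * L * n)"
  define \<delta> where "\<delta> = 1 / (mz_scale CARD('n) L * real n)"
  define C where "C = mz_local_constant CARD('n) B L (measure lborel (ball (0 :: real ^ 'n) (1 / 16))) p"
  define D where "D = (16 * (CARD('n) / (1 / (4 * B)))\<^sup>2) ^ CARD('n)"
  define t where "t = Max ((\<lambda>x. card (\<Lambda> \<inter> cap_rho_ball e \<alpha> x (1 / real n))) ` cap)"
  define S where "S y = {x \<in> cap. norm (lift x - lift y) \<le> \<delta>}" for y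
  have B: "1 \<le> B" "0 < B" using B_ge_1 by auto
  have T: "8 \<le> mz_scale CARD('n) L" by (rule mz_scale_ge_1[OF L(1)])
  have C: "0 \<le> C" unfolding C_def mz_local_constant_def using B T by simp
  have N: "real n \<le> N" "0 < N" using L n by (auto simp: N_def)
  \<comment> \<open>The balls are small at the scale of the weights, so replacing their centres by
    any of their points costs a factor 2 per power.\<close>
  have N\<delta>: "N * \<delta> \<le> 1"
  proof -
    have "real (4 * L) * 1 \<le> real (4 * L) * (2 * (3 ^ (2 * CARD('n) + 2) * real (2 * CARD('n) + 2)))"
    proof (rule mult_left_mono)
      have "1 * (1 * 1) \<le> (2::real) * (3 ^ (2 * CARD('n) + 2) * real (2 * CARD('n) + 2))"
        by (intro mult_mono one_le_power) auto
      then show "1 \<le> (2::real) * (3 ^ (2 * CARD('n) + 2) * real (2 * CARD('n) + 2))" by simp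
    qed simp
    then have "real (4 * L) \<le> mz_scale CARD('n) L" by (simp add: mz_scale_def mult_ac)
    then have "N \<le> mz_scale CARD('n) L * real n" by (simp add: N_def mult_right_mono)
    then show ?thesis using T n by (simp add: \<delta>_def divide_le_eq)
  qed
  have "\<forall>\<omega>\<in>\<Lambda>. \<exists>y. y \<in> cap \<and>
      \<bar>P \<omega>\<bar> powr p * cap_weight d e \<alpha> (1 / real n) \<omega> * (1 + N * norm (lift \<omega> - lift y)) ^ (2 * CARD('n))
        \<le> C * (\<integral>x. indicator (S y) x * \<bar>P x\<bar> powr p \<partial>sphere_measure)"
  proof
    fix \<omega> assume "\<omega> \<in> \<Lambda>"
    then have "\<omega> \<in> cap" using sub by auto
    then obtain y where "y \<in> cap"
      "\<bar>P \<omega>\<bar> powr p * cap_weight d e \<alpha> (1 / real n) \<omega> * (1 + N * norm (lift \<omega> - lift y)) ^ (2 * CARD('n))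
        \<le> C * (\<integral>x. indicator (S y) x * \<bar>P x\<bar> powr p \<partial>sphere_measure)"
      by (rule local_bound[OF m d P n L p, folded N_def C_def \<delta>_def, folded S_def])
    then show "\<exists>y. y \<in> cap \<and>
      \<bar>P \<omega>\<bar> powr p * cap_weight d e \<alpha> (1 / real n) \<omega> * (1 + N * norm (lift \<omega> - lift y)) ^ (2 * CARD('n))
        \<le> C * (\<integral>x. indicator (S y) x * \<bar>P x\<bar> powr p \<partial>sphere_measure)" by blast
  qed
  from bchoice[OF this] obtain y where "\<forall>\<omega>\<in>\<Lambda>. y \<omega> \<in> cap \<and>
      \<bar>P \<omega>\<bar> powr p * cap_weight d e \<alpha> (1 / real n) \<omega> * (1 + N * norm (lift \<omega> - lift (y \<omega>))) ^ (2 * CARD('n))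
        \<le> C * (\<integral>x. indicator (S (y \<omega>)) x * \<bar>P x\<bar> powr p \<partial>sphere_measure)" ..
  note y = this[THEN bspec]
  define k where "k \<omega> = 1 / (1 + N * norm (lift \<omega> - lift (y \<omega>))) ^ (2 * CARD('n))" for \<omega>
  have Sb: "S z \<in> sets borel" "S z \<subseteq> sphere 0 1" for z
    unfolding S_def by (rule lift_ball_borel) (auto simp: cap_def)
  have int: "integrable sphere_measure (\<lambda>x. indicator (S z) x * \<bar>P x\<bar> powr p)" for z
    using p by (intro integrable_poly_powr[OF P _ Sb]) simp
  have term_le: "\<bar>P \<omega>\<bar> powr p * cap_weight d e \<alpha> (1 / real n) \<omega>
      \<le> C * (k \<omega> * (\<integral>x. indicator (S (y \<omega>)) x * \<bar>P x\<bar> powr p \<partial>sphere_measure))" if "\<omega> \<in> \<Lambda>" for \<omega>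
  proof -
    have "0 < (1 + N * norm (lift \<omega> - lift (y \<omega>))) ^ (2 * CARD('n))"
      using N by (intro zero_less_power add_pos_nonneg) auto
    then show ?thesis using y[OF that] by (simp add: k_def field_simps)
  qed
  \<comment> \<open>Different \<omega> may share the same y, so overlaps are counted through the
    \<omega>: if x lies in the ball of y, the weight is moved from y to x and the count of \<Lambda>
    applies around x.\<close>
  have pointwise: "(\<Sum>\<omega>\<in>\<Lambda>. k \<omega> * (indicator (S (y \<omega>)) x * \<bar>P x\<bar> powr p))
      \<le> (2 ^ (2 * CARD('n)) * D * real t) * (indicator cap x * \<bar>P x\<bar> powr p)" for x
  proof (cases "x \<in> cap")
    case False
    then have "x \<notin> S z" for z by (simp add: S_def)
    then show ?thesis using False by simp
  next
    case True
    have "k \<omega> * indicator (S (y \<omega>)) x \<le> 2 ^ (2 * CARD('n)) * (1 / (1 + N * norm (lift \<omega> - lift x)) ^ (2 * CARD('n)))"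
      if "\<omega> \<in> \<Lambda>" for \<omega>
    proof (cases "x \<in> S (y \<omega>)")
      case False
      have "0 \<le> 1 + N * norm (lift \<omega> - lift x)" using N by simp
      then show ?thesis using False by simp
    next
      case True
      then have "norm (lift x - lift (y \<omega>)) \<le> \<delta>" by (simp add: S_def)
      then have "N * norm (lift x - lift (y \<omega>)) \<le> N * \<delta>" using N by (intro mult_left_mono) auto
      then have "N * norm (lift x - lift (y \<omega>)) \<le> 1" using N\<delta> by linarith
      moreover have "norm (lift \<omega> - lift x) \<le> norm (lift \<omega> - lift (y \<omega>)) + norm (lift x - lift (y \<omega>))"
        using norm_triangle_ineq4[of "lift \<omega> - lift (y \<omega>)" "lift x - lift (y \<omega>)"] by simp
      then have "N * norm (lift \<omega> - lift x) \<le> N * norm (lift \<omega> - lift (y \<omega>)) + N * norm (lift x - lift (y \<omega>))"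
        using N by (simp add: mult_left_mono flip: distrib_left)
      moreover have "0 \<le> N * norm (lift \<omega> - lift (y \<omega>))" using N by simp
      moreover have "1 + b \<le> 2 * (1 + a)" if "c \<le> 1" "b \<le> a + c" "0 \<le> a" for a b c :: real
        using that by argo
      ultimately have "1 + N * norm (lift \<omega> - lift x) \<le> 2 * (1 + N * norm (lift \<omega> - lift (y \<omega>)))" by blast
      then have "(1 + N * norm (lift \<omega> - lift x)) ^ (2 * CARD('n))
          \<le> (2 * (1 + N * norm (lift \<omega> - lift (y \<omega>)))) ^ (2 * CARD('n))"
        using N by (intro power_mono) auto
      then have "(1 + N * norm (lift \<omega> - lift x)) ^ (2 * CARD('n))
          \<le> 2 ^ (2 * CARD('n)) * (1 + N * norm (lift \<omega> - lift (y \<omega>))) ^ (2 * CARD('n))"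
        by (simp only: power_mult_distrib)
      moreover have "0 < (1 + N * norm (lift \<omega> - lift z)) ^ (2 * CARD('n))" for z
        using N by (intro zero_less_power add_pos_nonneg) auto
      ultimately show ?thesis using True by (simp add: k_def divide_le_eq)
    qed
    then have "(\<Sum>\<omega>\<in>\<Lambda>. k \<omega> * indicator (S (y \<omega>)) x)
        \<le> (\<Sum>\<omega>\<in>\<Lambda>. 2 ^ (2 * CARD('n)) * (1 / (1 + N * norm (lift \<omega> - lift x)) ^ (2 * CARD('n))))"
      by (rule sum_mono)
    also have "\<dots> = 2 ^ (2 * CARD('n)) * (\<Sum>\<omega>\<in>\<Lambda>. 1 / (1 + N * norm (lift \<omega> - lift x)) ^ (2 * CARD('n)))"
      by (simp only: sum_distrib_left)
    also have "\<dots> \<le> 2 ^ (2 * CARD('n)) * (D * real t)"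
      unfolding D_def t_def using B
      by (intro mult_left_mono weighted_count_le[OF fin N(2)] cap_rho_ball_count[OF fin sub n N(1)])
         (auto simp: divide_le_eq)
    finally have "(\<Sum>\<omega>\<in>\<Lambda>. k \<omega> * indicator (S (y \<omega>)) x) * \<bar>P x\<bar> powr p
        \<le> 2 ^ (2 * CARD('n)) * (D * real t) * \<bar>P x\<bar> powr p"
      by (rule mult_right_mono) simp
    then show ?thesis using True by (simp add: sum_distrib_right mult.assoc)
  qed
  have "(\<Sum>\<omega>\<in>\<Lambda>. \<bar>P \<omega>\<bar> powr p * cap_weight d e \<alpha> (1 / real n) \<omega>)
      \<le> (\<Sum>\<omega>\<in>\<Lambda>. C * (k \<omega> * (\<integral>x. indicator (S (y \<omega>)) x * \<bar>P x\<bar> powr p \<partial>sphere_measure)))"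
    by (intro sum_mono term_le)
  also have "\<dots> = C * (\<integral>x. (\<Sum>\<omega>\<in>\<Lambda>. k \<omega> * (indicator (S (y \<omega>)) x * \<bar>P x\<bar> powr p)) \<partial>sphere_measure)"
    using int by (simp add: Bochner_Integration.integral_sum sum_distrib_left)
  also have "\<dots> \<le> C * (\<integral>x. (2 ^ (2 * CARD('n)) * D * real t) * (indicator cap x * \<bar>P x\<bar> powr p) \<partial>sphere_measure)"
  proof (intro mult_left_mono integral_mono pointwise C)
    show "integrable sphere_measure (\<lambda>x. \<Sum>\<omega>\<in>\<Lambda>. k \<omega> * (indicator (S (y \<omega>)) x * \<bar>P x\<bar> powr p))"
      by (intro Bochner_Integration.integrable_sum integrable_mult_right int)
    have "cap \<subseteq> sphere 0 1" by (auto simp: cap_def)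
    then show "integrable sphere_measure (\<lambda>x. (2 ^ (2 * CARD('n)) * D * real t) * (indicator cap x * \<bar>P x\<bar> powr p))"
      using p by (intro integrable_mult_right integrable_poly_powr[OF P _ cap_borel]) auto
  qed
  also have "\<dots> = C * 2 ^ (2 * CARD('n)) * D * real t * (\<integral>x. indicator cap x * \<bar>P x\<bar> powr p \<partial>sphere_measure)"
    by simp
  finally show ?thesis by (simp only: C_def D_def t_def)
qed

end

section \<open>Constants uniform over all caps\<close>

theorem corollary1p3:
  fixes d :: nat and \<epsilon> p :: real
  assumes "d \<ge> 1" and "CARD('n::finite) = d + 1"
    and "0 < \<epsilon>" and "\<epsilon> < 1" and "1 \<le> p"
  shows "\<exists>C>0. \<forall>e \<in> sphere (0 :: real ^ 'n) 1. \<forall>\<alpha>. 0 < \<alpha> \<and> \<alpha> \<le> pi - \<epsilon> \<longrightarrow>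
    (\<forall>n::nat. n \<ge> 1 \<longrightarrow>
      (\<forall>\<Lambda>. finite \<Lambda> \<and> \<Lambda> \<subseteq> sph_cap e \<alpha> \<longrightarrow>
        (\<forall>f \<in> spherical_polynomials n.
          (\<Sum>\<omega>\<in>\<Lambda>. \<bar>f \<omega>\<bar> powr p * cap_weight d e \<alpha> (1 / real n) \<omega>)
          \<le> C * real (Max ((\<lambda>x. card (\<Lambda> \<inter> cap_rho_ball e \<alpha> x (1 / real n))) ` sph_cap e \<alpha>))
              * set_lebesgue_integral sphere_measure (sph_cap e \<alpha>) (\<lambda>x. \<bar>f x\<bar> powr p))))"
proof -
  \<comment> \<open>The largest value of 1 + tan(\<alpha>/2)^2 over admissible \<alpha>; it is
    finite as \<epsilon> keeps the half angle below a right angle.\<close>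
  define B where "B = 1 + (tan ((pi - \<epsilon>) / 2))\<^sup>2"
  have B: "1 \<le> B" by (simp add: B_def)
  define \<theta> where "\<theta> = (1 + (1 - 1 / B)) / 2"
  have "0 < 1 / B" using B by simp
  then have "\<theta> < 1" by (simp add: \<theta>_def)
  \<comment> \<open>The Chernoff multiplier depends on \<epsilon> alone, so degrees stay
    proportional to n uniformly in the cap.\<close>
  then obtain L0 where L0: "\<theta> ^ L0 < 1 / 4" using real_arch_pow_inv[of "1 / 4" \<theta>] by auto
  have "1 / B \<le> 1" using B by simp
  then have \<theta>0: "0 \<le> \<theta>" by (simp add: \<theta>_def)
  define L where "L = Suc L0"
  have "\<theta> ^ L \<le> \<theta> ^ L0" using \<theta>0 \<open>\<theta> < 1\<close> by (intro power_decreasing) (auto simp: L_def)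
  then have L: "1 \<le> L" "\<theta> ^ L \<le> 1 / 4" using L0 by (auto simp: L_def)
  define V where "V = measure lborel (ball (0 :: real ^ 'n) (1 / 16))"
  have V: "0 < V" unfolding V_def by (rule content_ball_pos) simp
  define C where "C = mz_local_constant CARD('n) B L V p
        * 2 ^ (2 * CARD('n)) * (16 * (CARD('n) / (1 / (4 * B)))\<^sup>2) ^ CARD('n)"
  have m: "2 \<le> CARD('n)" using assms(1,2) by simp
  have T: "8 \<le> mz_scale CARD('n) L" by (rule mz_scale_ge_1[OF L(1)])
  have "0 < mz_local_constant CARD('n) B L V p"
    unfolding mz_local_constant_def using B T V by (intro mult_pos_pos divide_pos_pos zero_less_power) auto
  moreover have "0 < (16 * (CARD('n) / (1 / (4 * B)))\<^sup>2) ^ CARD('n)"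
    using B m by (intro zero_less_power mult_pos_pos) auto
  ultimately have C: "0 < C" by (simp add: C_def)
  show ?thesis
  proof (intro exI[of _ C] conjI C ballI allI impI)
    fix e :: "real ^ 'n" and \<alpha> :: real and n :: nat and \<Lambda> :: "(real ^ 'n) set" and f :: "real ^ 'n \<Rightarrow> real"
    assume e: "e \<in> sphere 0 1" and \<alpha>: "0 < \<alpha> \<and> \<alpha> \<le> pi - \<epsilon>" and n: "1 \<le> n"
      and \<Lambda>: "finite \<Lambda> \<and> \<Lambda> \<subseteq> sph_cap e \<alpha>" and f: "f \<in> spherical_polynomials n"
    define R where "R = tan (\<alpha> / 2)"
    have "0 < R" unfolding R_def using \<alpha> assms(3) by (intro tan_gt_zero) auto
    have "R \<le> tan ((pi - \<epsilon>) / 2)"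
      unfolding R_def using \<alpha> assms(3) by (intro tan_mono_le) auto
    then have "1 + R\<^sup>2 \<le> B" using \<open>0 < R\<close> by (simp add: B_def power_mono)
    then interpret cap_chart e R B using e \<open>0 < R\<close> by unfold_locales auto
    have \<alpha>R: "2 * arctan R = \<alpha>" unfolding R_def using \<alpha> assms(3) by (subst arctan_tan) auto
    \<comment> \<open>\<open>f\<close> agrees with a polynomial only on the sphere; both sides of
      the inequality see just those values.\<close>
    obtain P where P: "poly_fun_deg_le n P" "\<And>x. x \<in> sphere 0 1 \<Longrightarrow> f x = P x"
      using f by (auto simp: spherical_polynomials_def)
    have cap: "sph_cap e \<alpha> = cap" using sph_cap_eq by (simp only: \<alpha>R)
    have capS: "cap \<subseteq> sphere 0 1" by (auto simp: cap_def)
    have "(\<Sum>\<omega>\<in>\<Lambda>. \<bar>f \<omega>\<bar> powr p * cap_weight d e \<alpha> (1 / real n) \<omega>)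
        = (\<Sum>\<omega>\<in>\<Lambda>. \<bar>P \<omega>\<bar> powr p * cap_weight d e \<alpha> (1 / real n) \<omega>)"
      using \<Lambda> capS P(2) by (intro sum.cong) (auto simp: cap)
    also have "\<dots> \<le> C * real (Max ((\<lambda>x. card (\<Lambda> \<inter> cap_rho_ball e \<alpha> x (1 / real n))) ` cap))
        * (\<integral>x. indicator cap x * \<bar>P x\<bar> powr p \<partial>sphere_measure)"
      using marcinkiewicz_upper[OF m assms(2) P(1) n L(1) _ assms(5), of \<Lambda>] \<Lambda> L(2)
      by (simp add: \<alpha>R cap C_def V_def \<theta>_def)
    also have "(\<integral>x. indicator cap x * \<bar>P x\<bar> powr p \<partial>sphere_measure)
        = set_lebesgue_integral sphere_measure (sph_cap e \<alpha>) (\<lambda>x. \<bar>f x\<bar> powr p)"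
      unfolding set_lebesgue_integral_def cap
      by (rule Bochner_Integration.integral_cong) (auto simp: P(2))
    finally show "(\<Sum>\<omega>\<in>\<Lambda>. \<bar>f \<omega>\<bar> powr p * cap_weight d e \<alpha> (1 / real n) \<omega>)
        \<le> C * real (Max ((\<lambda>x. card (\<Lambda> \<inter> cap_rho_ball e \<alpha> x (1 / real n))) ` sph_cap e \<alpha>))
          * set_lebesgue_integral sphere_measure (sph_cap e \<alpha>) (\<lambda>x. \<bar>f x\<bar> powr p)"
      by (simp only: cap)
  qed
qed

end
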